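(* Let $T$ be any one of the three intervals $\left(-\frac12,-\frac15\right)$, $\left(-\frac15,\frac1{10}\right)$, $\left(\frac1{10},\frac25\right)$. Let $h$ be absolutely monotone with $h^{(6)}>0$ in $(-1,1)$, and let $C\subset\mathbb{S}^{22}$ be a $T$-avoiding spherical code with $|C|=11178$. Then $$E_h(C)\ \ge\ \mathcal{E}_h(23,11178;T)=11178\left(352\,h\!\left(-\tfrac12\right)+4125\,h\!\left(-\tfrac15\right)+5600\,h\!\left(\tfrac1{10}\right)+1100\,h\!\left(\tfrac25\right)\right).$$ Equality $E_h(C)=\mathcal{E}_h(23,11178;T)$ is attained when $C$ is a spherical $5$-design with $I(C)=\{-\frac12,-\frac15,\frac1{10},\frac25\}$ (and hence a distance-invariant code) and with distance distribution $(352,4125,5600,1100)$. In particular, the code $C_{\sqrt6/6}$ is a $T$-avoiding universally optimal code on $\mathbb{S}^{22}$.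
   Context: A spherical code is a finite set $C\subset\mathbb{S}^{n-1}$; $I(C)=\{x\cdot y: x,y\in C,\ x\ne y\}$. For $T\subset[-1,1)$, $C$ is $T$-avoiding if $I(C)\cap T=\varnothing$. A spherical $\tau$-design is a spherical code $C$ such that the average over $C$ of every polynomial in $n$ variables of total degree at most $\tau$ equals its average over $\mathbb{S}^{n-1}$ with respect to normalized surface measure. A potential is a function $h:[-1,1)\to(-\infty,+\infty)$, continuous on $[-1,1)$; it is absolutely monotone if $h^{(j)}\ge0$ for all $j\ge1$ (on $(-1,1)$). The $h$-energy is $E_h(C)=\sum_{x\neq y\in C}h(x\cdot y)$ (sum over ordered pairs). $\mathcal{E}_h(n,N;T)$ is the minimum of $E_h(C)$ over all $T$-avoiding spherical codes $C\subset\mathbb{S}^{n-1}$ with $|C|=N$. For $T$ open, a code $C\subset\mathbb{S}^{n-1}$ is $T$-avoiding universally optimal if it is $T$-avoiding and, for every absolutely monotone $h$, it minimizes $E_h$ among all $T$-avoiding codes on $\mathbb{S}^{n-1}$ of cardinality $|C|$. A code $C$ is distance invariant if for each $t\in I(C)$ the number $A_t=|\{y\in C: x\cdot y=t\}|$ does not depend on $x\in C$; its distance distribution is the tuple $(A_t)$ listed in increasing order of $t\in I(C)$. The code $C_{\sqrt6/6}$: let $L\subset\mathbb{S}^{23}$ be the set of the $196560$ minimal vectors (length $2$) of the Leech lattice $\Lambda_{24}$ (the even unimodular lattice in $\mathbb{R}^{24}$ of minimum norm $4$) rescaled to unit length. Let $W\in\Lambda_{24}$ be a vector of length $\sqrt6$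 and $\widetilde w=W/\sqrt6$. With $\alpha=\frac{\sqrt6}6$, $C_{\sqrt6/6}$ is the set of vectors $(y-\alpha\widetilde w)/\sqrt{1-\alpha^2}$ with $y\in L$, $y\cdot\widetilde w=\alpha$, regarded as a subset of the unit sphere $\mathbb{S}^{22}$ of $\widetilde w^\perp\cong\mathbb{R}^{23}$. It is a spherical $5$-design with $11178$ points, with the inner products and distance distribution listed in the claim. *)

theory Defs
  imports "HOL-Analysis.Analysis"
begin

section \<open>Spherical codes\<close>

definition spherical_code :: "(real ^ 'n) set \<Rightarrow> bool" where
  "spherical_code C \<longleftrightarrow> finite C \<and> C \<subseteq> sphere 0 1"

definition inner_products :: "(real ^ 'n) set \<Rightarrow> real set" where
  "inner_products C = {x \<bullet> y | x y. x \<in> C \<and> y \<in> C \<and> x \<noteq> y}"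

definition avoiding_code :: "real set \<Rightarrow> (real ^ 'n) set \<Rightarrow> bool" where
  "avoiding_code T C \<longleftrightarrow> spherical_code C \<and> inner_products C \<inter> T = {}"

definition distance_invariant :: "(real ^ 'n) set \<Rightarrow> bool" where
  "distance_invariant C \<longleftrightarrow>
     (\<forall>t\<in>inner_products C. \<forall>x\<in>C. \<forall>x'\<in>C.
        card {y \<in> C. x \<bullet> y = t} = card {y \<in> C. x' \<bullet> y = t})"

text \<open>Only meaningful for finite, distance-invariant codes, where the described number exists
  and is unique.\<close>

definition distance_distribution :: "(real ^ 'n) set \<Rightarrow> nat list" where
  "distance_distribution C =
     map (\<lambda>t. THE a. \<forall>x\<in>C. card {y \<in> C. x \<bullet> y = t} = a)
       (sorted_list_of_set (inner_products C))"


section \<open>Spherical designs\<close>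

text \<open>Normalized surface measure on the unit sphere, as the radial projection of the uniform
  distribution on the unit ball: a Borel set \<open>A\<close> of the sphere gets the volume of the cone
  \<open>{r x | 0 < r < 1, x \<in> A}\<close> divided by that of the ball. Recall \<open>sgn x = x /\<^sub>R norm x\<close>; the origin,
  where \<open>sgn\<close> vanishes, is a null set. The measure lives on the whole space and is concentrated
  on the sphere.\<close>

definition surface_measure :: "(real ^ 'n) measure" where
  "surface_measure = distr (uniform_measure lborel (ball 0 1)) borel sgn"

text \<open>Polynomial functions in the coordinates, of total degree at most \<open>d\<close>; the exponent vectors
  \<open>m\<close> range over a finite set.\<close>

definition polynomials_upto :: "nat \<Rightarrow> (real ^ 'n \<Rightarrow> real) set" where
  "polynomials_upto d =
     {(\<lambda>x. \<Sum>m\<in>{m :: 'n \<Rightarrow> nat. (\<Sum>i\<in>UNIV. m i) \<le> d}. c m * (\<Prod>i\<in>UNIV. (x $ i) ^ m i)) | c. True}"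

definition spherical_design :: "nat \<Rightarrow> (real ^ 'n) set \<Rightarrow> bool" where
  "spherical_design \<tau> C \<longleftrightarrow> spherical_code C \<and>
     (\<forall>p\<in>polynomials_upto \<tau>. (\<Sum>x\<in>C. p x) / real (card C) = (LINT x|surface_measure. p x))"


section \<open>Potentials and energy\<close>

text \<open>Potentials live on \<open>[-1, 1)\<close>; they are represented by functions on all of \<open>real\<close> whose values
  outside this interval are irrelevant.\<close>

definition potential :: "(real \<Rightarrow> real) \<Rightarrow> bool" where
  "potential h \<longleftrightarrow> continuous_on {-1..<1} h"

text \<open>Differentiability has to be required explicitly because \<^const>\<open>deriv\<close> is total. The sign
  condition starts at the first derivative.\<close>

definition absolutely_monotone :: "(real \<Rightarrow> real) \<Rightarrow> bool" where
  "absolutely_monotone h \<longleftrightarrow> potential h \<and>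
     (\<forall>j. \<forall>t\<in>{-1<..<1}. (deriv ^^ j) h field_differentiable (at t)) \<and>
     (\<forall>j\<ge>1. \<forall>t\<in>{-1<..<1}. (deriv ^^ j) h t \<ge> 0)"

definition energy :: "(real \<Rightarrow> real) \<Rightarrow> (real ^ 'n) set \<Rightarrow> real" where
  "energy h C = (\<Sum>(x, y)\<in>{(x, y). x \<in> C \<and> y \<in> C \<and> x \<noteq> y}. h (x \<bullet> y))"

text \<open>The ambient dimension is passed as a type, as in \<open>TYPE(23)\<close>. The operator \<^const>\<open>Least\<close> returns
  the minimum only if there is one, so statements about \<open>min_energy\<close> should also assert that it is
  a lower bound and attained.\<close>

definition min_energy :: "'n::finite itself \<Rightarrow> (real \<Rightarrow> real) \<Rightarrow> nat \<Rightarrow> real set \<Rightarrow> real" where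
  "min_energy n h N T =
     (LEAST e. \<exists>C :: (real ^ 'n) set. avoiding_code T C \<and> card C = N \<and> e = energy h C)"

definition avoiding_universally_optimal :: "real set \<Rightarrow> (real ^ 'n) set \<Rightarrow> bool" where
  "avoiding_universally_optimal T C \<longleftrightarrow> avoiding_code T C \<and>
     (\<forall>h. absolutely_monotone h \<longrightarrow>
        (\<forall>C' :: (real ^ 'n) set. avoiding_code T C' \<and> card C' = card C \<longrightarrow> energy h C \<le> energy h C'))"


section \<open>The Leech lattice and the derived code\<close>

text \<open>The columns of \<open>B\<close> form a lattice basis, and \<open>\<bar>det B\<bar>\<close> is the covolume.\<close>

definition unimodular_lattice :: "(real ^ 'n) set \<Rightarrow> bool" where
  "unimodular_lattice \<Lambda> \<longleftrightarrow>
     (\<exists>B :: real ^ 'n ^ 'n. \<bar>det B\<bar> = 1 \<and> \<Lambda> = {B *v z | z. \<forall>i. z $ i \<in> \<int>}) \<and>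
     (\<forall>x\<in>\<Lambda>. \<forall>y\<in>\<Lambda>. x \<bullet> y \<in> \<int>)"

definition even_unimodular_lattice :: "(real ^ 'n) set \<Rightarrow> bool" where
  "even_unimodular_lattice \<Lambda> \<longleftrightarrow> unimodular_lattice \<Lambda> \<and>
     (\<forall>x\<in>\<Lambda>. \<exists>k::int. x \<bullet> x = 2 * of_int k)"

text \<open>This characterizes the Leech lattice up to isometry. As usual for lattices, its minimum norm
  \<open>4\<close> refers to the squared length.\<close>

definition leech_lattice :: "(real ^ 24) set \<Rightarrow> bool" where
  "leech_lattice \<Lambda> \<longleftrightarrow> even_unimodular_lattice \<Lambda> \<and>
     (\<exists>x\<in>\<Lambda>. x \<bullet> x = 4) \<and> (\<forall>x\<in>\<Lambda> - {0}. x \<bullet> x \<ge> 4)"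

definition kissing_code :: "(real ^ 24) set \<Rightarrow> (real ^ 24) set" where
  "kissing_code \<Lambda> = {x /\<^sub>R 2 | x. x \<in> \<Lambda> \<and> norm x = 2}"

definition derived_code :: "real \<Rightarrow> real ^ 'n \<Rightarrow> (real ^ 'n) set \<Rightarrow> (real ^ 'n) set" where
  "derived_code \<alpha> w L = {(y - \<alpha> *\<^sub>R w) /\<^sub>R sqrt (1 - \<alpha>\<^sup>2) | y. y \<in> L \<and> y \<bullet> w = \<alpha>}"

text \<open>\<open>\<phi>\<close> is a linear isometry of 23-space onto the orthogonal complement of \<open>w\<close>.\<close>

definition coordinates_on_complement :: "real ^ 24 \<Rightarrow> (real ^ 23 \<Rightarrow> real ^ 24) \<Rightarrow> bool" where
  "coordinates_on_complement w \<phi> \<longleftrightarrow>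
     linear \<phi> \<and> (\<forall>x. norm (\<phi> x) = norm x) \<and> range \<phi> = {v. v \<bullet> w = 0}"

text \<open>The code \<open>C\<close> with parameter \<open>\<surd>6/6\<close> obtained from a Leech lattice \<open>\<Lambda>\<close> and a lattice vector \<open>W\<close> of
  length \<open>\<surd>6\<close>, transported to 23-space by \<open>\<phi>\<close>.\<close>

definition C_sqrt6_6 :: "(real ^ 24) set \<Rightarrow> real ^ 24 \<Rightarrow> (real ^ 23 \<Rightarrow> real ^ 24) \<Rightarrow> (real ^ 23) set" where
  "C_sqrt6_6 \<Lambda> W \<phi> = \<phi> -` derived_code (sqrt 6 / 6) (W /\<^sub>R sqrt 6) (kissing_code \<Lambda>)"

end

theory Submission
  imports
    Defs
    "HOL-Probability.Probability"
    "HOL-Complex_Analysis.Conformal_Mappings"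
begin

text \<open>
  Lower bound: let \<open>f\<close> be the polynomial of degree 5 that interpolates \<open>h\<close> at the four inner
  products, to second order at the two of them that are not endpoints of \<open>T\<close>. The interpolation
  error is a divided difference of order 6 of \<open>h\<close>, hence nonnegative, times a polynomial that is
  nonnegative off \<open>T\<close>; so \<open>f \<le> h\<close> off \<open>T\<close>. The Newton coefficients of \<open>f\<close> and the Gegenbauer
  coefficients of the partial products of \<open>t - node\<close> are nonnegative, which bounds the energy of
  \<open>f\<close> below by that of a 5-design with these inner products.

  The code attains the bound: the theta series of the Leech lattice weighted by \<open>(x \<bullet> u)\<^sup>2\<^sup>k\<close>, minus
  its mean over the sphere of all \<open>u\<close>, has no terms of norm 0 and 2. For \<open>k \<le> 4\<close> it is inductively
  a modular form of weight \<open>12 + 2 k \<le> 20\<close> that vanishes to order 2, hence is 0, and the shells of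
  the lattice have the even moments of a 9-design. The inner products of a minimal vector
  with short lattice vectors are integers in a short range, so these moments determine all counts
  in the slice \<open>x \<bullet> W = 2\<close>.
\<close>

section \<open>Poisson summation for Gaussians\<close>

text \<open>All facts about the Leech lattice rest on one analytic input, Poisson summation for
  Gaussians. The lattice version is reduced to dimension one: integrality lets Gram-Schmidt run
  inside the lattice, which therefore contains a rectangular sublattice of finite index, and on its
  cosets Gaussian sums factor. Self-duality then recovers the lattice on the dual side. The
  vanishing theorem for forms uses a maximum modulus estimate instead of the valence formula. At the
  lowest height sqrt 3 / 2 of the fundamental domain it reaches weights below 8 * pi * sqrt 3 / 2,
  about 21.8, so weight 20 fits. Moments up to degree 9 are what the counting needs: the polynomial
  selecting the slice has degree 6, moments up to the third in the slice determine four counts, and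
  odd moments vanish by antipodality. \<open>min_energy\<close> is a \<open>Least\<close>, so its
  value is known only once some code attains it. Hence a concrete Leech lattice with a vector of
  squared length 6 is built from the Golay code and checked by computation; the optimality statement
  itself covers every lattice satisfying \<open>leech_lattice\<close>.\<close>

lemma summable_on_int_gaussian:
  fixes s x :: real
  assumes s: "s > 0"
  shows "(\<lambda>n::int. exp (- s * (of_int n + x)\<^sup>2)) summable_on UNIV"
proof -
  have geo: "(\<lambda>n::nat. exp (- (s/2) * real n)) summable_on UNIV"
  proof -
    have "summable (\<lambda>n. exp (- (s/2)) ^ n)" by (rule summable_geometric) (use s in simp)
    moreover have "exp (- (s/2)) ^ n = exp (- (s/2) * real n)" for n
      by (subst exp_of_nat_mult[symmetric]) (simp add: mult_ac)
    ultimately show ?thesis by (intro summable_nonneg_imp_summable_on) auto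
  qed
  have abs1: "(\<lambda>n::int. exp (- (s/2) * real_of_int \<bar>n\<bar>)) summable_on range int"
    by (subst summable_on_reindex) (use geo in \<open>auto simp: o_def\<close>)
  have abs2: "(\<lambda>n::int. exp (- (s/2) * real_of_int \<bar>n\<bar>)) summable_on range (\<lambda>n. - int n)"
    by (subst summable_on_reindex) (use geo in \<open>auto simp: o_def inj_on_def\<close>)
  have "(UNIV :: int set) = range int \<union> range (\<lambda>n. - int n)"
    by (auto simp: image_iff) (metis int_cases2)
  then have abs: "(\<lambda>n::int. exp (- (s/2) * real_of_int \<bar>n\<bar>)) summable_on UNIV"
    using summable_on_union[OF abs1 abs2] by simp
  have le: "exp (- s * (of_int n + x)\<^sup>2) \<le> exp (s * x\<^sup>2) * exp (- (s/2) * real_of_int \<bar>n\<bar>)" for n :: int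
  proof -
    have "n\<^sup>2 \<ge> \<bar>n\<bar>" by (metis abs_ge_zero abs_le_square_iff abs_of_nonneg int_one_le_iff_zero_less
          less_le mult_left_mono mult.right_neutral power2_abs power2_eq_square zero_power2)
    then have "real_of_int (n\<^sup>2) \<ge> real_of_int \<bar>n\<bar>" by linarith
    \<comment> \<open>With this square, \<open>(n + x)^2\<close> is at least
      \<open>n^2 / 2 - x^2\<close>, hence at least \<open>\<bar>n\<bar> / 2 - x^2\<close>: the
      comparison series is geometric.\<close>
    moreover have "0 \<le> (real_of_int n + 2 * x)\<^sup>2" by simp
    ultimately have "(of_int n + x)\<^sup>2 \<ge> real_of_int \<bar>n\<bar> / 2 - x\<^sup>2"
      by (simp add: power2_eq_square algebra_simps)
    then have "s * (of_int n + x)\<^sup>2 \<ge> s * (real_of_int \<bar>n\<bar> / 2 - x\<^sup>2)" using s by simp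
    then show ?thesis by (simp flip: exp_add add: algebra_simps)
  qed
  show ?thesis
    by (rule summable_on_comparison_test[OF summable_on_cmult_right[OF abs] le]) auto
qed

text \<open>Gives one majorant, summable over integer \<open>y\<close>, for all translates with
  \<open>x\<close> in a bounded interval; the term \<open>+ 0\<close> matches the shape of
  \<open>summable_on_int_gaussian\<close>.\<close>

lemma gaussian_translate_le:
  fixes s x R y :: real
  assumes "s > 0" "\<bar>x\<bar> \<le> R"
  shows "exp (- s * (y + x)\<^sup>2) \<le> exp (s * R\<^sup>2) * exp (- (s/2) * (y + 0)\<^sup>2)"
proof -
  have "0 \<le> (y + 2 * x)\<^sup>2" by simp
  then have "(y + x)\<^sup>2 \<ge> y\<^sup>2 / 2 - x\<^sup>2" by (simp add: power2_eq_square algebra_simps)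
  moreover have "x\<^sup>2 \<le> R\<^sup>2" using assms(2) by (metis abs_le_square_iff abs_ge_zero abs_of_nonneg order_trans)
  ultimately have "s * (y + x)\<^sup>2 \<ge> s * (y\<^sup>2 / 2 - R\<^sup>2)" using assms(1) by (intro mult_left_mono) auto
  then show ?thesis by (simp flip: exp_add add: algebra_simps)
qed

text \<open>The characteristic function of the standard normal distribution, after the substitution
  of \<open>c * y\<close> with \<open>c = sqrt (2 * pi * T)\<close>.\<close>

lemma gaussian_fourier_integral:
  fixes T \<beta> :: real
  assumes T: "T > 0"
  defines "g \<equiv> \<lambda>y. complex_of_real (exp (- (pi * T) * y\<^sup>2)) * cis (2 * pi * \<beta> * y)"
  shows "integrable lborel g" "integral\<^sup>L lborel g = of_real (exp (- pi * \<beta>\<^sup>2 / T) / sqrt T)"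
proof -
  define c where "c = sqrt (2 * pi * T)"
  have c: "c > 0" "c\<^sup>2 = 2 * pi * T" using T by (simp_all add: c_def)
  define f where "f x = std_normal_density x *\<^sub>R iexp (2 * pi * \<beta> / c * x)" for x
  have f: "integrable lborel f" "integral\<^sup>L lborel f = of_real (exp (- (2 * pi * \<beta> / c)\<^sup>2 / 2))"
  proof -
    have "integrable std_normal_distribution (\<lambda>x. iexp (2 * pi * \<beta> / c * x))"
    proof -
      interpret real_distribution std_normal_distribution by (rule real_dist_normal_dist)
      show ?thesis by (rule integrable_const_bound[where B=1]) auto
    qed
    then show "integrable lborel f" unfolding f_def
      by (subst (asm) integrable_density) (auto simp: normal_density_nonneg)
    have "integral\<^sup>L lborel f = char std_normal_distribution (2 * pi * \<beta> / c)"
      unfolding f_def char_def by (subst integral_density) (auto simp: normal_density_nonneg)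
    then show "integral\<^sup>L lborel f = of_real (exp (- (2 * pi * \<beta> / c)\<^sup>2 / 2))"
      by (simp add: char_std_normal_distribution)
  qed
  have fg: "f (0 + c * y) = g y / of_real (sqrt (2 * pi))" for y
  proof -
    have "(c * y)\<^sup>2 / 2 = pi * T * y\<^sup>2" using c by (simp add: power_mult_distrib)
    then show ?thesis using c
      by (simp add: f_def g_def std_normal_density_def cis_conv_exp scaleR_conv_of_real mult_ac)
  qed
  have "integrable lborel (\<lambda>y. f (0 + c * y))"
    using f(1) c(1) by (intro lborel_integrable_real_affine) auto
  then have "integrable lborel (\<lambda>y. of_real (sqrt (2 * pi)) * (g y / of_real (sqrt (2 * pi))))"
    unfolding fg by (rule integrable_mult_right)
  then show "integrable lborel g" by simp
  have "integral\<^sup>L lborel f = \<bar>c\<bar> *\<^sub>R integral\<^sup>L lborel (\<lambda>y. f (0 + c * y))"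
    by (rule lborel_integral_real_affine) (use c in auto)
  also have "\<dots> = of_real (c / sqrt (2 * pi)) * integral\<^sup>L lborel g"
    using c unfolding fg by (simp add: scaleR_conv_of_real)
  also have "c / sqrt (2 * pi) = sqrt T" by (simp add: c_def real_sqrt_mult)
  finally have "of_real (exp (- (2 * pi * \<beta> / c)\<^sup>2 / 2)) = of_real (sqrt T) * integral\<^sup>L lborel g"
    using f(2) by simp
  moreover have "(2 * pi * \<beta> / c)\<^sup>2 / 2 = pi * \<beta>\<^sup>2 / T"
    using c T by (simp add: power_divide power_mult_distrib power2_eq_square field_simps)
  ultimately have "of_real (exp (- pi * \<beta>\<^sup>2 / T)) = of_real (sqrt T) * integral\<^sup>L lborel g"
    by (metis minus_divide_left mult_minus_left)
  then show "integral\<^sup>L lborel g = of_real (exp (- pi * \<beta>\<^sup>2 / T) / sqrt T)"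
    using T by (simp add: divide_inverse mult_ac)
qed

text \<open>The powers of \<open>(1 + cos (2\<pi>(x - a))) / 2\<close> are trigonometric polynomials concentrating at
  \<open>a\<close>, so a function orthogonal to all of them vanishes at \<open>a\<close>.\<close>

lemma fourier_coefficients_zero_imp_zero:
  fixes d :: "real \<Rightarrow> complex" and a :: real
  assumes cont: "continuous_on {a - 1/2..a + 1/2} d"
    and zero: "\<And>l::int. integral {a - 1/2..a + 1/2} (\<lambda>x. d x * cis (2 * pi * l * x)) = 0"
  shows "d a = 0"
proof (rule ccontr)
  assume nz: "d a \<noteq> 0"
  define I where "I = {a - 1/2..a + 1/2}"
  define k where "k x = (1 + cos (2 * pi * (x - a))) / 2" for x
  have kcont: "continuous_on A k" for A unfolding k_def by (intro continuous_intros) auto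
  have dcont: "continuous_on I d" using cont by (simp add: I_def)
  have cisc: "continuous_on A (\<lambda>x. cis (2 * pi * real_of_int l * x))" for A l
    by (intro continuous_intros)
  have int: "(\<lambda>x. d x * of_real (k x ^ N) * cis (2 * pi * real_of_int l * x)) integrable_on I" for N l
    unfolding I_def
    by (intro integrable_continuous_real continuous_intros kcont cisc dcont[unfolded I_def])
  have kN: "integral I (\<lambda>x. d x * of_real (k x ^ N) * cis (2 * pi * real_of_int l * x)) = 0" for N l
  proof (induction N arbitrary: l)
    case 0
    then show ?case using zero[of l] by (simp add: I_def)
  next
    case (Suc N)
    let ?h = "\<lambda>l x. d x * of_real (k x ^ N) * cis (2 * pi * real_of_int l * x)"
    \<comment> \<open>\<open>k\<close> is a combination of the modes 0, 1 and -1, so a further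
      factor \<open>k\<close> only shifts the frequency \<open>l\<close> by at most one and the
      induction closes.\<close>
    have k: "of_real (k x) = 1/2 + cis (2 * pi * x) * cis (- 2 * pi * a) / 4 + cis (- 2 * pi * x) * cis (2 * pi * a) / 4" for x
      by (simp add: k_def cis_mult complex_eq_iff right_diff_distrib cos_diff sin_diff) (simp add: field_simps)
    have eq: "d x * of_real (k x ^ Suc N) * cis (2 * pi * real_of_int l * x) =
        ?h l x * (1/2) + ?h (l + 1) x * (cis (- 2 * pi * a) / 4) + ?h (l - 1) x * (cis (2 * pi * a) / 4)" for x
    proof -
      have c: "cis (2 * pi * real_of_int (l + 1) * x) = cis (2 * pi * real_of_int l * x) * cis (2 * pi * x)"
        "cis (2 * pi * real_of_int (l - 1) * x) = cis (2 * pi * real_of_int l * x) * cis (- 2 * pi * x)"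
        by (simp_all add: cis_mult algebra_simps)
      show ?thesis unfolding c power_Suc of_real_mult k by (simp add: algebra_simps)
    qed
    show ?case unfolding eq
      by (subst integral_add integral_mult_left Suc.IH; (intro integrable_add integrable_on_mult_left int)?)+ (simp add: Suc.IH)
  qed
  \<comment> \<open>The real part of \<open>d\<close> rotated by its value at \<open>a\<close>: a
    real function, positive at \<open>a\<close>, that is still orthogonal to every power of
    \<open>k\<close>.\<close>
  define e where "e x = Re (d x * cnj (d a))" for x
  have econt: "continuous_on I e" unfolding e_def by (intro continuous_intros dcont)
  have ekint: "(\<lambda>x. e x * k x ^ N) integrable_on I" for N
    unfolding I_def by (intro integrable_continuous_real continuous_intros kcont econt[unfolded I_def])
  have ek: "integral I (\<lambda>x. e x * k x ^ N) = 0" for N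
  proof -
    have h1: "integral I (\<lambda>x. d x * of_real (k x ^ N) * cnj (d a)) = 0"
      using kN[of N 0] int[of N 0] by (subst integral_mult_left) auto
    have h2: "(\<lambda>x. d x * of_real (k x ^ N) * cnj (d a)) integrable_on I"
      using int[of N 0] by (intro integrable_on_mult_left) simp
    have "integral I (\<lambda>x. Re (d x * of_real (k x ^ N) * cnj (d a))) = 0"
      using integral_linear[OF h2 bounded_linear_Re] unfolding h1 o_def by (simp only: zero_complex.sel)
    moreover have "Re (d x * of_real (k x ^ N) * cnj (d a)) = e x * k x ^ N" for x
      by (simp add: e_def algebra_simps)
    ultimately show ?thesis by simp
  qed
  have ea: "e a > 0" using nz unfolding e_def complex_mult_cnj
    by (simp add: complex_eq_iff sum_power2_gt_zero_iff)
  have "compact (e ` I)" unfolding I_def by (intro compact_continuous_image econt[unfolded I_def]) auto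
  then obtain B where B: "B > 0" "\<And>x. x \<in> I \<Longrightarrow> \<bar>e x\<bar> \<le> B"
    using compact_imp_bounded bounded_pos by (metis imageI real_norm_def)
  obtain \<delta>0 where \<delta>0: "\<delta>0 > 0" "\<And>x. x \<in> I \<Longrightarrow> dist x a < \<delta>0 \<Longrightarrow> dist (e x) (e a) < e a / 2"
    using econt ea unfolding continuous_on_iff I_def by (metis atLeastAtMost_iff half_gt_zero less_add_same_cancel1 diff_less_eq less_imp_le zero_less_divide_1_iff zero_less_numeral)
  define \<delta> where "\<delta> = min (\<delta>0 / 2) (1/4)"
  have \<delta>: "\<delta> > 0" "\<delta> \<le> 1/4" "\<delta> < \<delta>0" using \<delta>0 by (auto simp: \<delta>_def)
  \<comment> \<open>\<open>u\<close> bounds the kernel from above at distance at least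
    \<open>\<delta>\<close>, \<open>v\<close> bounds it from below within
    \<open>\<delta> / 2\<close>. As \<open>u < v\<close>, the \<open>N\<close>-th powers separate
    the two regions.\<close>
  define u v where "u = (1 + cos (2 * pi * \<delta>)) / 2" and "v = (1 + cos (2 * pi * (\<delta>/2))) / 2"
  have kabs: "k x = (1 + cos (2 * pi * \<bar>x - a\<bar>)) / 2" for x
    by (cases "x \<ge> a") (auto simp: k_def abs_if right_diff_distrib cos_diff)
  have cosmono: "cos (2 * pi * t) \<le> cos (2 * pi * s)" if "0 \<le> s" "s \<le> t" "t \<le> 1/2" for s t
    using that by (intro cos_monotone_0_pi_le) auto
  have k_le: "k x \<le> u" if "x \<in> I" "\<bar>x - a\<bar> \<ge> \<delta>" for x
  proof -
    have "\<bar>x - a\<bar> \<le> 1/2" using that(1) unfolding I_def atLeastAtMost_iff by linarith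
    then show ?thesis unfolding kabs u_def using cosmono[of \<delta> "\<bar>x - a\<bar>"] that \<delta> by simp
  qed
  have k_ge: "k x \<ge> v" if "\<bar>x - a\<bar> \<le> \<delta>/2" for x
    unfolding kabs v_def using cosmono[of "\<bar>x - a\<bar>" "\<delta>/2"] that \<delta> by simp
  have half: "0 \<le> (1 + t) / 2" if "- 1 \<le> t" for t :: real using that by simp
  have k0: "k x \<ge> 0" for x unfolding k_def by (rule half[OF cos_ge_minus_one])
  have "cos (2 * pi * \<delta>) < cos (2 * pi * (\<delta>/2))"
    using \<delta> by (intro cos_monotone_0_pi) auto
  then have uv: "u < v" by (simp add: u_def v_def)
  have u0: "u \<ge> 0" unfolding u_def by (rule half[OF cos_ge_minus_one])
  have main: "e a / 2 * \<delta> * v ^ N \<le> B * u ^ N" for N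
  proof -
    define J where "J = {a - \<delta>/2..a + \<delta>/2}"
    have JI: "J \<subseteq> I" using \<delta> by (auto simp: J_def I_def)
    have pos: "e x > e a / 2" if "x \<in> I" "\<bar>x - a\<bar> < \<delta>" for x
    proof -
      have "dist (e x) (e a) < e a / 2" by (rule \<delta>0) (use that \<delta> in \<open>auto simp: dist_real_def\<close>)
      then show ?thesis unfolding dist_real_def by linarith
    qed
    \<comment> \<open>The added constant dominates the negative part of \<open>e x * k x ^ N\<close>
      far from \<open>a\<close>, so the integral over the small interval \<open>J\<close> is at most
      that over \<open>I\<close>, where \<open>e x * k x ^ N\<close> contributes 0.\<close>
    let ?F = "\<lambda>x. e x * k x ^ N + B * u ^ N"
    have nonneg: "?F x \<ge> 0" if "x \<in> I" for x
    proof (cases "\<bar>x - a\<bar> < \<delta>")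
      case True
      then have "e x > 0" using pos[OF that] ea by linarith
      then show ?thesis using k0[of x] B u0 by simp
    next
      case False
      then have "k x ^ N \<le> u ^ N" using k_le[OF that] k0 by (intro power_mono) auto
      then have "\<bar>e x\<bar> * k x ^ N \<le> B * u ^ N" using B(2)[OF that] k0 B(1) by (intro mult_mono) auto
      moreover have "\<bar>e x * k x ^ N\<bar> = \<bar>e x\<bar> * k x ^ N" using k0 by (simp add: abs_mult)
      ultimately show ?thesis by linarith
    qed
    have Fcont: "continuous_on I ?F" by (intro continuous_intros kcont econt)
    have Fint: "?F integrable_on I" "?F integrable_on J"
      using Fcont continuous_on_subset[OF Fcont JI] unfolding I_def J_def
      by (auto intro!: integrable_continuous_real)
    have "e a / 2 * \<delta> * v ^ N = integral J (\<lambda>x. e a / 2 * v ^ N)" using \<delta> by (simp add: J_def)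
    also have "\<dots> \<le> integral J ?F"
    proof (rule integral_le)
      show "e a / 2 * v ^ N \<le> ?F x" if "x \<in> J" for x
      proof -
        have x: "\<bar>x - a\<bar> \<le> \<delta>/2" using that by (auto simp: J_def abs_if)
        have "v ^ N \<le> k x ^ N" using k_ge[OF x] uv u0 by (intro power_mono) auto
        moreover have "e x > e a / 2" using x \<delta> JI that by (intro pos) auto
        ultimately have "e a / 2 * v ^ N \<le> e x * k x ^ N" using ea uv u0 by (intro mult_mono) auto
        then show ?thesis using B u0 by (simp add: add_increasing2)
      qed
    qed (use Fint in \<open>auto simp: J_def\<close>)
    also have "\<dots> \<le> integral I ?F" using integral_subset_le[OF JI Fint(2,1)] nonneg by auto
    also have "\<dots> = B * u ^ N"
      using ek ekint by (subst integral_add) (auto simp: I_def)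
    finally show ?thesis .
  qed
  have "(\<lambda>N. B * (u / v) ^ N) \<longlonglongrightarrow> B * 0"
    using uv u0 by (intro tendsto_intros LIMSEQ_realpow_zero) auto
  then have "eventually (\<lambda>N. B * (u / v) ^ N < e a / 2 * \<delta>) sequentially"
    using ea \<delta> by (intro order_tendstoD(2)) auto
  then obtain N where "B * (u / v) ^ N < e a / 2 * \<delta>" by (auto simp: eventually_sequentially)
  then show False using main[of N] uv u0 by (simp add: power_divide field_simps)
qed

text \<open>Weierstrass M-test along finite subsets of the integers: uniform convergence passes both
  continuity and the integral to the unordered sum.\<close>

lemma has_sum_integral_of_dominated:
  fixes f :: "int \<Rightarrow> real \<Rightarrow> complex" and M :: "int \<Rightarrow> real"
  assumes M: "M summable_on UNIV" and le: "\<And>n x. x \<in> {c..d} \<Longrightarrow> norm (f n x) \<le> M n"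
    and cont: "\<And>n. continuous_on {c..d} (f n)"
  shows "continuous_on {c..d} (\<lambda>x. \<Sum>\<^sub>\<infinity>n. f n x)"
    and "((\<lambda>n. integral {c..d} (f n)) has_sum integral {c..d} (\<lambda>x. \<Sum>\<^sub>\<infinity>n. f n x)) UNIV"
proof -
  have u: "uniform_limit {c..d} (\<lambda>X x. \<Sum>n\<in>X. f n x) (\<lambda>x. \<Sum>\<^sub>\<infinity>n. f n x) (finite_subsets_at_top UNIV)"
    by (rule Weierstrass_m_test_general[OF _ M]) (use le in auto)
  show "continuous_on {c..d} (\<lambda>x. \<Sum>\<^sub>\<infinity>n. f n x)"
    by (rule uniform_limit_theorem[OF _ u]) (auto intro!: always_eventually continuous_intros cont)
  obtain I J where IJ: "\<And>X. ((\<lambda>x. \<Sum>n\<in>X. f n x) has_integral I X) {c..d}"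
    "((\<lambda>x. \<Sum>\<^sub>\<infinity>n. f n x) has_integral J) {c..d}" "(I \<longlongrightarrow> J) (finite_subsets_at_top UNIV)"
    by (rule uniform_limit_integral[OF u]) (auto intro!: continuous_intros cont)
  have "eventually (\<lambda>X. I X = (\<Sum>n\<in>X. integral {c..d} (f n))) (finite_subsets_at_top UNIV)"
  proof (rule eventually_mono)
    show "\<forall>\<^sub>F X in finite_subsets_at_top UNIV. finite (X :: int set)" by (intro eventually_finite_subsets_at_top_weakI)
    show "I X = (\<Sum>n\<in>X. integral {c..d} (f n))" if "finite X" for X
    proof -
      have "I X = integral {c..d} (\<lambda>x. \<Sum>n\<in>X. f n x)" using integral_unique[OF IJ(1)[of X]] by simp
      also have "\<dots> = (\<Sum>n\<in>X. integral {c..d} (f n))"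
        by (rule integral_sum) (use that in \<open>auto intro!: integrable_continuous_real cont\<close>)
      finally show ?thesis .
    qed
  qed
  then have "((\<lambda>X. \<Sum>n\<in>X. integral {c..d} (f n)) \<longlongrightarrow> J) (finite_subsets_at_top UNIV)"
    using IJ(3) tendsto_cong by blast
  then show "((\<lambda>n. integral {c..d} (f n)) has_sum integral {c..d} (\<lambda>x. \<Sum>\<^sub>\<infinity>n. f n x)) UNIV"
    using IJ(2) by (simp add: has_sum_def integral_unique)
qed

text \<open>Lets an unordered sum over the integers be computed from symmetric partial sums;
  integrals over unit intervals then join to one integral over an interval of length
  \<open>2 * K\<close>.\<close>

lemma filterlim_symmetric_int_intervals:
  "filterlim (\<lambda>K::nat. {- int K..<int K}) (finite_subsets_at_top UNIV) sequentially"
  unfolding filterlim_finite_subsets_at_top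
proof (intro allI impI)
  fix X :: "int set" assume X: "finite X \<and> X \<subseteq> UNIV"
  define B where "B = nat (\<Sum>x\<in>X. \<bar>x\<bar>) + 1"
  have "x \<in> {- int K..<int K}" if "K \<ge> B" "x \<in> X" for K x
  proof -
    have "\<bar>x\<bar> \<le> (\<Sum>x\<in>X. \<bar>x\<bar>)" using X that(2) by (intro member_le_sum) auto
    then show ?thesis using that(1) by (auto simp: B_def)
  qed
  then show "\<forall>\<^sub>F K in sequentially. finite {- int K..<int K} \<and> X \<subseteq> {- int K..<int K} \<and> {- int K..<int K} \<subseteq> UNIV"
    unfolding eventually_sequentially by blast
qed

text \<open>Both sides are continuous functions of \<open>a\<close>. On the unit interval around
  \<open>a\<close> their Fourier coefficients agree: those of the periodized Gaussian unfold to an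
  integral over the whole line, those of the dual series are read off by orthogonality. Then
  \<open>fourier_coefficients_zero_imp_zero\<close> applies to the difference.\<close>

theorem poisson_summation_gaussian:
  fixes T a b :: real
  assumes T: "T > 0"
  shows "(\<Sum>\<^sub>\<infinity>n::int. complex_of_real (exp (- (pi * T) * (of_int n + a)\<^sup>2)) * cis (2 * pi * b * (of_int n + a)))
    = (\<Sum>\<^sub>\<infinity>k::int. complex_of_real (exp (- (pi / T) * (of_int k - b)\<^sup>2)) * cis (2 * pi * of_int k * a)) / of_real (sqrt T)"
proof -
  define c d where "c = a - 1/2" and "d = a + 1/2"
  define \<gamma> where "\<gamma> y = complex_of_real (exp (- (pi * T) * y\<^sup>2)) * cis (2 * pi * b * y)" for y
  define \<psi> where "\<psi> k x = complex_of_real (exp (- (pi / T) * (of_int k - b)\<^sup>2) / sqrt T) * cis (2 * pi * of_int k * x)" for k :: int and x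
  define \<Phi> where "\<Phi> x = (\<Sum>\<^sub>\<infinity>n::int. \<gamma> (of_int n + x))" for x
  define \<Psi> where "\<Psi> x = (\<Sum>\<^sub>\<infinity>k. \<psi> k x)" for x
  define R where "R = \<bar>a\<bar> + 1"
  define M where "M n = exp (pi * T * R\<^sup>2) * exp (- (pi * T / 2) * (real_of_int n + 0)\<^sup>2)" for n :: int
  define M' where "M' k = exp (- (pi / T) * (real_of_int k + - b)\<^sup>2) / sqrt T" for k :: int
  have piT: "pi * T > 0" "pi * T / 2 > 0" "pi / T > 0" using T by auto
  have M: "M summable_on UNIV" unfolding M_def
    by (rule summable_on_cmult_right[OF summable_on_int_gaussian[OF piT(2)]])
  have M': "M' summable_on UNIV" 
    using summable_on_cmult_left[OF summable_on_int_gaussian[OF piT(3), of "- b"], of "inverse (sqrt T)"]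
    by (simp add: M'_def[abs_def] divide_inverse)
  have \<gamma>_le: "norm (\<gamma> (of_int n + x)) \<le> M n" if "x \<in> {c..d}" for n x
  proof -
    have "\<bar>x\<bar> \<le> R" using that by (auto simp: c_def d_def R_def)
    then show ?thesis using gaussian_translate_le[of "pi * T" x R "of_int n"] piT by (simp add: \<gamma>_def M_def norm_mult)
  qed
  have \<psi>_le: "norm (\<psi> k x) \<le> M' k" for k x using T by (simp add: \<psi>_def M'_def norm_mult norm_divide)
  have \<gamma>_cont: "continuous_on A (\<lambda>x. \<gamma> (of_int n + x))" for A n unfolding \<gamma>_def by (intro continuous_intros)
  have \<psi>_cont: "continuous_on A (\<psi> k)" for A k unfolding \<psi>_def by (intro continuous_intros)
  have cis_cont: "continuous_on A (\<lambda>x. cis (2 * pi * real_of_int l * x))" for A l by (intro continuous_intros)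
  have \<Phi>_cont: "continuous_on {c..d} \<Phi>" unfolding \<Phi>_def
    by (rule has_sum_integral_of_dominated(1)[OF M \<gamma>_le \<gamma>_cont])
  have \<Psi>_cont: "continuous_on {c..d} \<Psi>" unfolding \<Psi>_def
    by (rule has_sum_integral_of_dominated(1)[OF M' \<psi>_le \<psi>_cont])
  \<comment> \<open>Integration against \<open>cis (2 * pi * l * x)\<close> extracts the mode
    \<open>k = - l\<close> of the dual series, hence the sign of \<open>l\<close> on the
    right.\<close>
  have coeff_\<Phi>: "integral {c..d} (\<lambda>x. \<Phi> x * cis (2 * pi * real_of_int l * x)) = of_real (exp (- (pi / T) * (- of_int l - b)\<^sup>2) / sqrt T)" for l
  proof -
    define G where "G y = complex_of_real (exp (- (pi * T) * y\<^sup>2)) * cis (2 * pi * (b + l) * y)" for y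
    have G: "\<gamma> (of_int n + x) * cis (2 * pi * real_of_int l * x) = G (of_int n + x)" for n x
    proof -
      have "cis (2 * pi * real_of_int l * (of_int n + x)) = cis (2 * pi * real_of_int (l * n)) * cis (2 * pi * real_of_int l * x)"
        by (simp add: cis_mult algebra_simps)
      also have "cis (2 * pi * real_of_int (l * n)) = 1" by (rule cis_multiple_2pi) simp
      finally have "cis (2 * pi * real_of_int l * x) = cis (2 * pi * real_of_int l * (of_int n + x))" by simp
      then show ?thesis by (simp add: \<gamma>_def G_def cis_mult distrib_left distrib_right mult.assoc add_ac del: of_int_add)
    qed
    have "((\<lambda>n. integral {c..d} (\<lambda>x. \<gamma> (of_int n + x) * cis (2 * pi * real_of_int l * x))) has_sum
        integral {c..d} (\<lambda>x. \<Sum>\<^sub>\<infinity>n. \<gamma> (of_int n + x) * cis (2 * pi * real_of_int l * x))) UNIV"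
      by (rule has_sum_integral_of_dominated(2)[OF M])
         (use \<gamma>_le in \<open>auto simp: norm_mult intro!: continuous_intros \<gamma>_cont\<close>)
    also have "(\<lambda>x. \<Sum>\<^sub>\<infinity>n. \<gamma> (of_int n + x) * cis (2 * pi * real_of_int l * x)) = (\<lambda>x. \<Phi> x * cis (2 * pi * real_of_int l * x))"
      unfolding \<Phi>_def by (simp add: infsum_cmult_left')
    finally have hs: "((\<lambda>n. integral {c..d} (\<lambda>x. G (of_int n + x))) has_sum
        integral {c..d} (\<lambda>x. \<Phi> x * cis (2 * pi * real_of_int l * x))) UNIV" unfolding G .
    have Gcont: "continuous_on A G" for A unfolding G_def by (intro continuous_intros)
    have shift: "integral {c..d} (\<lambda>x. G (of_int n + x)) = integral {c + of_int n..c + of_int n + 1} G" for n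
    proof -
      have "integral {c + of_int n..d + of_int n} G = integral {c..d} (\<lambda>x. G (x + of_int n))"
      proof (rule integral_unique)
        have "(G has_integral integral {c..d} (\<lambda>x. G (x + of_int n))) {c + of_int n..d + of_int n}"
          using has_integral_shift_Icc_real[of G "of_int n" "integral {c..d} (\<lambda>x. G (x + of_int n))" c d]
          by (auto simp: o_def add.commute intro!: integrable_integral integrable_continuous_real continuous_on_compose2[OF Gcont[of UNIV]] continuous_intros)
        then show "(G has_integral integral {c..d} (\<lambda>x. G (x + of_int n))) {c + of_int n..d + of_int n}" .
      qed
      moreover have "d + of_int n = c + of_int n + 1" by (simp add: c_def d_def)
      ultimately show ?thesis by (simp add: add.commute)
    qed
    \<comment> \<open>Each translate is an integral of \<open>G\<close> over a unit interval; the
      intervals for \<open>- K\<close> to \<open>K - 1\<close> tile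
      \<open>[c - K, c + K]\<close>.\<close>
    have part: "(\<Sum>n\<in>{- int K..<int K}. integral {c..d} (\<lambda>x. G (of_int n + x))) = integral {c - real K..c + real K} G" for K
    proof (induction K)
      case (Suc K)
      have "{- int (Suc K)..<int (Suc K)} = insert (- int (Suc K)) (insert (int K) {- int K..<int K})" by auto
      moreover have s1: "integral {c..d} (\<lambda>x. G (of_int (- int (Suc K)) + x)) = integral {c - real (Suc K)..c - real K} G"
        unfolding shift by (rule arg_cong[where f="\<lambda>A. integral A G"]) simp
      moreover have s2: "integral {c..d} (\<lambda>x. G (of_int (int K) + x)) = integral {c + real K..c + real (Suc K)} G"
        unfolding shift by (rule arg_cong[where f="\<lambda>A. integral A G"]) simp
      ultimately have "(\<Sum>n\<in>{- int (Suc K)..<int (Suc K)}. integral {c..d} (\<lambda>x. G (of_int n + x))) =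
         integral {c - real (Suc K)..c - real K} G + integral {c + real K..c + real (Suc K)} G + integral {c - real K..c + real K} G"
        using Suc s1 s2 by simp
      also have "\<dots> = integral {c - real (Suc K)..c + real (Suc K)} G"
      proof -
        have Gi: "G integrable_on {x..y}" for x y by (intro integrable_continuous_real Gcont)
        have e1: "integral {c - real (Suc K)..c - real K} G + integral {c - real K..c + real K} G = integral {c - real (Suc K)..c + real K} G"
          by (rule Henstock_Kurzweil_Integration.integral_combine) (auto simp: Gi)
        have e2: "integral {c - real (Suc K)..c + real K} G + integral {c + real K..c + real (Suc K)} G = integral {c - real (Suc K)..c + real (Suc K)} G"
          by (rule Henstock_Kurzweil_Integration.integral_combine) (auto simp: Gi)
        show ?thesis unfolding e2[symmetric] e1[symmetric] by (simp only: add_ac)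
      qed
      finally show ?case .
    qed simp
    have lim1: "(\<lambda>K. integral {c - real K..c + real K} G) \<longlonglongrightarrow> integral {c..d} (\<lambda>x. \<Phi> x * cis (2 * pi * real_of_int l * x))"
      using filterlim_compose[OF hs[unfolded has_sum_def] filterlim_symmetric_int_intervals] by (simp add: part)
    have Gint: "integrable lborel G" "integral\<^sup>L lborel G = of_real (exp (- pi * (b + l)\<^sup>2 / T) / sqrt T)"
      using gaussian_fourier_integral[OF T, of "b + l"] by (simp_all add: G_def[abs_def])
    have "(\<lambda>K. LINT x|lborel. indicator {c - real K..c + real K} x *\<^sub>R G x) \<longlonglongrightarrow> integral\<^sup>L lborel G"
    proof (rule integral_dominated_convergence[where w="\<lambda>x. norm (G x)"])
      show "AE x in lborel. (\<lambda>K. indicator {c - real K..c + real K} x *\<^sub>R G x) \<longlonglongrightarrow> G x"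
      proof (intro AE_I2 tendsto_eventually)
        fix x :: real
        obtain K0 where K0: "\<bar>x - c\<bar> \<le> real K0" using real_arch_simple by blast
        show "\<forall>\<^sub>F K in sequentially. indicator {c - real K..c + real K} x *\<^sub>R G x = G x"
          using eventually_ge_at_top[of K0] by eventually_elim (use K0 in \<open>auto simp: indicator_def\<close>)
      qed
    qed (use Gint in \<open>auto simp: indicator_def\<close>)
    moreover have "(LINT x|lborel. indicator {c - real K..c + real K} x *\<^sub>R G x) = integral {c - real K..c + real K} G" for K
      using set_borel_integral_eq_integral(2)[of "{c - real K..c + real K}" G] Gint(1)
      by (simp add: set_lebesgue_integral_def set_integrable_def integrable_mult_indicator)
    ultimately have "(\<lambda>K. integral {c - real K..c + real K} G) \<longlonglongrightarrow> integral\<^sup>L lborel G" by simp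
    then have "integral {c..d} (\<lambda>x. \<Phi> x * cis (2 * pi * real_of_int l * x)) = integral\<^sup>L lborel G"
      using lim1 LIMSEQ_unique by blast
    moreover have "(b + l)\<^sup>2 = (- real_of_int l - b)\<^sup>2" by (simp add: power2_eq_square algebra_simps)
    ultimately show ?thesis using Gint(2) by simp
  qed
  have orth: "integral {c..d} (\<lambda>x. cis (2 * pi * real_of_int m * x)) = (if m = 0 then 1 else 0)" for m :: int
  proof (cases "m = 0")
    case False
    have "((\<lambda>x. cis (2 * pi * real_of_int m * x)) has_integral
       (cis (2 * pi * real_of_int m * d) / (2 * pi * of_int m * \<i>) - cis (2 * pi * real_of_int m * c) / (2 * pi * of_int m * \<i>))) {c..d}"
    proof (rule fundamental_theorem_of_calculus)
      show "((\<lambda>x. cis (2 * pi * real_of_int m * x) / (2 * pi * of_int m * \<i>)) has_vector_derivative cis (2 * pi * real_of_int m * x)) (at x within {c..d})" for x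
        unfolding cis_conv_exp using False
        by (auto intro!: derivative_eq_intros has_vector_derivative_real_field simp: field_simps)
    qed (simp add: c_def d_def)
    moreover have "cis (2 * pi * real_of_int m * d) = cis (2 * pi * real_of_int m) * cis (2 * pi * real_of_int m * c)"
      by (simp add: cis_mult c_def d_def algebra_simps)
    moreover have "cis (2 * pi * real_of_int m) = 1" by (rule cis_multiple_2pi) simp
    ultimately show ?thesis using False by (simp add: integral_unique)
  qed (simp add: c_def d_def)
  have coeff_\<Psi>: "integral {c..d} (\<lambda>x. \<Psi> x * cis (2 * pi * real_of_int l * x)) = of_real (exp (- (pi / T) * (- of_int l - b)\<^sup>2) / sqrt T)" for l
  proof -
    have "((\<lambda>k. integral {c..d} (\<lambda>x. \<psi> k x * cis (2 * pi * real_of_int l * x))) has_sum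
        integral {c..d} (\<lambda>x. \<Sum>\<^sub>\<infinity>k. \<psi> k x * cis (2 * pi * real_of_int l * x))) UNIV"
      by (rule has_sum_integral_of_dominated(2)[OF M'])
         (use \<psi>_le in \<open>auto simp: norm_mult intro!: continuous_intros \<psi>_cont\<close>)
    also have "(\<lambda>x. \<Sum>\<^sub>\<infinity>k. \<psi> k x * cis (2 * pi * real_of_int l * x)) = (\<lambda>x. \<Psi> x * cis (2 * pi * real_of_int l * x))"
      unfolding \<Psi>_def by (simp add: infsum_cmult_left')
    also have "(\<lambda>k. integral {c..d} (\<lambda>x. \<psi> k x * cis (2 * pi * real_of_int l * x))) =
        (\<lambda>k. if k = - l then of_real (exp (- (pi / T) * (- of_int l - b)\<^sup>2) / sqrt T) else 0)"
    proof
      fix k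
      have "(\<lambda>x. \<psi> k x * cis (2 * pi * real_of_int l * x)) =
          (\<lambda>x. complex_of_real (exp (- (pi / T) * (of_int k - b)\<^sup>2) / sqrt T) * cis (2 * pi * real_of_int (k + l) * x))"
        by (simp add: \<psi>_def cis_mult[symmetric] distrib_left distrib_right mult.assoc)
      then show "integral {c..d} (\<lambda>x. \<psi> k x * cis (2 * pi * real_of_int l * x)) =
          (if k = - l then of_real (exp (- (pi / T) * (- of_int l - b)\<^sup>2) / sqrt T) else 0)"
        using orth[of "k + l"] by (auto simp del: of_int_add)
    qed
    finally have "((\<lambda>k. if k = - l then complex_of_real (exp (- (pi / T) * (- of_int l - b)\<^sup>2) / sqrt T) else 0) has_sum
      integral {c..d} (\<lambda>x. \<Psi> x * cis (2 * pi * real_of_int l * x))) UNIV" .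
    moreover have "((\<lambda>k. if k = - l then complex_of_real (exp (- (pi / T) * (- of_int l - b)\<^sup>2) / sqrt T) else 0) has_sum
      of_real (exp (- (pi / T) * (- of_int l - b)\<^sup>2) / sqrt T)) UNIV"
      by (rule has_sum_finite_neutralI[where B="{-l}"]) auto
    ultimately show ?thesis by (rule has_sum_unique)
  qed
  have "\<Phi> a - \<Psi> a = 0"
  proof (rule fourier_coefficients_zero_imp_zero)
    show "continuous_on {a - 1/2..a + 1/2} (\<lambda>x. \<Phi> x - \<Psi> x)"
      using \<Phi>_cont \<Psi>_cont by (auto simp: c_def d_def intro!: continuous_intros)
    show "integral {a - 1/2..a + 1/2} (\<lambda>x. (\<Phi> x - \<Psi> x) * cis (2 * pi * real_of_int l * x)) = 0" for l
      unfolding left_diff_distrib c_def[symmetric] d_def[symmetric]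
      by (subst integral_diff)
         (auto simp: coeff_\<Phi> coeff_\<Psi> intro!: integrable_continuous_real continuous_intros \<Phi>_cont \<Psi>_cont)
  qed
  moreover have "\<Psi> a = (\<Sum>\<^sub>\<infinity>k::int. complex_of_real (exp (- (pi / T) * (of_int k - b)\<^sup>2)) * cis (2 * pi * of_int k * a)) / of_real (sqrt T)"
  proof -
    have "\<Psi> a = (\<Sum>\<^sub>\<infinity>k::int. complex_of_real (exp (- (pi / T) * (of_int k - b)\<^sup>2)) * cis (2 * pi * of_int k * a) * inverse (of_real (sqrt T)))"
      by (simp add: \<Psi>_def \<psi>_def divide_inverse mult_ac)
    then show ?thesis by (simp add: infsum_cmult_left' divide_inverse)
  qed
  ultimately show ?thesis by (simp add: \<Phi>_def \<gamma>_def)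
qed

section \<open>Poisson summation over a unimodular lattice\<close>

lemma sum_infsum_swap:
  fixes f :: "'a \<Rightarrow> 'b \<Rightarrow> complex"
  assumes "finite R" "\<And>r. f r summable_on A"
  shows "(\<Sum>r\<in>R. infsum (f r) A) = (\<Sum>\<^sub>\<infinity>x\<in>A. \<Sum>r\<in>R. f r x)"
proof -
  have "((\<lambda>x. \<Sum>r\<in>R. f r x) has_sum (\<Sum>r\<in>R. infsum (f r) A)) A"
    using assms(1) by induction (auto intro!: has_sum_add has_sum_infsum assms(2))
  then show ?thesis by (simp add: infsumI)
qed

lemma det_in_Ints:
  fixes A :: "real ^ 'n ^ 'n"
  assumes "\<And>i j. A $ i $ j \<in> \<int>"
  shows "det A \<in> \<int>"
  unfolding det_def by (intro Ints_sum Ints_mult Ints_prod assms) auto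

text \<open>A finite set of functions lies in the box of its coordinate projections, over which the
  sum of products factors; this bounds all finite partial sums by the product of the full
  sums.\<close>

lemma abs_summable_on_prod_UNIV:
  fixes f :: "'n::finite \<Rightarrow> 'b \<Rightarrow> real"
  assumes "\<And>i. f i summable_on UNIV" and "\<And>i b. f i b \<ge> 0"
  shows "(\<lambda>k. \<Prod>i\<in>UNIV. f i (k i)) summable_on (UNIV :: ('n \<Rightarrow> 'b) set)"
proof (rule nonneg_bounded_partial_sums_imp_summable_on[where C="\<Prod>i\<in>UNIV. infsum (f i) UNIV"])
  show "\<forall>\<^sub>F X in finite_subsets_at_top UNIV. (\<Sum>k\<in>X. \<Prod>i\<in>UNIV. f i (k i)) \<le> (\<Prod>i\<in>UNIV. infsum (f i) UNIV)"
  proof (rule eventually_finite_subsets_at_top_weakI)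
    fix X :: "('n \<Rightarrow> 'b) set" assume X: "finite X"
    have sub: "X \<subseteq> PiE UNIV (\<lambda>i. (\<lambda>k. k i) ` X)" by (auto simp: PiE_def)
    have fin: "finite (PiE UNIV (\<lambda>i. (\<lambda>k. k i) ` X))" using X by (intro finite_PiE) auto
    have "(\<Sum>k\<in>X. \<Prod>i\<in>UNIV. f i (k i)) \<le> (\<Sum>k\<in>PiE UNIV (\<lambda>i. (\<lambda>k. k i) ` X). \<Prod>i\<in>UNIV. f i (k i))"
      by (rule sum_mono2[OF fin sub]) (auto intro!: prod_nonneg assms)
    also have "\<dots> = (\<Prod>i\<in>UNIV. \<Sum>b\<in>(\<lambda>k. k i) ` X. f i b)"
      using infsum_prod_PiE_abs[of UNIV f "\<lambda>i. (\<lambda>k. k i) ` X"] X fin by simp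
    also have "\<dots> \<le> (\<Prod>i\<in>UNIV. infsum (f i) UNIV)"
      using X by (intro prod_mono conjI sum_nonneg finite_sum_le_infsum assms) auto
    finally show "(\<Sum>k\<in>X. \<Prod>i\<in>UNIV. f i (k i)) \<le> (\<Prod>i\<in>UNIV. infsum (f i) UNIV)" .
  qed
qed (auto intro!: prod_nonneg assms)

context
  fixes \<Lambda> :: "(real ^ 'n) set"
  assumes L: "unimodular_lattice \<Lambda>"
begin

lemma lattice_inner_Ints: "x \<in> \<Lambda> \<Longrightarrow> y \<in> \<Lambda> \<Longrightarrow> x \<bullet> y \<in> \<int>"
  using L by (auto simp: unimodular_lattice_def)

lemma lattice_add: "x \<in> \<Lambda> \<Longrightarrow> y \<in> \<Lambda> \<Longrightarrow> x + y \<in> \<Lambda>"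
proof -
  assume "x \<in> \<Lambda>" "y \<in> \<Lambda>"
  then obtain B :: "real ^ 'n ^ 'n" and a b where *: "\<Lambda> = {B *v z | z. \<forall>i. z $ i \<in> \<int>}"
    "x = B *v a" "\<forall>i. a $ i \<in> \<int>" "y = B *v b" "\<forall>i. b $ i \<in> \<int>"
    using L unfolding unimodular_lattice_def by blast
  then have "x + y = B *v (a + b)" by (simp add: matrix_vector_right_distrib)
  with * show ?thesis by auto
qed

lemma lattice_scale: "x \<in> \<Lambda> \<Longrightarrow> c \<in> \<int> \<Longrightarrow> c *\<^sub>R x \<in> \<Lambda>"
proof -
  assume "x \<in> \<Lambda>" and c: "c \<in> \<int>"
  then obtain B :: "real ^ 'n ^ 'n" and a where *: "\<Lambda> = {B *v z | z. \<forall>i. z $ i \<in> \<int>}"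
    "x = B *v a" "\<forall>i. a $ i \<in> \<int>"
    using L unfolding unimodular_lattice_def by blast
  then have "c *\<^sub>R x = B *v (c *\<^sub>R a)" by (simp add: matrix_vector_mult_scaleR)
  with * c show ?thesis by auto
qed

lemma lattice_zero: "0 \<in> \<Lambda>"
proof -
  obtain B :: "real ^ 'n ^ 'n" where "\<Lambda> = {B *v z | z. \<forall>i. z $ i \<in> \<int>}"
    using L unfolding unimodular_lattice_def by blast
  then show ?thesis by (auto intro!: exI[of _ 0])
qed

lemma lattice_uminus: "x \<in> \<Lambda> \<Longrightarrow> - x \<in> \<Lambda>"
  using lattice_scale[of x "-1"] by simp

lemma lattice_diff: "x \<in> \<Lambda> \<Longrightarrow> y \<in> \<Lambda> \<Longrightarrow> x - y \<in> \<Lambda>"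
  using lattice_add[of x "- y"] lattice_uminus by simp

lemma lattice_sum: "(\<And>i. i \<in> I \<Longrightarrow> f i \<in> \<Lambda>) \<Longrightarrow> sum f I \<in> \<Lambda>"
  by (induction I rule: infinite_finite_induct) (auto simp: lattice_zero lattice_add)

lemma span_lattice: "span \<Lambda> = UNIV"
proof -
  obtain B :: "real ^ 'n ^ 'n" where B: "\<bar>det B\<bar> = 1" "\<Lambda> = {B *v z | z. \<forall>i. z $ i \<in> \<int>}"
    using L unfolding unimodular_lattice_def by blast
  have "B *v axis j 1 \<in> \<Lambda>" for j unfolding B(2) by (auto simp: axis_def)
  then have "columns B \<subseteq> \<Lambda>" by (auto simp: columns_def matrix_vector_mult_basis[symmetric])
  moreover have "span (columns B) = UNIV"
  proof -
    have "invertible B" using B(1) by (auto simp: invertible_det_nz)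
    then show ?thesis
      by (metis invertible_def matrix_right_invertible_span_columns span_vec_eq)
  qed
  ultimately show ?thesis by (metis span_mono top.extremum_uniqueI)
qed

text \<open>The Gram matrix of the basis is integral with determinant 1. Cramer's rule expresses the
  coordinates of \<open>x\<close> through integer determinants divided by 1.\<close>

lemma lattice_self_dual:
  assumes "\<And>y. y \<in> \<Lambda> \<Longrightarrow> x \<bullet> y \<in> \<int>"
  shows "x \<in> \<Lambda>"
proof -
  obtain B :: "real ^ 'n ^ 'n" where B: "\<bar>det B\<bar> = 1" "\<Lambda> = {B *v z | z. \<forall>i. z $ i \<in> \<int>}"
    using L unfolding unimodular_lattice_def by blast
  have col: "column j B \<in> \<Lambda>" for j
    unfolding B(2) matrix_vector_mult_basis[symmetric] by (auto simp: axis_def)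
  define G where "G = transpose B ** B"
  have detG: "det G = 1"
    using B(1) by (simp add: G_def det_mul det_transpose) (metis abs_mult_self_eq mult_1)
  have "invertible B" using B(1) by (auto simp: invertible_det_nz)
  then obtain c where c: "x = B *v c"
    by (metis invertible_def matrix_vector_mul_assoc matrix_vector_mul_lid)
  have "G *v c = transpose B *v x" by (simp add: G_def c matrix_vector_mul_assoc)
  moreover have det0: "det G \<noteq> 0" using detG by simp
  ultimately have eq: "c = (\<chi> k. det (\<chi> i j. if j = k then (transpose B *v x) $ i else G $ i $ j) / det G)"
    using cramer[OF det0] by blast
  have "(transpose B *v x) $ i = column i B \<bullet> x" for i
    by (simp add: matrix_vector_mult_def transpose_def column_def inner_vec_def del: transpose_matrix_vector)
  then have i1: "(transpose B *v x) $ i \<in> \<int>" for i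
    using assms[OF col, of i] by (simp add: inner_commute del: transpose_matrix_vector)
  have "G $ i $ j = column i B \<bullet> column j B" for i j
    by (simp add: G_def matrix_matrix_mult_def transpose_def column_def inner_vec_def)
  then have i2: "G $ i $ j \<in> \<int>" for i j using lattice_inner_Ints[OF col col] by simp
  have "c $ k \<in> \<int>" for k
    by (subst eq) (auto simp: detG intro!: det_in_Ints i1 i2 simp del: transpose_matrix_vector)
  then show ?thesis unfolding B(2) c by blast
qed

text \<open>Gram-Schmidt with cleared denominators: multiplying by the product \<open>P\<close> of
  the squared lengths, which are integers, brings the orthogonalized vector back into the
  lattice.\<close>

lemma orthogonal_sets_in_lattice:
  "k \<le> CARD('n) \<Longrightarrow> \<exists>A. A \<subseteq> \<Lambda> \<and> finite A \<and> card A = k \<and> 0 \<notin> A \<and> pairwise orthogonal A"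
proof (induction k)
  case 0
  then show ?case by (intro exI[of _ "{}"]) auto
next
  case (Suc k)
  then obtain A where A: "A \<subseteq> \<Lambda>" "finite A" "card A = k" "0 \<notin> A" "pairwise orthogonal A" by auto
  have "dim (span A) \<le> k" using dim_le_card'[OF A(2)] A(3) by simp
  then have "span A \<noteq> UNIV" using Suc.prems by (metis DIM_cart DIM_real dim_UNIV mult.right_neutral not_less_eq_eq order_trans)
  then obtain b where b: "b \<in> \<Lambda>" "b \<notin> span A"
    using span_lattice by (metis span_minimal subsetI subspace_span top.extremum_uniqueI)
  define P where "P = (\<Prod>a\<in>A. a \<bullet> a)"
  have P0: "P \<noteq> 0" using A by (auto simp: P_def)
  define w where "w = P *\<^sub>R (b - (\<Sum>a\<in>A. ((b \<bullet> a) / (a \<bullet> a)) *\<^sub>R a))"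
  have w0: "w \<notin> span A"
  proof
    assume "w \<in> span A"
    then have "(1 / P) *\<^sub>R w \<in> span A" by (rule span_scale)
    then have "b - (\<Sum>a\<in>A. ((b \<bullet> a) / (a \<bullet> a)) *\<^sub>R a) \<in> span A"
      using P0 by (simp add: w_def)
    moreover have "(\<Sum>a\<in>A. ((b \<bullet> a) / (a \<bullet> a)) *\<^sub>R a) \<in> span A"
      by (intro span_sum span_scale span_base)
    ultimately have "(b - (\<Sum>a\<in>A. ((b \<bullet> a) / (a \<bullet> a)) *\<^sub>R a)) + (\<Sum>a\<in>A. ((b \<bullet> a) / (a \<bullet> a)) *\<^sub>R a) \<in> span A"
      by (rule span_add)
    then show False using b by simp
  qed
  have ort: "w \<bullet> a = 0" if "a \<in> A" for a
  proof -
    have "(\<Sum>a'\<in>A. ((b \<bullet> a') / (a' \<bullet> a')) *\<^sub>R a') \<bullet> a = (\<Sum>a'\<in>A. (b \<bullet> a') / (a' \<bullet> a') * (a' \<bullet> a))"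
      by (simp add: inner_sum_left)
    also have "\<dots> = (\<Sum>a'\<in>A. if a' = a then b \<bullet> a else 0)"
      using A that by (intro sum.cong) (auto simp: pairwise_def orthogonal_def)
    finally show ?thesis using A that by (simp add: w_def inner_diff_left)
  qed
  have wL: "w \<in> \<Lambda>"
  proof -
    have "P \<in> \<int>" unfolding P_def using A by (intro Ints_prod lattice_inner_Ints) auto
    moreover have "P * ((b \<bullet> a) / (a \<bullet> a)) \<in> \<int>" if "a \<in> A" for a
    proof -
      have "P = (a \<bullet> a) * (\<Prod>a\<in>A - {a}. a \<bullet> a)"
        unfolding P_def by (rule prod.remove[OF A(2) that])
      moreover have "a \<bullet> a \<noteq> 0" using A(4) that by auto
      ultimately have "P * ((b \<bullet> a) / (a \<bullet> a)) = (\<Prod>a\<in>A - {a}. a \<bullet> a) * (b \<bullet> a)" by simp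
      also have "\<dots> \<in> \<int>" using A b that by (intro Ints_mult Ints_prod lattice_inner_Ints) auto
      finally show ?thesis .
    qed
    ultimately have "P *\<^sub>R b - (\<Sum>a\<in>A. (P * ((b \<bullet> a) / (a \<bullet> a))) *\<^sub>R a) \<in> \<Lambda>"
      using A b by (intro lattice_diff lattice_sum lattice_scale) auto
    then show ?thesis by (simp add: w_def scaleR_diff_right scaleR_sum_right)
  qed
  show ?case
  proof (intro exI[of _ "insert w A"] conjI)
    have "w \<notin> A" using w0 span_base by blast
    then show "card (insert w A) = Suc k" using A by simp
    show "0 \<notin> insert w A" using A w0 span_zero by auto
    show "pairwise orthogonal (insert w A)"
      using A ort by (auto simp: pairwise_insert orthogonal_def inner_commute)
  qed (use A wL in auto)
qed

lemma orthogonal_frame_in_lattice: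
  obtains v :: "'n \<Rightarrow> real ^ 'n" where "\<And>i. v i \<in> \<Lambda>" "\<And>i. v i \<noteq> 0" "\<And>i j. i \<noteq> j \<Longrightarrow> v i \<bullet> v j = 0"
    "\<And>x. x = (\<Sum>i\<in>UNIV. ((x \<bullet> v i) / (v i \<bullet> v i)) *\<^sub>R v i)"
proof -
  obtain A where A: "A \<subseteq> \<Lambda>" "finite A" "card A = CARD('n)" "0 \<notin> A" "pairwise orthogonal A"
    using orthogonal_sets_in_lattice by blast
  then obtain v where v: "bij_betw v (UNIV :: 'n set) A"
    using finite_same_card_bij[of "UNIV :: 'n set" A] by auto
  have vA: "v i \<in> A" for i using v by (auto simp: bij_betw_def)
  have ort: "v i \<bullet> v j = 0" if "i \<noteq> j" for i j
  proof -
    have "v i \<noteq> v j" using v that by (auto simp: bij_betw_def inj_on_def)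
    then show ?thesis using A(5) vA by (auto simp: pairwise_def orthogonal_def)
  qed
  have "independent A" using pairwise_orthogonal_independent A by blast
  then have spanA: "span A = UNIV" using A
    using dim_eq_card_independent[of A] dim_eq_full[of A] by simp
  have exp: "x = (\<Sum>i\<in>UNIV. ((x \<bullet> v i) / (v i \<bullet> v i)) *\<^sub>R v i)" for x
    proof -
      define e where "e = x - (\<Sum>i\<in>UNIV. ((x \<bullet> v i) / (v i \<bullet> v i)) *\<^sub>R v i)"
      have "orthogonal e y" if "y \<in> A" for y
      proof -
        have "y \<in> range v" using bij_betw_imp_surj_on[OF v] that by simp
        then obtain j where j: "y = v j" by (rule rangeE)
        have "v j \<noteq> 0" using vA[of j] A(4) by auto
        have "(\<Sum>i\<in>UNIV. ((x \<bullet> v i) / (v i \<bullet> v i)) *\<^sub>R v i) \<bullet> v j = (\<Sum>i\<in>UNIV. if i = j then x \<bullet> v j else 0)"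
          unfolding inner_sum_left using ort \<open>v j \<noteq> 0\<close> by (intro sum.cong) auto
        then show ?thesis by (simp add: e_def j orthogonal_def inner_diff_left)
      qed
      then have "orthogonal e e" using spanA orthogonal_to_span[of e A e] by auto
      then show ?thesis by (simp add: e_def orthogonal_self)
    qed
  have "v i \<in> \<Lambda>" "v i \<noteq> 0" for i using vA[of i] A(1,4) by auto
  then show ?thesis using ort exp by (rule that)
qed

text \<open>Let M be the rectangular lattice spanned by the orthogonal frame. The points
  \<open>y k\<close> form its dual, and \<open>\<Lambda>\<close> lies between the two: it is the
  image of \<open>L'\<close>, a finite union of cosets of the box lattice with steps
  \<open>D i\<close>. On each coset the Gaussian sum is a product of one-dimensional ones, to which
  \<open>poisson_summation_gaussian\<close> applies; the characters that appear add up over the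
  cosets to a multiple of the indicator of \<open>\<Lambda>\<close>. The factor \<open>K\<close> is
  left unevaluated and is determined in \<open>lattice_poisson\<close>.\<close>

theorem lattice_poisson_aux:
  "\<exists>K. \<forall>t>0. \<forall>z.
     (\<lambda>x. exp (- (pi * t) * (norm x)\<^sup>2)) summable_on \<Lambda> \<and>
     (\<lambda>x. exp (- (pi / t) * (norm (x - z))\<^sup>2)) summable_on \<Lambda> \<and>
     (\<Sum>\<^sub>\<infinity>x\<in>\<Lambda>. complex_of_real (exp (- (pi * t) * (norm x)\<^sup>2)) * cis (2 * pi * (x \<bullet> z)))
     = K / of_real (sqrt t ^ CARD('n)) * (\<Sum>\<^sub>\<infinity>x\<in>\<Lambda>. complex_of_real (exp (- (pi / t) * (norm (x - z))\<^sup>2)))"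
proof -
  obtain v :: "'n \<Rightarrow> real ^ 'n" where v: "\<And>i. v i \<in> \<Lambda>" "\<And>i. v i \<noteq> 0" "\<And>i j. i \<noteq> j \<Longrightarrow> v i \<bullet> v j = 0"
    and expand: "\<And>x. x = (\<Sum>i\<in>UNIV. ((x \<bullet> v i) / (v i \<bullet> v i)) *\<^sub>R v i)"
    using orthogonal_frame_in_lattice by blast
  define D where "D i = \<lfloor>v i \<bullet> v i\<rfloor>" for i
  define d where "d i = real_of_int (D i)" for i
  have vd: "v i \<bullet> v i = d i" for i
    using lattice_inner_Ints[OF v(1) v(1), of i i] by (metis D_def d_def floor_of_int Ints_cases)
  have d0: "d i > 0" for i using v(2)[of i] by (simp flip: vd)
  have D0: "D i > 0" for i using d0[of i] by (simp add: d_def)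
  have Dn: "D i \<noteq> 0" for i using D0[of i] by simp
  \<comment> \<open>Coordinates dual to the frame: a lattice vector has integer coordinates here,
    because its inner products with the \<open>v i\<close> are integers.\<close>
  define Y where "Y c = (\<Sum>i\<in>UNIV. (c i / d i) *\<^sub>R v i)" for c :: "'n \<Rightarrow> real"
  have Yv: "Y c \<bullet> v j = c j" for c j
  proof -
    have "Y c \<bullet> v j = (\<Sum>i\<in>UNIV. if i = j then c j else 0)"
      unfolding Y_def inner_sum_left using v(3) d0[of j] vd[of j] by (intro sum.cong) auto
    then show ?thesis by simp
  qed
  have YY: "Y c \<bullet> Y e = (\<Sum>i\<in>UNIV. c i * e i / d i)" for c e
  proof -
    have "Y c \<bullet> Y e = (\<Sum>i\<in>UNIV. (e i / d i) * (Y c \<bullet> v i))"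
      by (subst Y_def[of e]) (simp add: inner_sum_right)
    then show ?thesis by (simp add: Yv mult.commute)
  qed
  have Y_norm: "(norm (Y c))\<^sup>2 = (\<Sum>i\<in>UNIV. (c i)\<^sup>2 / d i)" for c
    unfolding power2_norm_eq_inner YY by (simp add: power2_eq_square)
  have Y_coord: "Y (\<lambda>i. x \<bullet> v i) = x" for x using expand[of x] by (simp add: Y_def vd)
  have Y_diff: "Y c - Y e = Y (\<lambda>i. c i - e i)" for c e
    by (simp add: Y_def sum_subtractf diff_divide_distrib scaleR_diff_left)
  have Y_add: "Y c + Y e = Y (\<lambda>i. c i + e i)" for c e
    by (simp add: Y_def sum.distrib add_divide_distrib scaleR_add_left)
  define y where "y k = Y (\<lambda>i. real_of_int (k i))" for k :: "'n \<Rightarrow> int"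
  define L' where "L' = {k. y k \<in> \<Lambda>}"
  define co where "co x i = \<lfloor>x \<bullet> v i\<rfloor>" for x i
  have co: "real_of_int (co x i) = x \<bullet> v i" if "x \<in> \<Lambda>" for x i
    using lattice_inner_Ints[OF that v(1), of i] by (auto simp: co_def Ints_def)
  have y_co: "y (co x) = x" if "x \<in> \<Lambda>" for x using Y_coord co[OF that] by (simp add: y_def)
  have inj_y: "inj y"
  proof (rule injI)
    fix k l assume "y k = y l"
    then have "real_of_int (k i) = real_of_int (l i)" for i using Yv by (metis y_def)
    then show "k = l" by auto
  qed
  have y_L': "y ` L' = \<Lambda>"
    using y_co by (auto simp: L'_def image_iff) (metis)
  have reindex: "infsum f \<Lambda> = (\<Sum>\<^sub>\<infinity>k\<in>L'. f (y k))" for f :: "_ \<Rightarrow> complex"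
    using infsum_reindex[of y L' f] inj_y y_L' by (simp add: o_def inj_on_subset[OF inj_y])
  have reindex_s: "f summable_on \<Lambda> \<longleftrightarrow> (\<lambda>k. f (y k)) summable_on L'" for f :: "_ \<Rightarrow> real"
    using summable_on_reindex[of y L' f] inj_y y_L' by (simp add: o_def inj_on_subset[OF inj_y])
  have y_shift: "y (\<lambda>i. k i + D i * q i) = y k + (\<Sum>i\<in>UNIV. real_of_int (q i) *\<^sub>R v i)" for k q
  proof -
    have "(real_of_int (k i) + real_of_int (D i) * real_of_int (q i)) / d i = real_of_int (k i) / d i + q i" for i
      using d0[of i] by (simp add: d_def field_simps)
    then show ?thesis by (simp add: y_def Y_def sum.distrib scaleR_add_left)
  qed
  have vsum: "(\<Sum>i\<in>UNIV. real_of_int (q i) *\<^sub>R v i) \<in> \<Lambda>" for q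
    by (intro lattice_sum lattice_scale v) auto
  have L'_shift: "(\<lambda>i. k i + D i * q i) \<in> L' \<longleftrightarrow> k \<in> L'" for k q
    using lattice_add[OF _ vsum[of q], of "y k"] lattice_diff[OF _ vsum[of q], of "y k + (\<Sum>i\<in>UNIV. real_of_int (q i) *\<^sub>R v i)"]
    by (auto simp: L'_def y_shift)
  \<comment> \<open>Representatives of \<open>\<Lambda>\<close> modulo the span of the frame: adding
    \<open>D i\<close> to coordinate \<open>i\<close> adds the vector \<open>v i\<close>.\<close>
  define R where "R = {r \<in> L'. \<forall>i. r i \<in> {0..<D i}}"
  have "R \<subseteq> PiE UNIV (\<lambda>i. {0..<D i})" by (auto simp: R_def)
  then have finR: "finite R" by (rule finite_subset) (intro finite_PiE, auto)
  define h where "h r n = (\<lambda>i. r i + D i * n i)" for r n :: "'n \<Rightarrow> int"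
  have bij: "bij_betw (\<lambda>(r, n). h r n) (R \<times> UNIV) L'"
  proof (rule bij_betw_byWitness[where f'="\<lambda>k. (\<lambda>i. k i mod D i, \<lambda>i. k i div D i)"])
    show "\<forall>a\<in>R \<times> UNIV. (\<lambda>k. (\<lambda>i. k i mod D i, \<lambda>i. k i div D i)) (case a of (r, n) \<Rightarrow> h r n) = a"
      using Dn by (auto simp: h_def R_def fun_eq_iff div_pos_pos_trivial)
    show "\<forall>k\<in>L'. (case (\<lambda>i. k i mod D i, \<lambda>i. k i div D i) of (r, n) \<Rightarrow> h r n) = k"
      by (auto simp: h_def)
    show "(\<lambda>(r, n). h r n) ` (R \<times> UNIV) \<subseteq> L'"
      using L'_shift by (auto simp: h_def R_def)
    show "(\<lambda>k. (\<lambda>i. k i mod D i, \<lambda>i. k i div D i)) ` L' \<subseteq> R \<times> UNIV"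
    proof -
      have "(\<lambda>i. k i mod D i) \<in> L'" if "k \<in> L'" for k
        using L'_shift[of "\<lambda>i. k i mod D i" "\<lambda>i. k i div D i"] that by simp
      then show ?thesis using D0 by (auto simp: R_def)
    qed
  qed
  \<comment> \<open>A character sum over a finite quotient. On \<open>L'\<close> all terms are 1 by
    integrality. Outside it, self-duality gives a lattice vector \<open>l\<close> with
    \<open>y k \<bullet> l\<close> not an integer; translation by \<open>l\<close> permutes the
    representatives and multiplies the sum by \<open>c\<close>, which is not 1, so the sum is
    0.\<close>
  define ch where "ch k = (\<Sum>r\<in>R. cis (2 * pi * (y k \<bullet> y r)))" for k
  have ch: "ch k = (if k \<in> L' then of_nat (card R) else 0)" for k
  proof (cases "k \<in> L'")
    case True
    have "cis (2 * pi * (y k \<bullet> y r)) = 1" if "r \<in> R" for r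
      by (rule cis_multiple_2pi, rule lattice_inner_Ints) (use True that in \<open>auto simp: L'_def R_def\<close>)
    then show ?thesis using True by (simp add: ch_def)
  next
    case False
    then obtain l where l: "l \<in> \<Lambda>" "y k \<bullet> l \<notin> \<int>" using lattice_self_dual[of "y k"] by (auto simp: L'_def)
    define c where "c = cis (2 * pi * (y k \<bullet> l))"
    have c1: "c \<noteq> 1"
    proof
      assume "c = 1"
      then obtain n :: int where "2 * pi * (y k \<bullet> l) = of_int (2 * n) * pi"
        unfolding c_def cis_conv_exp exp_eq_1 by auto
      then have "y k \<bullet> l = of_int n" by simp
      then show False using l(2) by simp
    qed
    \<comment> \<open>Translation by \<open>l\<close>, reduced to the representative of the new
      coset.\<close>
    define \<sigma> where "\<sigma> r = (\<lambda>i. (r i + co l i) mod D i)" for r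
    have \<sigma>_eq: "y (\<sigma> r) = y r + l - (\<Sum>i\<in>UNIV. real_of_int ((r i + co l i) div D i) *\<^sub>R v i)" for r
    proof -
      have "y (\<lambda>i. \<sigma> r i + D i * ((r i + co l i) div D i)) = y r + l"
        using Y_add[of "\<lambda>i. of_int (r i)" "\<lambda>i. of_int (co l i)"] y_co[OF l(1)] by (simp add: \<sigma>_def y_def)
      then show ?thesis unfolding y_shift by (simp add: algebra_simps)
    qed
    have \<sigma>R: "\<sigma> r \<in> R" if "r \<in> R" for r
      using that D0 \<sigma>_eq[of r] l(1) by (auto simp: R_def L'_def intro!: lattice_diff lattice_add vsum) (auto simp: \<sigma>_def)
    have inj: "inj_on \<sigma> R"
    proof (rule inj_onI)
      fix r s assume rs: "r \<in> R" "s \<in> R" "\<sigma> r = \<sigma> s"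
      have "r i = s i" for i
      proof -
        have "(r i + co l i) mod D i = (s i + co l i) mod D i" using rs(3) by (metis \<sigma>_def)
        then have "(r i + co l i - co l i) mod D i = (s i + co l i - co l i) mod D i" by (metis mod_diff_left_eq)
        then have "r i mod D i = s i mod D i" by simp
        then show ?thesis using rs by (simp add: R_def)
      qed
      then show "r = s" by auto
    qed
    have "\<sigma> ` R = R" by (rule endo_inj_surj[OF finR _ inj]) (use \<sigma>R in auto)
    then have bij\<sigma>: "bij_betw \<sigma> R R" using inj by (simp add: bij_betw_def)
    have "ch k = (\<Sum>r\<in>R. cis (2 * pi * (y k \<bullet> y (\<sigma> r))))"
      unfolding ch_def by (rule sum.reindex_bij_betw[OF bij\<sigma>, symmetric])
    also have "\<dots> = (\<Sum>r\<in>R. c * cis (2 * pi * (y k \<bullet> y r)))"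
    proof (rule sum.cong)
      fix r
      define q where "q i = (r i + co l i) div D i" for i
      have "y k \<bullet> y (\<sigma> r) = y k \<bullet> y r + y k \<bullet> l - of_int (\<Sum>i\<in>UNIV. q i * k i)"
        using Yv[of "\<lambda>i. of_int (k i)", folded y_def]
        by (simp add: \<sigma>_eq q_def inner_diff_right inner_add_right inner_sum_right)
      then have "cis (2 * pi * (y k \<bullet> y (\<sigma> r))) = cis (2 * pi * (y k \<bullet> y r)) * cis (2 * pi * (y k \<bullet> l)) * cis (2 * pi * - of_int (\<Sum>i\<in>UNIV. q i * k i))"
        unfolding cis_mult by (intro arg_cong[where f=cis]) (simp only: right_diff_distrib distrib_left diff_conv_add_uminus mult_minus_right)
      also have "cis (2 * pi * - of_int (\<Sum>i\<in>UNIV. q i * k i)) = 1" by (rule cis_multiple_2pi, intro Ints_minus Ints_of_int)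
      finally show "cis (2 * pi * (y k \<bullet> y (\<sigma> r))) = c * cis (2 * pi * (y k \<bullet> y r))" by (simp add: c_def)
    qed simp
    also have "\<dots> = c * ch k" by (simp add: ch_def sum_distrib_left)
    finally have "ch k = 0" using c1 by simp
    then show ?thesis using False by simp
  qed
  define K where "K = complex_of_real (\<Prod>i\<in>UNIV. 1 / sqrt (d i)) * of_nat (card R)"
  show ?thesis
  proof (intro exI[of _ K] allI impI)
    fix t :: real and z :: "real ^ 'n" assume t: "t > 0"
    define w where "w i = z \<bullet> v i" for i
    have z: "z = Y w" using Y_coord[of z] by (simp add: w_def[abs_def])
    define a where "a i m = exp (- (pi * t / d i) * (real_of_int m + 0)\<^sup>2)" for i m
    define b where "b i m = exp (- (pi / t / d i) * (real_of_int m + - w i)\<^sup>2)" for i m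
    have a_sum: "a i summable_on UNIV" and b_sum: "b i summable_on UNIV" for i
      unfolding a_def b_def using t d0[of i] by (intro summable_on_int_gaussian; simp)+
    have a_prod: "exp (- (pi * t) * (norm (y k))\<^sup>2) = (\<Prod>i\<in>UNIV. a i (k i))" for k
      by (simp add: a_def exp_sum[symmetric] y_def Y_norm sum_distrib_left sum_negf)
    have b_prod: "exp (- (pi / t) * (norm (y k - z))\<^sup>2) = (\<Prod>i\<in>UNIV. b i (k i))" for k
      by (simp add: b_def exp_sum[symmetric] y_def z Y_diff Y_norm sum_distrib_left sum_negf mult.assoc)
    have a_all: "(\<lambda>k. \<Prod>i\<in>UNIV. a i (k i)) summable_on UNIV"
      by (rule abs_summable_on_prod_UNIV[OF a_sum]) (simp add: a_def)
    have b_all: "(\<lambda>k. \<Prod>i\<in>UNIV. b i (k i)) summable_on UNIV"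
      by (rule abs_summable_on_prod_UNIV[OF b_sum]) (simp add: b_def)
    have s1: "(\<lambda>x. exp (- (pi * t) * (norm x)\<^sup>2)) summable_on \<Lambda>"
      unfolding reindex_s a_prod by (rule summable_on_subset_banach[OF a_all]) simp
    have s2: "(\<lambda>x. exp (- (pi / t) * (norm (x - z))\<^sup>2)) summable_on \<Lambda>"
      unfolding reindex_s b_prod by (rule summable_on_subset_banach[OF b_all]) simp
    define g where "g i m = complex_of_real (a i m) * cis (2 * pi * (w i / d i) * m)" for i and m :: int
    have g_prod: "complex_of_real (exp (- (pi * t) * (norm (y k))\<^sup>2)) * cis (2 * pi * (y k \<bullet> z)) = (\<Prod>i\<in>UNIV. g i (k i))" for k
    proof -
      have "y k \<bullet> z = (\<Sum>i\<in>UNIV. w i / d i * k i)" by (simp add: y_def z YY mult.commute)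
      then have "cis (2 * pi * (y k \<bullet> z)) = (\<Prod>i\<in>UNIV. cis (2 * pi * (w i / d i) * k i))"
        by (simp add: cis_conv_exp exp_sum[symmetric] sum_distrib_left mult.assoc)
      then show ?thesis unfolding a_prod g_def by (simp add: prod.distrib)
    qed
    have norm_g: "norm (g i m) = a i m" for i m by (simp add: g_def norm_mult a_def)
    have "(\<lambda>k. \<Prod>i\<in>UNIV. g i (k i)) summable_on L'"
      by (rule abs_summable_summable, rule summable_on_subset_banach[of _ UNIV])
         (use a_all in \<open>auto simp: prod_norm[symmetric] norm_g\<close>)
    then have g_sum: "(\<lambda>(r, n). \<Prod>i\<in>UNIV. g i (h r n i)) summable_on (R \<times> UNIV)"
      using summable_on_reindex_bij_betw[OF bij, of "\<lambda>k. \<Prod>i\<in>UNIV. g i (k i)"] by (simp add: case_prod_unfold)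
    define B where "B i m r = complex_of_real (b i m) * cis (2 * pi * real_of_int m * (real_of_int r / d i))" for i and m r :: int
    have norm_B: "norm (B i m r) = b i m" for i m r by (simp add: B_def norm_mult b_def)
    have B_abs: "(\<lambda>m. norm (B i m r)) summable_on UNIV" for i r using b_sum[of i] by (simp add: norm_B)
    \<comment> \<open>Poisson summation in one variable with \<open>T = t * d i\<close>, offset
      \<open>a = r / d i\<close> and frequency \<open>b = w i\<close>; the offset \<open>r\<close>
      survives on the dual side only as a phase.\<close>
    have one: "(\<Sum>\<^sub>\<infinity>n. g i (r + D i * n)) = (1 / of_real (sqrt (t * d i))) * (\<Sum>\<^sub>\<infinity>m. B i m r)" for i r
    proof -
      have td: "t * d i > 0" using t d0 by simp
      have "g i (r + D i * n) = complex_of_real (exp (- (pi * (t * d i)) * (of_int n + r / d i)\<^sup>2)) * cis (2 * pi * w i * (of_int n + r / d i))" for n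
      proof -
        have e: "real_of_int (r + D i * n) = d i * (of_int n + r / d i)" using d0[of i] by (simp add: d_def field_simps)
        have "pi * t / d i * (d i * (of_int n + r / d i))\<^sup>2 = pi * (t * d i) * (of_int n + r / d i)\<^sup>2"
          using d0[of i] by (simp add: power2_eq_square)
        moreover have "2 * pi * (w i / d i) * (d i * (of_int n + r / d i)) = 2 * pi * w i * (of_int n + r / d i)"
          using d0[of i] by simp
        ultimately show ?thesis unfolding g_def a_def e by (simp only: add_0_right minus_mult_left[symmetric])
      qed
      then have "(\<Sum>\<^sub>\<infinity>n. g i (r + D i * n)) = (\<Sum>\<^sub>\<infinity>k::int. complex_of_real (exp (- (pi / (t * d i)) * (of_int k - w i)\<^sup>2)) * cis (2 * pi * of_int k * (r / d i))) / of_real (sqrt (t * d i))"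
        using poisson_summation_gaussian[OF td, of "r / d i" "w i"] by simp
      then show ?thesis by (simp add: B_def b_def)
    qed
    have "(\<Sum>\<^sub>\<infinity>x\<in>\<Lambda>. complex_of_real (exp (- (pi * t) * (norm x)\<^sup>2)) * cis (2 * pi * (x \<bullet> z))) = (\<Sum>\<^sub>\<infinity>k\<in>L'. \<Prod>i\<in>UNIV. g i (k i))"
      unfolding reindex g_prod ..
    also have "\<dots> = (\<Sum>\<^sub>\<infinity>(r, n)\<in>R \<times> UNIV. \<Prod>i\<in>UNIV. g i (h r n i))"
      using infsum_reindex_bij_betw[OF bij, of "\<lambda>k. \<Prod>i\<in>UNIV. g i (k i)"] by (simp add: case_prod_unfold)
    also have "\<dots> = (\<Sum>\<^sub>\<infinity>r\<in>R. \<Sum>\<^sub>\<infinity>n. \<Prod>i\<in>UNIV. g i (h r n i))"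
      by (rule infsum_Sigma'_banach[symmetric, OF g_sum])
    also have "\<dots> = (\<Sum>r\<in>R. \<Sum>\<^sub>\<infinity>n. \<Prod>i\<in>UNIV. g i (r i + D i * n i))"
      using finR by (simp add: h_def)
    also have "\<dots> = (\<Sum>r\<in>R. \<Prod>i\<in>UNIV. \<Sum>\<^sub>\<infinity>n. g i (r i + D i * n))"
    proof (rule sum.cong)
      fix r
      have "(\<lambda>n. norm (g i (r i + D i * n))) summable_on UNIV" for i
      proof -
        have "inj (\<lambda>n. r i + D i * n)" using D0[of i] by (auto simp: inj_on_def)
        moreover have "a i summable_on range (\<lambda>n. r i + D i * n)" by (rule summable_on_subset_banach[OF a_sum]) simp
        ultimately show ?thesis by (simp add: norm_g summable_on_reindex o_def)
      qed
      then show "(\<Sum>\<^sub>\<infinity>n. \<Prod>i\<in>UNIV. g i (r i + D i * n i)) = (\<Prod>i\<in>UNIV. \<Sum>\<^sub>\<infinity>n. g i (r i + D i * n))"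
        using infsum_prod_PiE_abs[of UNIV "\<lambda>i n. g i (r i + D i * n)" "\<lambda>_. UNIV"] by (simp add: PiE_UNIV_domain)
    qed simp
    also have "\<dots> = (\<Sum>r\<in>R. of_real (\<Prod>i\<in>UNIV. 1 / sqrt (t * d i)) * (\<Prod>i\<in>UNIV. \<Sum>\<^sub>\<infinity>m. B i m (r i)))"
      by (simp add: one prod.distrib prod_dividef)
    also have "\<dots> = (\<Sum>r\<in>R. of_real (\<Prod>i\<in>UNIV. 1 / sqrt (t * d i)) * (\<Sum>\<^sub>\<infinity>k. \<Prod>i\<in>UNIV. B i (k i) (r i)))"
      using infsum_prod_PiE_abs[of UNIV "\<lambda>i m. B i m (r i)" "\<lambda>_. UNIV" for r] B_abs by (simp add: PiE_UNIV_domain)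
    also have "\<dots> = of_real (\<Prod>i\<in>UNIV. 1 / sqrt (t * d i)) * (\<Sum>r\<in>R. \<Sum>\<^sub>\<infinity>k. \<Prod>i\<in>UNIV. B i (k i) (r i))"
      by (simp add: sum_distrib_left)
    also have "(\<Sum>r\<in>R. \<Sum>\<^sub>\<infinity>k. \<Prod>i\<in>UNIV. B i (k i) (r i)) = (\<Sum>\<^sub>\<infinity>k. \<Sum>r\<in>R. \<Prod>i\<in>UNIV. B i (k i) (r i))"
    proof (rule sum_infsum_swap[OF finR])
      show "(\<lambda>k. \<Prod>i\<in>UNIV. B i (k i) (r i)) summable_on UNIV" for r
        by (rule abs_summable_summable) (use b_all in \<open>auto simp: prod_norm[symmetric] norm_B\<close>)
    qed
    also have "\<dots> = (\<Sum>\<^sub>\<infinity>k. of_real (\<Prod>i\<in>UNIV. b i (k i)) * ch k)"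
    proof (rule infsum_cong)
      fix k
      have "(\<Prod>i\<in>UNIV. B i (k i) (r i)) = of_real (\<Prod>i\<in>UNIV. b i (k i)) * cis (2 * pi * (y k \<bullet> y r))" for r
      proof -
        have "cis (2 * pi * (y k \<bullet> y r)) = (\<Prod>i\<in>UNIV. cis (2 * pi * real_of_int (k i) * (real_of_int (r i) / d i)))"
          by (simp add: cis_conv_exp exp_sum[symmetric] sum_distrib_left mult.assoc y_def YY)
        then show ?thesis by (simp add: B_def prod.distrib)
      qed
      then show "(\<Sum>r\<in>R. \<Prod>i\<in>UNIV. B i (k i) (r i)) = of_real (\<Prod>i\<in>UNIV. b i (k i)) * ch k"
        by (simp add: ch_def sum_distrib_left)
    qed
    also have "\<dots> = (\<Sum>\<^sub>\<infinity>k\<in>L'. of_real (\<Prod>i\<in>UNIV. b i (k i)) * of_nat (card R))"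
      by (rule infsum_cong_neutral) (auto simp: ch)
    also have "\<dots> = (\<Sum>\<^sub>\<infinity>k\<in>L'. of_real (\<Prod>i\<in>UNIV. b i (k i))) * of_nat (card R)"
      by (rule infsum_cmult_left')
    also have "(\<Sum>\<^sub>\<infinity>k\<in>L'. complex_of_real (\<Prod>i\<in>UNIV. b i (k i))) = (\<Sum>\<^sub>\<infinity>x\<in>\<Lambda>. complex_of_real (exp (- (pi / t) * (norm (x - z))\<^sup>2)))"
      unfolding reindex b_prod ..
    also have "complex_of_real (\<Prod>i\<in>UNIV. 1 / sqrt (t * d i)) = of_real (\<Prod>i\<in>UNIV. 1 / sqrt (d i)) / of_real (sqrt t ^ CARD('n))"
      by (simp add: real_sqrt_mult prod_dividef prod.distrib)
    finally have "(\<Sum>\<^sub>\<infinity>x\<in>\<Lambda>. complex_of_real (exp (- (pi * t) * (norm x)\<^sup>2)) * cis (2 * pi * (x \<bullet> z)))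
     = K / of_real (sqrt t ^ CARD('n)) * (\<Sum>\<^sub>\<infinity>x\<in>\<Lambda>. complex_of_real (exp (- (pi / t) * (norm (x - z))\<^sup>2)))"
      by (simp add: K_def mult_ac)
    then show "(\<lambda>x. exp (- (pi * t) * (norm x)\<^sup>2)) summable_on \<Lambda> \<and>
     (\<lambda>x. exp (- (pi / t) * (norm (x - z))\<^sup>2)) summable_on \<Lambda> \<and>
     (\<Sum>\<^sub>\<infinity>x\<in>\<Lambda>. complex_of_real (exp (- (pi * t) * (norm x)\<^sup>2)) * cis (2 * pi * (x \<bullet> z)))
     = K / of_real (sqrt t ^ CARD('n)) * (\<Sum>\<^sub>\<infinity>x\<in>\<Lambda>. complex_of_real (exp (- (pi / t) * (norm (x - z))\<^sup>2)))"
      using s1 s2 by blast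
  qed
qed

lemma lattice_gaussian_summable:
  assumes "s > 0"
  shows "(\<lambda>x. exp (- s * (norm (x - z))\<^sup>2)) summable_on \<Lambda>"
proof -
  have "pi / s > 0" using assms by simp
  then have "(\<lambda>x. exp (- (pi / (pi / s)) * (norm (x - z))\<^sup>2)) summable_on \<Lambda>"
    using lattice_poisson_aux by blast
  then show ?thesis by simp
qed

text \<open>At \<open>t = 1\<close>, \<open>z = 0\<close> both sides of
  \<open>lattice_poisson_aux\<close> contain the same positive sum, which forces
  \<open>K = 1\<close>.\<close>

theorem lattice_poisson:
  assumes t: "t > 0"
  shows "(\<Sum>\<^sub>\<infinity>x\<in>\<Lambda>. complex_of_real (exp (- (pi * t) * (norm x)\<^sup>2)) * cis (2 * pi * (x \<bullet> z)))
     = (\<Sum>\<^sub>\<infinity>x\<in>\<Lambda>. complex_of_real (exp (- (pi / t) * (norm (x - z))\<^sup>2))) / of_real (sqrt t ^ CARD('n))"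
proof -
  obtain K where K: "\<And>t z. t > 0 \<Longrightarrow>
     (\<Sum>\<^sub>\<infinity>x\<in>\<Lambda>. complex_of_real (exp (- (pi * t) * (norm x)\<^sup>2)) * cis (2 * pi * (x \<bullet> z)))
     = K / of_real (sqrt t ^ CARD('n)) * (\<Sum>\<^sub>\<infinity>x\<in>\<Lambda>. complex_of_real (exp (- (pi / t) * (norm (x - z))\<^sup>2)))"
    using lattice_poisson_aux by blast
  define S where "S = (\<Sum>\<^sub>\<infinity>x\<in>\<Lambda>. exp (- pi * (norm (x - (0 :: real ^ 'n)))\<^sup>2))"
  have summ: "(\<lambda>x. exp (- pi * (norm (x - (0 :: real ^ 'n)))\<^sup>2)) summable_on \<Lambda>"
    by (rule lattice_gaussian_summable) simp
  have "sum (\<lambda>x :: real ^ 'n. exp (- pi * (norm (x - 0))\<^sup>2)) {0} \<le> S"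
    unfolding S_def by (rule finite_sum_le_infsum[OF summ]) (auto simp: lattice_zero)
  then have "S \<noteq> 0" by auto
  moreover have "complex_of_real S = K * complex_of_real S"
  proof -
    have "((\<lambda>x. exp (- pi * (norm (x - (0 :: real ^ 'n)))\<^sup>2)) has_sum S) \<Lambda>"
      unfolding S_def using summ by (rule has_sum_infsum)
    then have "(\<Sum>\<^sub>\<infinity>x\<in>\<Lambda>. complex_of_real (exp (- pi * (norm (x - (0 :: real ^ 'n)))\<^sup>2))) = of_real S"
      by (intro infsumI) (subst has_sum_of_real_iff)
    then show ?thesis using K[of 1 0] by simp
  qed
  ultimately have "K = 1" by simp
  then show ?thesis using K[OF t, of z] by simp
qed

end

section \<open>Modular forms vanishing to order two\<close>

text \<open>The numerical margin of \<open>modular_form_vanishes\<close>: at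
  \<open>y = sqrt 3 / 2\<close> it compares about 2.79 with about 2.97. The bound on
  \<open>exp 1.08\<close> is the fourth power of a quadratic Taylor bound for
  \<open>exp 0.27\<close>.\<close>

lemma exp_decay_numeric:
  fixes y :: real
  assumes y: "y \<ge> sqrt 3 / 2"
  shows "(20/19) ^ 20 < exp (8 * pi * (y - 19/20 * y))"
proof -
  have "sqrt 3 \<ge> 1.73" by (rule real_le_rsqrt) (simp add: power2_eq_square)
  then have "y \<ge> 0.865" using y by simp
  moreover have "pi > 3.14" using pi_approx by simp
  ultimately have "3.14 * 0.865 \<le> pi * y" by (intro mult_mono) auto
  then have "1.08 \<le> 8 * pi * (y - 19/20 * y)" by (simp add: algebra_simps)
  then have "exp 1.08 \<le> exp (8 * pi * (y - 19/20 * y))" by simp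
  moreover have "exp (1.08::real) = exp 0.27 ^ 4" by (simp flip: exp_of_nat_mult)
  moreover have "(1 + 0.27 + 0.27\<^sup>2 / 2) ^ 4 \<le> exp (0.27::real) ^ 4"
    by (intro power_mono exp_lower_Taylor_quadratic) auto
  moreover have "(20/19) ^ 20 < (1 + 0.27 + 0.27\<^sup>2 / 2 :: real) ^ 4"
    by (simp add: power_divide field_simps)
  ultimately show ?thesis by linarith
qed

lemma power_exp_decay_at_top:
  fixes k :: nat and c :: real
  assumes "c > 0"
  shows "((\<lambda>y. y ^ k * exp (- (c * y))) \<longlongrightarrow> 0) at_top"
proof -
  have "filterlim (\<lambda>y. c * y) at_top at_top"
    using assms by (intro filterlim_tendsto_pos_mult_at_top[OF tendsto_const] filterlim_ident) auto
  then have "((\<lambda>y. (c * y) ^ k / exp (c * y)) \<longlongrightarrow> 0) at_top"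
    by (rule filterlim_compose[OF tendsto_power_div_exp_0])
  then have "((\<lambda>y. (c * y) ^ k / exp (c * y) / c ^ k) \<longlongrightarrow> 0 / c ^ k) at_top"
    using assms by (intro tendsto_divide) auto
  then show ?thesis
    using assms by (simp add: power_mult_distrib exp_minus field_simps)
qed

text \<open>\<open>F\<close> has period 1 and satisfies the weight \<open>k\<close> law under
  inversion, so \<open>G\<close>, the squared modulus of \<open>F\<close> times
  \<open>Im \<tau> ^ k\<close>, is invariant under both maps. If \<open>F\<close> were nonzero
  somewhere above height \<open>c\<close>, \<open>G\<close> would have a positive maximum
  \<open>G \<tau>0\<close> there. With \<open>F = q^2 p\<close>, the maximum principle for
  \<open>p\<close> compares the height of \<open>\<tau>0\<close> with a slightly lower one: the
  factor \<open>q^2\<close> loses more than the power of the height can gain.\<close>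

theorem modular_form_vanishes:
  fixes a :: "nat \<Rightarrow> complex" and k :: nat
  assumes summ: "\<And>r. 0 \<le> r \<Longrightarrow> r < 1 \<Longrightarrow> summable (\<lambda>m. norm (a m) * r ^ m)"
    and a01: "a 0 = 0" "a 1 = 0" and k: "k \<le> 20"
    and fe: "\<And>t::real. t > 0 \<Longrightarrow>
      (\<Sum>m. a m * of_real (exp (- 2 * pi / t)) ^ m) = (\<i> * of_real t) ^ k * (\<Sum>m. a m * of_real (exp (- 2 * pi * t)) ^ m)"
  shows "a m = 0"
proof -
  define f where "f z = (\<Sum>m. a m * z ^ m)" for z :: complex
  define p where "p z = (\<Sum>m. a (m + 2) * z ^ m)" for z :: complex
  have sums_f: "(\<lambda>m. a m * z ^ m) sums f z" if "norm z < 1" for z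
    unfolding f_def
    by (intro summable_sums summable_norm_cancel[where f="\<lambda>m. a m * z ^ m"])
       (use summ[of "norm z"] that in \<open>simp add: norm_mult norm_power\<close>)
  have f_zero: "f 0 = 0" using a01 sums_f[of 0] by (simp add: f_def)
  have sums_p: "(\<lambda>m. a (m + 2) * z ^ m) sums p z" and f_p: "f z = z ^ 2 * p z" if z: "norm z < 1" for z
  proof -
    show *: "(\<lambda>m. a (m + 2) * z ^ m) sums p z"
    proof (cases "z = 0")
      case True
      then show ?thesis unfolding p_def
        using powser_sums_zero[of "\<lambda>m. a (m + 2)"] by (metis sums_unique)
    next
      case False
      have "summable (\<lambda>m. a (m + 2) * z ^ (m + 2))"
        using sums_f[OF z] summable_iff_shift[of "\<lambda>m. a m * z ^ m" 2] by (simp add: sums_iff)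
      then have "summable (\<lambda>m. a (m + 2) * z ^ (m + 2) / z ^ 2)" by (rule summable_divide)
      then show ?thesis unfolding p_def using False
        by (intro summable_sums) (simp add: power_add power2_eq_square)
    qed
    have "(\<lambda>m. z ^ 2 * (a (m + 2) * z ^ m)) sums (z ^ 2 * p z)"
      by (intro sums_mult *)
    then have "(\<lambda>m. a (m + 2) * z ^ (m + 2)) sums (z ^ 2 * p z)" by (simp add: power_add power2_eq_square mult_ac)
    moreover have "(\<lambda>m. a (m + 2) * z ^ (m + 2)) sums (f z - (\<Sum>i<2. a i * z ^ i))"
      using sums_f[OF z] by (subst sums_iff_shift) simp
    ultimately have "z ^ 2 * p z = f z - (\<Sum>i<2. a i * z ^ i)" by (rule sums_unique2)
    then show "f z = z ^ 2 * p z" using a01 by (simp add: numeral_2_eq_2)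
  qed
  have hol_f: "f holomorphic_on ball 0 1"
    by (rule power_series_holomorphic[where a=a]) (use sums_f in auto)
  have hol_p: "p holomorphic_on ball 0 1"
    by (rule power_series_holomorphic[where a="\<lambda>m. a (m+2)"]) (use sums_p in auto)
  define q where "q \<tau> = exp (2 * pi * \<i> * \<tau>)" for \<tau> :: complex
  define F where "F \<tau> = f (q \<tau>)" for \<tau>
  have norm_q: "norm (q \<tau>) = exp (- 2 * pi * Im \<tau>)" for \<tau> by (simp add: q_def)
  have q_in: "norm (q \<tau>) < 1" if "Im \<tau> > 0" for \<tau> using that by (simp add: norm_q)
  have hol_F: "F holomorphic_on {\<tau>. Im \<tau> > 0}"
    unfolding F_def
    by (rule holomorphic_on_compose_gen[unfolded o_def, where t="ball 0 1", OF _ hol_f])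
       (use q_in in \<open>auto simp: q_def intro!: holomorphic_intros\<close>)
  have F_add: "F (\<tau> + of_int n) = F \<tau>" for \<tau> n
  proof -
    have "q (\<tau> + of_int n) = q \<tau>"
      unfolding q_def using exp_integer_2pi[of "of_int n"]
      by (simp add: exp_add distrib_left mult_ac)
    then show ?thesis by (simp add: F_def)
  qed
  have Im_S: "Im (- 1 / \<tau>) = Im \<tau> / (norm \<tau>)\<^sup>2" for \<tau> :: complex
    by (simp add: Im_divide cmod_power2)
  have F_S: "F (- 1 / \<tau>) = \<tau> ^ k * F \<tau>" if "Im \<tau> > 0" for \<tau>
  proof -
    \<comment> \<open>The functional equation is given on the imaginary axis only; the identity
      theorem carries it to the half-plane.\<close>
    define D where "D \<tau> = F (- 1 / \<tau>) - \<tau> ^ k * F \<tau>" for \<tau>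
    define H where "H = {\<tau>::complex. Im \<tau> > 0}"
    have "D \<tau> = 0"
    proof (rule analytic_continuation[where S=H and U="(\<lambda>t. \<i> * of_real t) ` {0<..}" and \<xi>=\<i> and f=D])
      have "(\<lambda>\<tau>. F (- 1 / \<tau>)) holomorphic_on H"
      proof (rule holomorphic_on_compose_gen[unfolded o_def, OF _ hol_F])
        show "(\<lambda>\<tau>. - 1 / \<tau>) holomorphic_on H" by (intro holomorphic_intros) (auto simp: H_def)
        show "(\<lambda>\<tau>. - 1 / \<tau>) ` H \<subseteq> {\<tau>. Im \<tau> > 0}"
          unfolding H_def using Im_S by (auto intro!: divide_pos_pos)
      qed
      then show "D holomorphic_on H" unfolding D_def H_def
        by (intro holomorphic_intros hol_F) 
      show "open H" "connected H"
        by (auto simp: H_def open_halfspace_Im_gt intro!: convex_connected convex_halfspace_Im_gt)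
      show "(\<lambda>t. \<i> * complex_of_real t) ` {0<..} \<subseteq> H" by (auto simp: H_def)
      show "\<i> \<in> H" "\<tau> \<in> H" using that by (auto simp: H_def)
      have "(\<lambda>n. \<i> * of_real (1 + inverse (real (Suc n)))) \<longlonglongrightarrow> \<i> * of_real (1 + 0)"
        by (intro tendsto_intros LIMSEQ_inverse_real_of_nat)
      then show "\<i> islimpt (\<lambda>t. \<i> * complex_of_real t) ` {0<..}"
        unfolding islimpt_sequential
        by (intro exI[of _ "\<lambda>n. \<i> * of_real (1 + inverse (real (Suc n)))"])
           (auto intro!: imageI add_pos_pos simp: complex_eq_iff)
      show "D z = 0" if zU: "z \<in> (\<lambda>t. \<i> * complex_of_real t) ` {0<..}" for z
      proof -
        obtain t where t: "t > 0" "z = \<i> * of_real t" using zU by auto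
        have "q z = of_real (exp (- 2 * pi * t))"
          by (simp add: q_def t flip: exp_of_real) (simp add: algebra_simps)
        moreover have "q (- 1 / z) = of_real (exp (- 2 * pi / t))"
          using t by (simp add: q_def exp_of_real[symmetric] field_simps)
        ultimately show ?thesis using fe[OF t(1)] t by (simp add: D_def F_def f_def)
      qed
    qed
    then show ?thesis by (simp add: D_def)
  qed
  define G where "G \<tau> = (norm (F \<tau>))\<^sup>2 * Im \<tau> ^ k" for \<tau>
  have G_add: "G (\<tau> + of_int n) = G \<tau>" for \<tau> n by (simp add: G_def F_add)
  have G_S: "G (- 1 / \<tau>) = G \<tau>" if "Im \<tau> > 0" for \<tau>
  proof -
    have "\<tau> \<noteq> 0" using that by auto
    moreover from this have "((norm \<tau>)\<^sup>2) ^ k \<noteq> 0" by simp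
    moreover have "(norm \<tau> ^ k)\<^sup>2 = ((norm \<tau>)\<^sup>2) ^ k" by (simp add: mult.commute flip: power_mult)
    ultimately show ?thesis unfolding G_def F_S[OF that] Im_S norm_mult norm_power power_mult_distrib power_divide
      by simp
  qed
  have cont_G: "continuous_on {\<tau>. Im \<tau> > 0} G"
    unfolding G_def by (intro continuous_intros holomorphic_on_imp_continuous_on hol_F)
  \<comment> \<open>The minimal height of the standard fundamental domain of the modular
    group.\<close>
  define c where "c = sqrt 3 / 2"
  have c: "c > 0" "c\<^sup>2 = 3/4" by (simp_all add: c_def power_divide)
  have c_le: "c \<le> 1"
    using c by (intro power2_le_imp_le[of c 1]) auto
  have red: "\<exists>n::int. \<bar>Re (\<tau> + of_int n)\<bar> \<le> 1/2" for \<tau>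
    by (rule exI[of _ "- round (Re \<tau>)"]) (use of_int_round_abs_le[of "Re \<tau>"] in \<open>simp add: abs_minus_commute\<close>)
  have F0: "F \<tau> = 0" if "Im \<tau> \<ge> c" for \<tau>
  proof (rule ccontr)
    assume nz: "F \<tau> \<noteq> 0"
    have Gpos: "G \<tau> > 0" using nz that c unfolding G_def by simp
    have "compact (cball (0::complex) (exp (- 2 * pi * c)))" by simp
    moreover have "continuous_on (cball (0::complex) (exp (- 2 * pi * c))) p"
      by (rule holomorphic_on_imp_continuous_on, rule holomorphic_on_subset[OF hol_p])
        (use c in \<open>auto simp: subset_iff intro: le_less_trans\<close>)
    ultimately have "bounded (p ` cball 0 (exp (- 2 * pi * c)))"
      using compact_continuous_image compact_imp_bounded by blast
    then obtain B where B: "B > 0" "\<And>z. norm z \<le> exp (- 2 * pi * c) \<Longrightarrow> norm (p z) \<le> B"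
      unfolding bounded_pos by auto
    have G_le: "G \<sigma> \<le> B\<^sup>2 * (Im \<sigma> ^ k * exp (- (8 * pi * Im \<sigma>)))" if "Im \<sigma> \<ge> c" for \<sigma>
    proof -
      have "Im \<sigma> > 0" using that c by auto
      have "norm (F \<sigma>) = exp (- 2 * pi * Im \<sigma>) ^ 2 * norm (p (q \<sigma>))"
        using f_p[OF q_in[OF \<open>Im \<sigma> > 0\<close>]] by (simp add: F_def norm_mult norm_power norm_q)
      also have "\<dots> \<le> exp (- 2 * pi * Im \<sigma>) ^ 2 * B"
        by (intro mult_left_mono B) (use that in \<open>auto simp: norm_q\<close>)
      finally have "(norm (F \<sigma>))\<^sup>2 \<le> (exp (- 2 * pi * Im \<sigma>) ^ 2 * B)\<^sup>2"
        by (intro power_mono) auto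
      also have "\<dots> = B\<^sup>2 * exp (- (8 * pi * Im \<sigma>))"
        by (simp add: power_mult_distrib flip: exp_of_nat_mult)
      finally have "(norm (F \<sigma>))\<^sup>2 * Im \<sigma> ^ k \<le> B\<^sup>2 * exp (- (8 * pi * Im \<sigma>)) * Im \<sigma> ^ k"
        using \<open>Im \<sigma> > 0\<close> by (intro mult_right_mono) auto
      then show ?thesis unfolding G_def by (simp add: mult_ac)
    qed
    \<comment> \<open>High in the half-plane \<open>G\<close> falls below \<open>G \<tau>\<close>,
      so its supremum over heights at least \<open>c\<close> is attained in a compact rectangle of
      width 1.\<close>
    have "((\<lambda>y. B\<^sup>2 * (y ^ k * exp (- (8 * pi * y)))) \<longlongrightarrow> B\<^sup>2 * 0) at_top"
      by (intro tendsto_mult tendsto_const power_exp_decay_at_top) auto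
    then have "eventually (\<lambda>y. B\<^sup>2 * (y ^ k * exp (- (8 * pi * y))) < G \<tau>) at_top"
      using Gpos by (auto dest: order_tendstoD)
    then obtain Y0 where Y0: "\<And>y. y \<ge> Y0 \<Longrightarrow> B\<^sup>2 * (y ^ k * exp (- (8 * pi * y))) < G \<tau>"
      by (auto simp: eventually_at_top_linorder)
    define Y where "Y = max Y0 (max c (Im \<tau>))"
    define K where "K = {z. \<bar>Re z\<bar> \<le> 1/2 \<and> c \<le> Im z \<and> Im z \<le> Y}"
    have K_eq: "K = cbox (Complex (-1/2) c) (Complex (1/2) Y)"
      by (auto simp: K_def in_cbox_complex_iff abs_le_iff)
    have "compact K" unfolding K_eq by simp
    moreover have tK: "\<exists>n. \<tau> + of_int n \<in> K" using red[of \<tau>] that by (auto simp: K_def Y_def)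
    moreover have "continuous_on K G"
      by (rule continuous_on_subset[OF cont_G]) (use c in \<open>auto simp: K_def\<close>)
    ultimately obtain \<tau>0 where \<tau>0: "\<tau>0 \<in> K" "\<And>z. z \<in> K \<Longrightarrow> G z \<le> G \<tau>0"
      using continuous_attains_sup[of K G] by blast
    obtain n where "\<tau> + of_int n \<in> K" using tK by blast
    then have G\<tau>: "G \<tau> \<le> G \<tau>0" using \<tau>0(2) G_add by metis
    have max1: "G \<sigma> \<le> G \<tau>0" if "Im \<sigma> \<ge> c" for \<sigma>
    proof (cases "Im \<sigma> \<le> Y")
      case True
      obtain n where "\<bar>Re (\<sigma> + of_int n)\<bar> \<le> 1/2" using red by blast
      then have "\<sigma> + of_int n \<in> K" using True that by (auto simp: K_def)
      then show ?thesis using \<tau>0(2) G_add by metis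
    next
      case False
      then have "Im \<sigma> \<ge> Y0" by (simp add: Y_def)
      then show ?thesis using G_le[OF that] Y0[of "Im \<sigma>"] G\<tau> by linarith
    qed
    \<comment> \<open>After a translation to \<open>\<bar>Re \<rho>\<bar> \<le> 1/2\<close>, one
      inversion lifts any height between \<open>1/2\<close> and \<open>c\<close> to at least
      \<open>c\<close>. The worst case is \<open>Re \<rho> = 1/2\<close>; the quadratic that decides
      it has the roots \<open>c\<close> and \<open>c / 3\<close>.\<close>
    have max2: "G \<sigma> \<le> G \<tau>0" if "Im \<sigma> \<ge> 1/2" for \<sigma>
    proof (cases "Im \<sigma> \<ge> c")
      case True then show ?thesis by (rule max1)
    next
      case False
      obtain n where n: "\<bar>Re (\<sigma> + of_int n)\<bar> \<le> 1/2" using red by blast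
      define \<rho> where "\<rho> = \<sigma> + of_int n"
      define y where "y = Im \<sigma>"
      have \<rho>: "\<bar>Re \<rho>\<bar> \<le> 1/2" "Im \<rho> = y" using n by (auto simp: \<rho>_def y_def)
      have y: "1/2 \<le> y" "y < c" using that False by (auto simp: y_def)
      have "(Re \<rho>)\<^sup>2 \<le> (1/2)\<^sup>2" using \<rho>(1) by (metis abs_le_square_iff abs_of_nonneg zero_le_divide_1_iff zero_le_numeral)
      then have nr: "(norm \<rho>)\<^sup>2 \<le> 1/4 + y\<^sup>2" by (simp add: cmod_power2 \<rho> power_divide)
      have "0 \<le> (c - y) * (3 * y - c)" using y c
        using c_le by (intro mult_nonneg_nonneg) auto
      then have "0 \<le> 4 * c * y - c\<^sup>2 - 3 * y\<^sup>2" by (simp add: algebra_simps power2_eq_square)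
      then have "3 * (1/4 + y\<^sup>2) \<le> 4 * c * y" using c by simp
      then have "c * (3 * (1/4 + y\<^sup>2)) \<le> c * (4 * c * y)" using c by (intro mult_left_mono) auto
      also have "\<dots> = 3 * y" using c(2) by (simp add: power2_eq_square)
      finally have "c * (1/4 + y\<^sup>2) \<le> y" by argo
      then have "c * (norm \<rho>)\<^sup>2 \<le> y" using nr c by (smt (verit) mult_left_mono)
      moreover have "\<rho> \<noteq> 0" using \<rho> y by auto
      ultimately have "c \<le> Im (- 1 / \<rho>)" unfolding Im_S \<rho>(2) by (simp add: field_simps)
      then have "G (- 1 / \<rho>) \<le> G \<tau>0" by (rule max1)
      moreover have "G (- 1 / \<rho>) = G \<sigma>" using G_S[of \<rho>] G_add \<rho> y by (simp add: \<rho>_def)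
      ultimately show ?thesis by simp
    qed
    define y0 where "y0 = Im \<tau>0"
    \<comment> \<open>The comparison height stays above \<open>1/2\<close>, where
      \<open>max2\<close> applies. The ratio 19/20 is close enough to 1 for the exponential loss to
      beat \<open>(20/19) ^ 20\<close>.\<close>
    define y1 where "y1 = 19/20 * y0"
    have y0: "y0 \<ge> c" using \<tau>0 by (simp add: K_def y0_def)
    have c_half: "c \<ge> 0.86" unfolding c_def
      using real_le_rsqrt[of "1.73" 3] by (simp add: power2_eq_square)
    have y1: "y1 \<ge> 1/2" "y1 < y0" "y1 > 0" using y0 c_half by (auto simp: y1_def)
    define E where "E = sqrt (G \<tau>0 / y1 ^ k) * exp (4 * pi * y1)"
    have bd: "norm (p z) \<le> E" if z: "norm z = exp (- 2 * pi * y1)" for z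
    proof -
      have "z \<noteq> 0" using z by auto
      define \<sigma> where "\<sigma> = Ln z / (2 * pi * \<i>)"
      have qz: "q \<sigma> = z" using \<open>z \<noteq> 0\<close> by (simp add: q_def \<sigma>_def)
      then have "exp (- 2 * pi * Im \<sigma>) = exp (- 2 * pi * y1)" using norm_q[of \<sigma>] z by simp
      then have Im: "Im \<sigma> = y1" by simp
      have "(norm (F \<sigma>))\<^sup>2 \<le> G \<tau>0 / y1 ^ k" using max2[of \<sigma>] Im y1 by (simp add: G_def field_simps)
      then have "norm (F \<sigma>) \<le> sqrt (G \<tau>0 / y1 ^ k)" by (rule real_le_rsqrt)
      moreover have "norm (F \<sigma>) = exp (- 4 * pi * y1) * norm (p z)"
        using f_p[of z] z y1 by (simp add: F_def qz norm_mult norm_power flip: exp_of_nat_mult)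
      ultimately show ?thesis unfolding E_def by (simp add: exp_minus field_simps)
    qed
    \<comment> \<open>The circle of height \<open>y1\<close> encloses \<open>q \<tau>0\<close>,
      since a lower height means a larger radius; on it \<open>E\<close> bounds \<open>p\<close>
      through the maximality of \<open>G \<tau>0\<close>.\<close>
    have p_le: "norm (p (q \<tau>0)) \<le> E"
    proof (rule maximum_modulus_frontier[where f=p and S="cball 0 (exp (- 2 * pi * y1))"])
      have sub: "cball 0 (exp (- 2 * pi * y1)) \<subseteq> ball (0::complex) 1"
        using y1 order.strict_trans1[of _ "exp (- (2 * pi * y1))" 1] by auto
      show "p holomorphic_on interior (cball 0 (exp (- 2 * pi * y1)))"
        by (rule holomorphic_on_subset[OF hol_p]) (use sub interior_subset in blast)
      show "continuous_on (closure (cball 0 (exp (- 2 * pi * y1)))) p"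
        by (rule holomorphic_on_imp_continuous_on, rule holomorphic_on_subset[OF hol_p]) (use sub in auto)
      show "q \<tau>0 \<in> cball 0 (exp (- 2 * pi * y1))" using y1 by (simp add: norm_q y0_def)
      show "norm (p z) \<le> E" if "z \<in> frontier (cball 0 (exp (- 2 * pi * y1)))" for z
        by (rule bd) (use that in auto)
    qed auto
    have "norm (F \<tau>0) = exp (- 4 * pi * y0) * norm (p (q \<tau>0))"
      using f_p[of "q \<tau>0"] q_in[of \<tau>0] y0 c by (simp add: F_def norm_mult norm_power norm_q y0_def flip: exp_of_nat_mult)
    also have "\<dots> \<le> exp (- 4 * pi * y0) * E" using p_le by simp
    finally have "(norm (F \<tau>0))\<^sup>2 \<le> (exp (- 4 * pi * y0) * E)\<^sup>2" by (intro power_mono) auto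
    also have "\<dots> = exp (- 8 * pi * y0) * exp (8 * pi * y1) * (G \<tau>0 / y1 ^ k)"
      using Gpos G\<tau> y1 by (simp add: E_def power_mult_distrib mult.assoc flip: exp_of_nat_mult)
    also have "\<dots> = exp (- 8 * pi * y0) * exp (8 * pi * y1) * ((norm (F \<tau>0))\<^sup>2 * (y0 / y1) ^ k)"
      by (simp add: G_def y0_def power_divide)
    finally have *: "(norm (F \<tau>0))\<^sup>2 \<le> (norm (F \<tau>0))\<^sup>2 * (exp (- 8 * pi * y0) * exp (8 * pi * y1) * (y0 / y1) ^ k)"
      by (simp add: mult_ac)
    have "(norm (F \<tau>0))\<^sup>2 > 0" using Gpos G\<tau> by (auto simp: G_def)
    then have "1 \<le> exp (- 8 * pi * y0) * exp (8 * pi * y1) * (y0 / y1) ^ k" using * by simp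
    also have "y0 / y1 = 20/19" using y0 c by (simp add: y1_def)
    finally have "exp (8 * pi * (y0 - y1)) \<le> (20/19) ^ k"
      by (simp add: exp_minus exp_diff right_diff_distrib field_simps)
    also have "\<dots> \<le> (20/19) ^ 20" using k by (intro power_increasing) auto
    also have "\<dots> < exp (8 * pi * (y0 - y1))"
      using exp_decay_numeric[of y0] y0 by (simp add: y1_def c_def)
    finally show False by simp
  qed
  \<comment> \<open>Vanishing above height \<open>c\<close> means that the power series vanishes
    near 0, which kills all coefficients because zeros are isolated.\<close>
  have "f z = 0" if z: "norm z < exp (- 2 * pi * c)" for z
  proof (cases "z = 0")
    case False
    define \<sigma> where "\<sigma> = Ln z / (2 * pi * \<i>)"
    have qz: "q \<sigma> = z" using False by (simp add: q_def \<sigma>_def)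
    then have "exp (- 2 * pi * Im \<sigma>) < exp (- 2 * pi * c)" using norm_q[of \<sigma>] z by simp
    then have "Im \<sigma> \<ge> c" by simp
    then show ?thesis using F0[of \<sigma>] by (simp add: F_def qz)
  qed (use f_zero in simp)
  then have fz: "f z = 0" if "norm z < exp (- 2 * pi * c)" for z using that by blast
  show "a m = 0"
  proof (rule ccontr)
    assume "a m \<noteq> 0"
    then have "m > 0" using a01 by (cases m) auto
    obtain s where s: "0 < s" "\<And>z. z \<in> cball 0 s - {0} \<Longrightarrow> f z \<noteq> 0"
      by (rule powser_0_nonzero[of "1" 0 a f m]) (use sums_f f_zero \<open>a m \<noteq> 0\<close> \<open>m > 0\<close> in auto)
    have e: "exp (- 2 * pi * c) > 0" by simp
    define w where "w = min s (exp (- 2 * pi * c) / 2)"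
    have "w > 0" using s exp_gt_zero[of "- 2 * pi * c"] unfolding w_def by linarith
    then have "f (of_real w) \<noteq> 0" using e by (intro s(2)) (auto simp: w_def min_def split: if_splits)
    moreover have "w < exp (- 2 * pi * c)"
      using exp_gt_zero[of "- 2 * pi * c"] unfolding w_def by linarith
    then have "f (of_real w) = 0" using fz[of "of_real w"] \<open>w > 0\<close> by simp
    ultimately show False by simp
  qed
qed

section \<open>Moments of the surface measure\<close>

text \<open>The even moment of order \<open>2 * k\<close> of one coordinate on the unit sphere: 1 *
  3 * ... * (2 k - 1) divided by n (n + 2) ... (n + 2 k - 2).\<close>

definition sphere_moment :: "nat \<Rightarrow> nat \<Rightarrow> real" where
  "sphere_moment n k = (\<Prod>i<k. (2 * real i + 1) / (real n + 2 * real i))"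

text \<open>Coefficients of \<open>s\<close> are compared in the moment of \<open>x + s y\<close>,
  whose squared length is \<open>A + 2 * B * s + C * s^2\<close>. One-vector moments thus determine
  all two-vector moments, for the surface measure and for lattice shells alike.\<close>

lemma polarization:
  fixes \<mu> :: "nat \<Rightarrow> real"
  assumes "\<And>s. (\<Sum>j\<le>2*m. of_nat (2*m choose j) * \<mu> j * s ^ j) = K * (A + 2 * B * s + C * s\<^sup>2) ^ m"
    and j: "j \<le> 2 * m"
  shows "of_nat (2*m choose j) * \<mu> j = K * coeff ([:A, 2 * B, C:] ^ m) j"
proof -
  define p where "p = (\<Sum>j\<le>2*m. monom (of_nat (2*m choose j) * \<mu> j) j)"
  have "poly p = poly (smult K ([:A, 2 * B, C:] ^ m))"
    using assms(1) by (intro ext) (simp add: p_def poly_sum poly_monom power2_eq_square algebra_simps)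
  then have "p = smult K ([:A, 2 * B, C:] ^ m)" by (rule poly_eq_poly_eq_iff[THEN iffD1])
  then have "coeff p j = K * coeff ([:A, 2 * B, C:] ^ m) j" by simp
  moreover have "coeff p j = of_nat (2*m choose j) * \<mu> j" using j by (simp add: p_def coeff_sum)
  ultimately show ?thesis by simp
qed

lemma emeasure_lborel_orthogonal_vimage:
  fixes f :: "real ^ 'n::{finite,wellorder} \<Rightarrow> real ^ 'n::_"
  assumes f: "orthogonal_transformation f" and A: "A \<in> sets borel"
  shows "emeasure lborel (ball 0 1 \<inter> f -` A) = emeasure lborel (ball 0 1 \<inter> A)"
proof -
  have fm[measurable]: "f \<in> borel_measurable borel"
    using f by (intro borel_measurable_continuous_onI linear_continuous_on linear_conv_bounded_linear[THEN iffD1]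
        orthogonal_transformation_linear)
  have [measurable]: "A \<in> sets borel" by (rule A)
  have sets: "ball 0 1 \<inter> f -` A \<in> sets borel" "ball 0 1 \<inter> A \<in> sets borel"
    using measurable_sets[OF fm A] A by auto
  have fin: "emeasure lborel (ball 0 1 \<inter> B) < \<infinity>" if "B \<in> sets borel" for B :: "(real ^ 'n::_) set"
    by (rule le_less_trans[OF emeasure_mono emeasure_lborel_ball_finite]) (use that in auto)
  have vim: "f -` A \<in> sets borel" using measurable_sets[OF fm A] by auto
  have lm: "ball 0 1 \<inter> B \<in> lmeasurable" if "B \<in> sets borel" for B :: "(real ^ 'n::_) set"
    using that fin[OF that] by (intro fmeasurableI) auto
  have im: "f ` (ball 0 1 \<inter> f -` A) = ball 0 1 \<inter> A"
  proof -
    have "f ` (ball 0 1 \<inter> f -` A) = f ` ball 0 1 \<inter> A" by blast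
    then show ?thesis using image_orthogonal_transformation_ball[OF f, of 0 1] f
      by (simp add: linear_0 orthogonal_transformation_linear)
  qed
  have "measure lebesgue (ball 0 1 \<inter> A) = measure lebesgue (ball 0 1 \<inter> f -` A)"
    using measure_orthogonal_image[OF f lm[OF vim]] by (simp add: im)
  then show ?thesis
    using sets fin[OF vim] fin[OF A]
    by (simp add: emeasure_eq_ennreal_measure[OF less_imp_neq])
qed

lemma emeasure_unit_ball_pos: "emeasure lborel (ball (0 :: real ^ 'n) 1) \<noteq> 0"
proof
  assume "emeasure lborel (ball (0 :: real ^ 'n) 1) = 0"
  then have "measure lborel (ball (0 :: real ^ 'n) 1) = 0" by (simp add: measure_def)
  then show False using content_ball_pos[of 1 "0 :: real ^ 'n"] by simp
qed

lemma prob_space_surface_measure: "prob_space (surface_measure :: (real ^ 'n) measure)"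
proof -
  interpret U: prob_space "uniform_measure lborel (ball (0 :: real ^ 'n) 1)"
    by (rule prob_space_uniform_measure) (use emeasure_unit_ball_pos emeasure_lborel_ball_finite[of 0 1] in \<open>auto simp: less_top\<close>)
  show ?thesis unfolding surface_measure_def
    by (rule U.prob_space_distr) (simp add: uniform_measure_def)
qed

lemma sets_surface_measure [simp, measurable_cong]: "sets surface_measure = sets borel"
  and space_surface_measure [simp]: "space surface_measure = UNIV"
  by (simp_all add: surface_measure_def)

lemma measurable_sgn_uniform [measurable]:
  "sgn \<in> measurable (uniform_measure lborel (ball (0 :: real ^ 'n) 1)) borel"
  by (simp add: uniform_measure_def)

lemma AE_surface_measure_norm: "AE x in surface_measure. norm (x :: real ^ 'n) = 1"
proof -
  have "AE x in lborel. x \<noteq> (0 :: real ^ 'n)" by (rule AE_lborel_singleton)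
  then have "AE x in uniform_measure lborel (ball (0 :: real ^ 'n) 1). norm (sgn x) = 1"
    by (intro AE_uniform_measureI) (auto simp: norm_sgn)
  then show ?thesis unfolding surface_measure_def
    by (subst AE_distr_iff) auto
qed

text \<open>The radial projection \<open>sgn\<close> commutes with orthogonal maps, so the
  invariance of the uniform distribution on the ball descends to the sphere.\<close>

lemma distr_surface_measure_orthogonal:
  fixes f :: "real ^ 'n::{finite,wellorder} \<Rightarrow> real ^ 'n::_"
  assumes f: "orthogonal_transformation f"
  shows "distr surface_measure borel f = surface_measure"
proof -
  define U where "U = uniform_measure lborel (ball (0 :: real ^ 'n::_) 1)"
  have fm[measurable]: "f \<in> borel_measurable borel"
    using f by (intro borel_measurable_continuous_onI linear_continuous_on linear_conv_bounded_linear[THEN iffD1]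
        orthogonal_transformation_linear)
  have sU[measurable_cong]: "sets U = sets borel" by (simp add: U_def uniform_measure_def)
  have DU: "distr U borel f = U"
  proof (rule measure_eqI)
    show "emeasure (distr U borel f) A = emeasure U A" if "A \<in> sets (distr U borel f)" for A
    proof -
      have A: "A \<in> sets borel" using that by simp
      have "emeasure (distr U borel f) A = emeasure U (f -` A)"
        using A by (subst emeasure_distr) (auto simp: U_def uniform_measure_def)
      also have "\<dots> = emeasure U A"
        using emeasure_lborel_orthogonal_vimage[OF f A] A measurable_sets[OF fm A] by (simp add: U_def)
      finally show ?thesis .
    qed
  qed (simp add: sU)
  have comm: "f (sgn x) = sgn (f x)" for x
    using f by (simp add: sgn_div_norm orthogonal_transformation_norm orthogonal_transformation_scaleR)
  have "distr surface_measure borel f = distr U borel (f \<circ> sgn)"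
    unfolding surface_measure_def U_def[symmetric] by (subst distr_distr) auto
  also have "f \<circ> sgn = sgn \<circ> f" using comm by auto
  also have "distr U borel (sgn \<circ> f) = distr (distr U borel f) borel sgn"
    by (subst distr_distr) auto
  finally show ?thesis unfolding DU by (simp add: surface_measure_def U_def)
qed

lemma integrable_surface_measure:
  fixes g :: "real ^ 'n \<Rightarrow> real"
  assumes "continuous_on UNIV g"
  shows "integrable surface_measure g"
proof -
  interpret prob_space "surface_measure :: (real ^ 'n) measure" by (rule prob_space_surface_measure)
  have "compact (g ` sphere 0 1)"
    by (intro compact_continuous_image continuous_on_subset[OF assms]) auto
  then obtain B where B: "\<And>x. x \<in> sphere 0 1 \<Longrightarrow> norm (g x) \<le> B"
    using compact_imp_bounded bounded_iff by (metis imageI)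
  show ?thesis
  proof (rule integrable_const_bound[where B=B])
    show "AE x in surface_measure. norm (g x) \<le> B"
      using AE_surface_measure_norm by eventually_elim (use B in auto)
  qed (use borel_measurable_continuous_onI[OF assms] in \<open>simp add: measurable_cong_sets[OF sets_surface_measure refl]\<close>)
qed

lemma integrable_surface_inner_powers:
  "integrable surface_measure (\<lambda>z :: real ^ 'n. (z \<bullet> x) ^ i * (z \<bullet> y) ^ j)"
  by (intro integrable_surface_measure continuous_intros)

lemma surface_integral_orthogonal:
  fixes f :: "real ^ 'n::{finite,wellorder} \<Rightarrow> real ^ 'n::_" and g :: "real ^ 'n::_ \<Rightarrow> real"
  assumes f: "orthogonal_transformation f" and g: "g \<in> borel_measurable borel"
  shows "(LINT z|surface_measure. g (f z)) = (LINT z|surface_measure. g z)"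
proof -
  have fm: "f \<in> borel_measurable borel"
    using f by (intro borel_measurable_continuous_onI linear_continuous_on linear_conv_bounded_linear[THEN iffD1]
        orthogonal_transformation_linear)
  have "(LINT z|distr surface_measure borel f. g z) = (LINT z|surface_measure. g (f z))"
    by (rule integral_distr) (use fm g in auto)
  then show ?thesis by (simp add: distr_surface_measure_orthogonal[OF f])
qed

lemma surface_integral_odd:
  fixes u :: "real ^ 'n::{finite,wellorder}"
  assumes "odd k"
  shows "(LINT z|surface_measure. (z \<bullet> u) ^ k) = 0"
proof -
  have "(LINT z|surface_measure. ((- z) \<bullet> u) ^ k) = (LINT z|surface_measure. (z \<bullet> u) ^ k)"
    by (rule surface_integral_orthogonal[where f=uminus and g="\<lambda>z. (z \<bullet> u) ^ k"])
       (auto simp: orthogonal_transformation_def linear_iff)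
  moreover have "((- z) \<bullet> u) ^ k = - ((z \<bullet> u) ^ k)" for z using assms by simp
  ultimately show ?thesis by simp
qed

lemma surface_integral_even_eq:
  fixes u v :: "real ^ 'n::{finite,wellorder}"
  assumes "norm u = norm v"
  shows "(LINT z|surface_measure. (z \<bullet> u) ^ k) = (LINT z|surface_measure. (z \<bullet> v) ^ k)"
proof -
  obtain f where f: "orthogonal_transformation f" "f u = v"
    using orthogonal_transformation_exists[OF assms] by blast
  have "(LINT z|surface_measure. (f z \<bullet> v) ^ k) = (LINT z|surface_measure. (z \<bullet> v) ^ k)"
    by (rule surface_integral_orthogonal[OF f(1)]) simp
  moreover have "f z \<bullet> v = z \<bullet> u" for z using f by (metis orthogonal_transformation_def)
  ultimately show ?thesis by simp
qed

text \<open>The constant \<open>c\<close> is a parameter because the mixed moments obtained here are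
  what determines \<open>c\<close> in \<open>surface_integral_even\<close>.\<close>

lemma surface_integral_polarization:
  fixes x y :: "real ^ 'n"
  assumes c: "\<And>u :: real ^ 'n. (LINT z|surface_measure. (z \<bullet> u) ^ (2 * m)) = c * norm u ^ (2 * m)"
    and j: "j \<le> 2 * m"
  shows "real (2 * m choose j) * (LINT z|surface_measure. (z \<bullet> x) ^ (2 * m - j) * (z \<bullet> y) ^ j)
      = c * coeff ([:x \<bullet> x, 2 * (x \<bullet> y), y \<bullet> y:] ^ m) j"
proof (rule polarization[OF _ j])
  fix s :: real
  have "(\<Sum>j\<le>2*m. real (2*m choose j) * (LINT z|surface_measure. (z \<bullet> x) ^ (2*m - j) * (z \<bullet> y) ^ j) * s ^ j) =
    (\<Sum>j\<le>2*m. LINT z|surface_measure. real (2*m choose j) * s ^ j * ((z \<bullet> x) ^ (2*m - j) * (z \<bullet> y) ^ j))"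
    by (intro sum.cong refl, subst integral_mult_right_zero) (simp add: mult_ac)
  also have "\<dots> = (LINT z|surface_measure. (\<Sum>j\<le>2*m. real (2*m choose j) * s ^ j * ((z \<bullet> x) ^ (2*m - j) * (z \<bullet> y) ^ j)))"
    by (subst Bochner_Integration.integral_sum) (auto intro!: integrable_surface_inner_powers)
  also have "(\<lambda>z. \<Sum>j\<le>2*m. real (2*m choose j) * s ^ j * ((z \<bullet> x) ^ (2*m - j) * (z \<bullet> y) ^ j)) =
      (\<lambda>z. (s * (z \<bullet> y) + z \<bullet> x) ^ (2*m))"
    by (intro ext, subst binomial_ring) (simp add: power_mult_distrib mult_ac)
  also have "\<dots> = (\<lambda>z. (z \<bullet> (x + s *\<^sub>R y)) ^ (2*m))"
    by (simp add: inner_add_right add.commute)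
  also have "(LINT z|surface_measure. (z \<bullet> (x + s *\<^sub>R y)) ^ (2*m)) = c * ((norm (x + s *\<^sub>R y))\<^sup>2) ^ m"
    by (subst c) (simp only: power_mult)
  also have "(norm (x + s *\<^sub>R y))\<^sup>2 = x \<bullet> x + 2 * (x \<bullet> y) * s + (y \<bullet> y) * s\<^sup>2"
    unfolding power2_norm_eq_inner
    by (simp add: inner_add_left inner_add_right inner_commute power2_eq_square algebra_simps)
  finally show "(\<Sum>j\<le>2*m. real (2*m choose j) * (LINT z|surface_measure. (z \<bullet> x) ^ (2*m - j) * (z \<bullet> y) ^ j) * s ^ j)
      = c * (x \<bullet> x + 2 * (x \<bullet> y) * s + (y \<bullet> y) * s\<^sup>2) ^ m" .
qed

text \<open>By rotation invariance the integral depends only on the length of \<open>u\<close>.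
  Inserting the sum of the squared coordinates, which is 1 on the sphere, gives a recursion between
  consecutive moments; the mixed terms come from polarization.\<close>

lemma surface_integral_even:
  fixes u :: "real ^ 'n::{finite,wellorder}"
  shows "(LINT z|surface_measure. (z \<bullet> u) ^ (2 * k)) = sphere_moment CARD('n) k * norm u ^ (2 * k)"
proof -
  interpret prob_space "surface_measure :: (real ^ 'n::_) measure" by (rule prob_space_surface_measure)
  define n where "n = CARD('n)"
  define a :: 'n where "a = undefined"
  define e :: "'n \<Rightarrow> real ^ 'n::_" where "e i = axis i 1" for i
  define c where "c k = (LINT z|surface_measure. (z \<bullet> e a) ^ (2 * k))" for k
  have c: "(LINT z|surface_measure. (z \<bullet> u) ^ (2 * k)) = c k * norm u ^ (2 * k)" for u :: "real ^ 'n::_" and k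
  proof -
    have "(LINT z|surface_measure. (z \<bullet> u) ^ (2 * k)) = (LINT z|surface_measure. (z \<bullet> (norm u *\<^sub>R e a)) ^ (2 * k))"
      by (rule surface_integral_even_eq) (simp add: e_def)
    also have "\<dots> = (LINT z|surface_measure. norm u ^ (2 * k) * (z \<bullet> e a) ^ (2 * k))"
      by (simp add: power_mult_distrib)
    also have "\<dots> = c k * norm u ^ (2 * k)" by (simp add: c_def)
    finally show ?thesis .
  qed
  have mixed: "(LINT z|surface_measure. (z \<bullet> e a) ^ (2 * k) * (z \<bullet> e i) ^ 2) = c (Suc k) / (2 * k + 1)"
    if "i \<noteq> a" for i k
  proof -
    have ort: "e a \<bullet> e i = 0" "e i \<bullet> e i = 1" "e a \<bullet> e a = 1" using that by (auto simp: e_def inner_axis_axis)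
    have "real (2 * Suc k choose 2) * (LINT z|surface_measure. (z \<bullet> e a) ^ (2 * Suc k - 2) * (z \<bullet> e i) ^ 2)
        = c (Suc k) * coeff ([:1, 2 * 0, 1:] ^ Suc k) 2"
      using surface_integral_polarization[OF c[of _ "Suc k"], of 2 "e a" "e i"] ort by simp
    moreover have "coeff ([:1, 0, 1:] ^ m) 0 = (1::real) \<and> coeff ([:1, 0, 1:] ^ m) 2 = real m" for m
      by (induction m) (auto simp: numeral_2_eq_2)
    moreover have "of_nat (2 * Suc k choose 2) = real (Suc k) * (2 * k + 1)"
      by (simp add: choose_two algebra_simps)
    ultimately have "real (Suc k) * ((2 * k + 1) * (LINT z|surface_measure. (z \<bullet> e a) ^ (2 * k) * (z \<bullet> e i) ^ 2))
        = real (Suc k) * c (Suc k)" by (simp add: mult_ac del: power_Suc of_nat_Suc)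
    then show ?thesis by (simp add: field_simps del: of_nat_Suc)
  qed
  have rec: "c k = c (Suc k) * ((real n + 2 * real k) / (2 * real k + 1))" for k
  proof -
    have "c k = (LINT z|surface_measure. (z \<bullet> e a) ^ (2 * k) * (\<Sum>i\<in>UNIV. (z \<bullet> e i) ^ 2))"
      unfolding c_def
    proof (rule integral_cong_AE)
      show "AE z in surface_measure. (z \<bullet> e a) ^ (2 * k) = (z \<bullet> e a) ^ (2 * k) * (\<Sum>i\<in>UNIV. (z \<bullet> e i) ^ 2)"
        using AE_surface_measure_norm
      proof eventually_elim
        case (elim z)
        have "(\<Sum>i\<in>UNIV. (z \<bullet> e i) ^ 2) = z \<bullet> z"
          unfolding e_def inner_axis by (simp add: inner_vec_def power2_eq_square)
        then show ?case using elim by (simp add: norm_eq_1)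
      qed
    qed auto
    also have "\<dots> = (\<Sum>i\<in>UNIV. LINT z|surface_measure. (z \<bullet> e a) ^ (2 * k) * (z \<bullet> e i) ^ 2)"
      by (subst Bochner_Integration.integral_sum[symmetric])
         (auto intro!: integrable_surface_inner_powers simp: sum_distrib_left)
    also have "\<dots> = (\<Sum>i\<in>UNIV. if i = a then c (Suc k) else c (Suc k) / (2 * k + 1))"
      by (intro sum.cong refl) (auto simp: mixed, simp add: c_def power2_eq_square mult_ac)
    also have "\<dots> = c (Suc k) + (real n - 1) * (c (Suc k) / (2 * k + 1))"
      by (subst sum.remove[of _ a]) (auto simp: n_def card_Diff_subset of_nat_diff Suc_leI)
    also have "\<dots> = c (Suc k) * ((real n + 2 * real k) / (2 * real k + 1))" by (simp add: field_simps)
    finally show ?thesis .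
  qed
  have "n > 0" by (simp add: n_def)
  have "c k = sphere_moment n k" for k
  proof (induction k)
    case 0
    then show ?case using prob_space by (simp add: c_def sphere_moment_def)
  next
    case (Suc k)
    have "2 * real k + 1 > 0" "real n + 2 * real k > 0" using \<open>n > 0\<close> by auto
    then have "c (Suc k) = c k * ((2 * real k + 1) / (real n + 2 * real k))"
      using rec[of k] by (simp add: field_simps)
    then show ?case by (simp add: Suc sphere_moment_def)
  qed
  then show ?thesis using c by (simp add: n_def)
qed

section \<open>The linear programming bound\<close>

text \<open>For unit vectors with inner product \<open>\<rho>\<close> the Gram polynomial of
  \<open>x + s y\<close> is \<open>[:1, 2 * \<rho>, 1:]\<close>; the moments become explicit
  polynomials in \<open>\<rho>\<close>, which can be compared symbolically.\<close>

definition mixed_moment :: "nat \<Rightarrow> nat \<Rightarrow> nat \<Rightarrow> real \<Rightarrow> real" where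
  "mixed_moment n i j \<rho> = (if odd (i + j) then 0 else
     sphere_moment n ((i + j) div 2) * coeff ([:1, 2 * \<rho>, 1:] ^ ((i + j) div 2)) j / real ((i + j) choose j))"

lemma surface_integral_mixed:
  fixes x y :: "real ^ 'n::{finite,wellorder}"
  assumes x: "norm x = 1" and y: "norm y = 1"
  shows "(LINT z|surface_measure. (z \<bullet> x) ^ i * (z \<bullet> y) ^ j) = mixed_moment CARD('n) i j (x \<bullet> y)"
proof (cases "odd (i + j)")
  case True
  have "(LINT z|surface_measure. ((- z) \<bullet> x) ^ i * ((- z) \<bullet> y) ^ j) = (LINT z|surface_measure. (z \<bullet> x) ^ i * (z \<bullet> y) ^ j)"
    by (rule surface_integral_orthogonal[where f=uminus and g="\<lambda>z. (z \<bullet> x) ^ i * (z \<bullet> y) ^ j"])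
       (auto simp: orthogonal_transformation_def linear_iff)
  moreover have "((- z) \<bullet> x) ^ i * ((- z) \<bullet> y) ^ j = - ((z \<bullet> x) ^ i * (z \<bullet> y) ^ j)" for z
    using True by (cases "even i") auto
  ultimately show ?thesis using True by (simp add: mixed_moment_def)
next
  case False
  then obtain m where m: "i + j = 2 * m" using evenE by blast
  then have ij: "i = 2 * m - j" "j \<le> 2 * m" by auto
  have "real (2 * m choose j) * (LINT z|surface_measure. (z \<bullet> x) ^ i * (z \<bullet> y) ^ j) =
      sphere_moment CARD('n) m * coeff ([:x \<bullet> x, 2 * (x \<bullet> y), y \<bullet> y:] ^ m) j"
    unfolding ij(1) by (rule surface_integral_polarization[OF surface_integral_even ij(2)])
  moreover have "real (2 * m choose j) \<noteq> 0" using ij(2) by (simp add: binomial_eq_0_iff)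
  ultimately show ?thesis using x y m False by (simp add: mixed_moment_def norm_eq_1 field_simps)
qed

text \<open>Positive definiteness without an addition formula: if a zonal polynomial convolved with
  itself gives \<open>\<kappa> * G\<close>, then the double sum of \<open>G\<close> is, up to
  \<open>\<kappa>\<close>, the integral of the square of a sum of zonal functions.\<close>

lemma sum_kernel_nonneg:
  fixes C :: "(real ^ 'n::{finite,wellorder}) set" and g :: "nat \<Rightarrow> real"
  assumes C: "spherical_code C"
    and \<kappa>: "\<kappa> > 0" "\<And>\<rho>. (\<Sum>i\<le>d. \<Sum>j\<le>d. g i * g j * mixed_moment CARD('n) i j \<rho>) = \<kappa> * G \<rho>"
  shows "(\<Sum>x\<in>C. \<Sum>y\<in>C. G (x \<bullet> y)) \<ge> 0"
proof -
  define P where "P x z = (\<Sum>i\<le>d. g i * (z \<bullet> x) ^ i)" for x z :: "real ^ 'n::_"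
  have n1: "norm x = 1" if "x \<in> C" for x using C that by (auto simp: spherical_code_def)
  have fin: "finite C" using C by (simp add: spherical_code_def)
  have PP: "P x z * P y z = (\<Sum>i\<le>d. \<Sum>j\<le>d. g i * g j * ((z \<bullet> x) ^ i * (z \<bullet> y) ^ j))" for x y z
    unfolding P_def sum_product by (simp add: mult_ac)
  have int: "integrable surface_measure (\<lambda>z. P x z * P y z)" for x y
    unfolding PP by (intro Bochner_Integration.integrable_sum integrable_mult_right integrable_surface_inner_powers)
  have kernel: "(LINT z|surface_measure. P x z * P y z) = \<kappa> * G (x \<bullet> y)" if "x \<in> C" "y \<in> C" for x y
  proof -
    have "(LINT z|surface_measure. P x z * P y z) =
        (\<Sum>i\<le>d. \<Sum>j\<le>d. g i * g j * (LINT z|surface_measure. (z \<bullet> x) ^ i * (z \<bullet> y) ^ j))"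
      unfolding PP
      by (subst Bochner_Integration.integral_sum)
         (auto intro!: sum.cong Bochner_Integration.integrable_sum integrable_mult_right integrable_surface_inner_powers
           simp: Bochner_Integration.integral_sum integrable_surface_inner_powers)
    also have "\<dots> = \<kappa> * G (x \<bullet> y)"
      unfolding surface_integral_mixed[OF n1[OF that(1)] n1[OF that(2)]] by (rule \<kappa>)
    finally show ?thesis .
  qed
  have "0 \<le> (LINT z|surface_measure. (\<Sum>x\<in>C. P x z)\<^sup>2)" by simp
  also have "\<dots> = (LINT z|surface_measure. (\<Sum>x\<in>C. \<Sum>y\<in>C. P x z * P y z))"
    by (simp add: power2_eq_square sum_product)
  also have "\<dots> = (\<Sum>x\<in>C. \<Sum>y\<in>C. LINT z|surface_measure. P x z * P y z)"
    by (subst Bochner_Integration.integral_sum) (auto simp: int intro!: sum.cong)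
  also have "\<dots> = \<kappa> * (\<Sum>x\<in>C. \<Sum>y\<in>C. G (x \<bullet> y))"
    by (simp add: kernel sum_distrib_left)
  finally show ?thesis using \<kappa>(1) by (simp add: zero_le_mult_iff)
qed

section \<open>Gegenbauer polynomials of degree at most 5 in dimension 23\<close>

lemma choose_values:
  shows "2 choose 2 = (1::nat)"
    and "4 choose 2 = (6::nat)"
    and "4 choose 3 = (4::nat)"
    and "4 choose 4 = (1::nat)"
    and "6 choose 2 = (15::nat)"
    and "6 choose 3 = (20::nat)"
    and "6 choose 4 = (15::nat)"
    and "6 choose 5 = (6::nat)"
    and "8 choose 2 = (28::nat)"
    and "8 choose 3 = (56::nat)"
    and "8 choose 4 = (70::nat)"
    and "8 choose 5 = (56::nat)"
    and "10 choose 2 = (45::nat)"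
    and "10 choose 3 = (120::nat)"
    and "10 choose 4 = (210::nat)"
    and "10 choose 5 = (252::nat)"
  by (simp_all add: eval_nat_numeral)

lemma prod_lessThan_values:
  fixes f :: "nat \<Rightarrow> real"
  shows "(\<Prod>i<1. f i) = f 0" and "(\<Prod>i<2. f i) = f 0 * f 1" and "(\<Prod>i<3. f i) = f 0 * f 1 * f 2"
    and "(\<Prod>i<4. f i) = f 0 * f 1 * f 2 * f 3" and "(\<Prod>i<5. f i) = f 0 * f 1 * f 2 * f 3 * f 4"
  by (simp_all add: eval_nat_numeral)

lemma sum_atMost_5: "(\<Sum>i\<le>(5::nat). f i) = f 0 + f 1 + f 2 + f 3 + f 4 + (f 5 :: real)"
  by (simp add: eval_nat_numeral)

lemma coeff_pCons_numeral: "coeff (pCons a p) (numeral k) = coeff p (pred_numeral k)"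
  by (simp add: numeral_eq_Suc)

lemma gram_poly_powers:
  fixes r :: real
  shows "[:1, 2 * r, 1:] ^ 1 = [:1, 2 * r, 1:]"
    and "[:1, 2 * r, 1:] ^ 2 = [:1, 4 * r, 2 + 4 * r ^ 2, 4 * r, 1:]"
    and "[:1, 2 * r, 1:] ^ 3 = [:1, 6 * r, 3 + 12 * r ^ 2, 12 * r + 8 * r ^ 3, 3 + 12 * r ^ 2, 6 * r, 1:]"
    and "[:1, 2 * r, 1:] ^ 4 = [:1, 8 * r, 4 + 24 * r ^ 2, 24 * r + 32 * r ^ 3, 6 + 48 * r ^ 2 + 16 * r ^ 4, 24 * r + 32 * r ^ 3, 4 + 24 * r ^ 2, 8 * r, 1:]"
    and "[:1, 2 * r, 1:] ^ 5 = [:1, 10 * r, 5 + 40 * r ^ 2, 40 * r + 80 * r ^ 3, 10 + 120 * r ^ 2 + 80 * r ^ 4, 60 * r + 160 * r ^ 3 + 32 * r ^ 5, 10 + 120 * r ^ 2 + 80 * r ^ 4, 40 * r + 80 * r ^ 3, 5 + 40 * r ^ 2, 10 * r, 1:]"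
proof -
  show "[:1, 2 * r, 1:] ^ 1 = [:1, 2 * r, 1:]" by simp
  show p2: "[:1, 2 * r, 1:] ^ 2 = [:1, 4 * r, 2 + 4 * r ^ 2, 4 * r, 1:]"
    using power_Suc[of "[:1, 2 * r, 1:]" 1]  by (simp add: eval_nat_numeral algebra_simps)
  show p3: "[:1, 2 * r, 1:] ^ 3 = [:1, 6 * r, 3 + 12 * r ^ 2, 12 * r + 8 * r ^ 3, 3 + 12 * r ^ 2, 6 * r, 1:]"
    using power_Suc[of "[:1, 2 * r, 1:]" 2] p2 by (simp add: eval_nat_numeral algebra_simps)
  show p4: "[:1, 2 * r, 1:] ^ 4 = [:1, 8 * r, 4 + 24 * r ^ 2, 24 * r + 32 * r ^ 3, 6 + 48 * r ^ 2 + 16 * r ^ 4, 24 * r + 32 * r ^ 3, 4 + 24 * r ^ 2, 8 * r, 1:]"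
    using power_Suc[of "[:1, 2 * r, 1:]" 3] p3 by (simp add: eval_nat_numeral algebra_simps)
  show p5: "[:1, 2 * r, 1:] ^ 5 = [:1, 10 * r, 5 + 40 * r ^ 2, 40 * r + 80 * r ^ 3, 10 + 120 * r ^ 2 + 80 * r ^ 4, 60 * r + 160 * r ^ 3 + 32 * r ^ 5, 10 + 120 * r ^ 2 + 80 * r ^ 4, 40 * r + 80 * r ^ 3, 5 + 40 * r ^ 2, 10 * r, 1:]"
    using power_Suc[of "[:1, 2 * r, 1:]" 4] p4 by (simp add: eval_nat_numeral algebra_simps)
qed

lemma mixed_moment_values:
  shows "mixed_moment n 0 0 r = 1"
    and "mixed_moment n 0 2 r = sphere_moment n 1 * (1) / 1"
    and "mixed_moment n 0 4 r = sphere_moment n 2 * (1) / 1"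
    and "mixed_moment n 1 1 r = sphere_moment n 1 * (2 * r) / 2"
    and "mixed_moment n 1 3 r = sphere_moment n 2 * (4 * r) / 4"
    and "mixed_moment n 1 5 r = sphere_moment n 3 * (6 * r) / 6"
    and "mixed_moment n 2 0 r = sphere_moment n 1 * (1) / 1"
    and "mixed_moment n 2 2 r = sphere_moment n 2 * (2 + 4 * r ^ 2) / 6"
    and "mixed_moment n 2 4 r = sphere_moment n 3 * (3 + 12 * r ^ 2) / 15"
    and "mixed_moment n 3 1 r = sphere_moment n 2 * (4 * r) / 4"
    and "mixed_moment n 3 3 r = sphere_moment n 3 * (12 * r + 8 * r ^ 3) / 20"
    and "mixed_moment n 3 5 r = sphere_moment n 4 * (24 * r + 32 * r ^ 3) / 56"
    and "mixed_moment n 4 0 r = sphere_moment n 2 * (1) / 1"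
    and "mixed_moment n 4 2 r = sphere_moment n 3 * (3 + 12 * r ^ 2) / 15"
    and "mixed_moment n 4 4 r = sphere_moment n 4 * (6 + 48 * r ^ 2 + 16 * r ^ 4) / 70"
    and "mixed_moment n 5 1 r = sphere_moment n 3 * (6 * r) / 6"
    and "mixed_moment n 5 3 r = sphere_moment n 4 * (24 * r + 32 * r ^ 3) / 56"
    and "mixed_moment n 5 5 r = sphere_moment n 5 * (60 * r + 160 * r ^ 3 + 32 * r ^ 5) / 252"
  by (simp_all add: mixed_moment_def sphere_moment_def[of n 0] gram_poly_powers(2-5) choose_values coeff_pCons_numeral)
    (simp_all add: eval_nat_numeral)

lemma sphere_moment_values:
  shows "sphere_moment 23 1 = 1/23" and "sphere_moment 23 2 = 3/575" and "sphere_moment 23 3 = 1/1035"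
    and "sphere_moment 23 4 = 7/30015" and "sphere_moment 23 5 = 63/930465"
  by (simp_all add: sphere_moment_def prod_lessThan_values)

text \<open>The left-hand sides are Gram sums of the Gegenbauer polynomials of degree 1 to 5 for
  \<open>S\<^sup>2\<^sup>2\<close>, normalized to be monic.\<close>

lemma gegenbauer_sums_nonneg:
  fixes C :: "(real ^ 23) set"
  assumes C: "spherical_code C"
  shows "(\<Sum>x\<in>C. \<Sum>y\<in>C. x \<bullet> y) \<ge> 0"
    and "(\<Sum>x\<in>C. \<Sum>y\<in>C. (x \<bullet> y) ^ 2 - 1/23) \<ge> 0"
    and "(\<Sum>x\<in>C. \<Sum>y\<in>C. (x \<bullet> y) ^ 3 - 3/25 * (x \<bullet> y)) \<ge> 0"
    and "(\<Sum>x\<in>C. \<Sum>y\<in>C. (x \<bullet> y) ^ 4 - 2/9 * (x \<bullet> y) ^ 2 + 1/225) \<ge> 0"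
    and "(\<Sum>x\<in>C. \<Sum>y\<in>C. (x \<bullet> y) ^ 5 - 10/29 * (x \<bullet> y) ^ 3 + 5/261 * (x \<bullet> y)) \<ge> 0"
proof -
  have card23: "CARD(23) = 23" by simp
  note eval = card23 sum_atMost_5[unfolded One_nat_def] mixed_moment_values[unfolded One_nat_def]
    sphere_moment_values[unfolded One_nat_def]
  show "(\<Sum>x\<in>C. \<Sum>y\<in>C. x \<bullet> y) \<ge> 0"
    \<comment> \<open>In each of the five cases \<open>g\<close> lists the coefficients of the very
      polynomial \<open>G\<close>: by the reproducing property a Gegenbauer polynomial convolved
      with itself is a positive multiple \<open>\<kappa>\<close> of itself.\<close>
    by (rule sum_kernel_nonneg[OF C, where d=5 and g="nth [0, 1, 0, 0, 0, 0]" and \<kappa>="1/23" and G="\<lambda>\<rho>. \<rho>"])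
       (simp_all add: eval, (simp add: field_simps)?)
  show "(\<Sum>x\<in>C. \<Sum>y\<in>C. (x \<bullet> y) ^ 2 - 1/23) \<ge> 0"
    by (rule sum_kernel_nonneg[OF C, where d=5 and g="nth [-1/23, 0, 1, 0, 0, 0]" and \<kappa>="2/575" and G="\<lambda>\<rho>. \<rho> ^ 2 - 1/23"])
       (simp_all add: eval, (simp add: field_simps)?)
  show "(\<Sum>x\<in>C. \<Sum>y\<in>C. (x \<bullet> y) ^ 3 - 3/25 * (x \<bullet> y)) \<ge> 0"
    by (rule sum_kernel_nonneg[OF C, where d=5 and g="nth [0, -3/25, 0, 1, 0, 0]" and \<kappa>="2/5175" and G="\<lambda>\<rho>. \<rho> ^ 3 - 3/25 * \<rho>"])
       (simp_all add: eval, (simp add: field_simps)?)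
  show "(\<Sum>x\<in>C. \<Sum>y\<in>C. (x \<bullet> y) ^ 4 - 2/9 * (x \<bullet> y) ^ 2 + 1/225) \<ge> 0"
    by (rule sum_kernel_nonneg[OF C, where d=5 and g="nth [1/225, 0, -2/9, 0, 1, 0]" and \<kappa>="8/150075" and G="\<lambda>\<rho>. \<rho> ^ 4 - 2/9 * \<rho> ^ 2 + 1/225"])
       (simp_all add: eval, (simp add: field_simps)?)
  show "(\<Sum>x\<in>C. \<Sum>y\<in>C. (x \<bullet> y) ^ 5 - 10/29 * (x \<bullet> y) ^ 3 + 5/261 * (x \<bullet> y)) \<ge> 0"
    by (rule sum_kernel_nonneg[OF C, where d=5 and g="nth [0, 5/261, 0, -10/29, 0, 1]" and \<kappa>="8/930465" and G="\<lambda>\<rho>. \<rho> ^ 5 - 10/29 * \<rho> ^ 3 + 5/261 * \<rho>"])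
       (simp_all add: eval, (simp add: field_simps)?)
qed

text \<open>\<open>D\<close> is a function with all its derivatives. The threshold \<open>m\<close>
  is 1 for a potential, whose own sign is free, and 0 for its divided differences.\<close>

definition nonneg_derivs :: "nat \<Rightarrow> (nat \<Rightarrow> real \<Rightarrow> real) \<Rightarrow> bool" where
  "nonneg_derivs m D \<longleftrightarrow> (\<forall>j. \<forall>t\<in>{-1<..<1}. (D j has_real_derivative D (Suc j) t) (at t)) \<and>
     (\<forall>j\<ge>m. \<forall>t\<in>{-1<..<1}. D j t \<ge> 0)"

text \<open>The divided difference \<open>(g t - g a) / (t - a)\<close> is the integral of \<open>g' (a + s (t - a))\<close> over
  \<open>0 \<le> s \<le> 1\<close>, so all its derivatives inherit nonnegativity.\<close>

lemma divided_difference: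
  assumes D: "nonneg_derivs 1 D" and a: "a \<in> {-1<..<1}"
  obtains Q where "nonneg_derivs 0 Q" "\<And>t. t \<in> {-1<..<1} \<Longrightarrow> D 0 t = D 0 a + (t - a) * Q 0 t"
proof -
  have der: "(D j has_real_derivative D (Suc j) t) (at t)" if "t \<in> {-1<..<1}" for j t
    using D that by (auto simp: nonneg_derivs_def)
  have cont: "continuous_on {-1<..<1} (D j)" for j
    by (rule DERIV_continuous_on[where D="D (Suc j)"]) (use der has_field_derivative_at_within in blast)
  have mem: "a + s * (t - a) \<in> {-1<..<1}" if "t \<in> {-1<..<1}" "s \<in> {0..1}" for s t
  proof -
    have "(1 - s) *\<^sub>R a + s *\<^sub>R t \<in> {-1<..<1}"
      using convexD[OF convex_real_interval(8) a that(1), of "1 - s" s] that by auto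
    then show ?thesis by (simp add: algebra_simps)
  qed
  \<comment> \<open>The integrand of the \<open>j\<close>-th derivative in \<open>t\<close> of the
    divided difference; the chain rule contributes the factor \<open>s ^ j\<close>.\<close>
  define q where "q j t s = s ^ j * D (Suc j) (a + s * (t - a))" for j t s
  define Q where "Q j t = integral {0..1} (q j t)" for j t
  have qcont: "continuous_on ({-1<..<1} \<times> {0..1}) (\<lambda>(t, s). q j t s)" for j
    unfolding q_def case_prod_unfold
    by (intro continuous_intros continuous_on_compose2[OF cont]) (use mem in auto)
  have qint: "q j t integrable_on {0..1}" if "t \<in> {-1<..<1}" for j t
    unfolding q_def
    by (intro integrable_continuous_real continuous_intros continuous_on_compose2[OF cont]) (use mem that in auto)
  show ?thesis
  proof
    show "nonneg_derivs 0 Q" unfolding nonneg_derivs_def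
    proof (intro conjI allI ballI impI)
      fix j and t :: real assume t: "t \<in> {-1<..<1}"
      have "((\<lambda>t. integral (cbox 0 1) (q j t)) has_field_derivative integral (cbox 0 1) (q (Suc j) t)) (at t within {-1<..<1})"
      proof (rule leibniz_rule_field_derivative)
        fix x s :: real assume xs: "x \<in> {-1<..<1}" "s \<in> cbox 0 1"
        have "(D (Suc j) has_real_derivative D (Suc (Suc j)) (a + s * (x - a))) (at (a + s * (x - a)))"
          by (rule der) (use mem xs in auto)
        then have "((\<lambda>x. D (Suc j) (a + s * (x - a))) has_real_derivative D (Suc (Suc j)) (a + s * (x - a)) * s) (at x)"
          by (rule DERIV_chain2) (auto intro!: derivative_eq_intros)
        then have "((\<lambda>x. q j x s) has_real_derivative s ^ j * (D (Suc (Suc j)) (a + s * (x - a)) * s)) (at x)"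
          unfolding q_def by (rule DERIV_cmult)
        then show "((\<lambda>x. q j x s) has_real_derivative q (Suc j) x s) (at x within {-1<..<1})"
          by (simp add: q_def mult_ac has_field_derivative_at_within)
      qed (use qint qcont t in auto)
      then show "(Q j has_real_derivative Q (Suc j) t) (at t)"
        using t by (simp add: Q_def[abs_def] at_within_open[of _ "{-1<..<1}"])
      show "Q j t \<ge> 0"
        unfolding Q_def by (rule integral_nonneg[OF qint[OF t]])
           (use D mem t in \<open>auto simp: q_def nonneg_derivs_def intro!: mult_nonneg_nonneg\<close>)
    qed
    show "D 0 t = D 0 a + (t - a) * Q 0 t" if t: "t \<in> {-1<..<1}" for t
    proof -
      have "((\<lambda>s. D 1 (a + s * (t - a)) * (t - a)) has_integral (D 0 (a + 1 * (t - a)) - D 0 (a + 0 * (t - a)))) {0..1}"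
      proof (rule fundamental_theorem_of_calculus)
        fix s :: real assume "s \<in> {0..1}"
        then have "(D 0 has_real_derivative D (Suc 0) (a + s * (t - a))) (at (a + s * (t - a)))"
          using mem t by (intro der) auto
        then have "((\<lambda>s. D 0 (a + s * (t - a))) has_real_derivative D 1 (a + s * (t - a)) * (t - a)) (at s)"
          unfolding One_nat_def by (rule DERIV_chain2) (auto intro!: derivative_eq_intros)
        then show "((\<lambda>s. D 0 (a + s * (t - a))) has_vector_derivative D 1 (a + s * (t - a)) * (t - a)) (at s within {0..1})"
          by (simp add: has_real_derivative_iff_has_vector_derivative has_vector_derivative_at_within)
      qed simp
      then have "integral {0..1} (\<lambda>s. D 1 (a + s * (t - a)) * (t - a)) = D 0 (a + 1 * (t - a)) - D 0 (a + 0 * (t - a))"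
        by (rule integral_unique)
      moreover have "integral {0..1} (\<lambda>s. D 1 (a + s * (t - a)) * (t - a)) = Q 0 t * (t - a)"
        unfolding Q_def q_def by (subst integral_mult_left) (simp_all add: mult.commute)
      ultimately have "Q 0 t * (t - a) = D 0 (a + 1 * (t - a)) - D 0 (a + 0 * (t - a))" by metis
      then show ?thesis by (simp add: mult.commute)
    qed
  qed
qed

lemma nonneg_derivs_mono: "nonneg_derivs 0 D \<Longrightarrow> nonneg_derivs 1 D"
  by (simp add: nonneg_derivs_def)

text \<open>\<open>divided_difference\<close> is applied six times. Nodes may coincide, which makes
  this Hermite interpolation. The coefficients \<open>c1\<close> to \<open>c5\<close> and the
  remainder \<open>g\<close> are values of divided differences with nonnegative derivatives of every
  order from 0; \<open>c0\<close> is a value of \<open>h\<close> and carries no sign.\<close>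

lemma newton_expansion:
  assumes h: "absolutely_monotone h" and x: "x0 \<in> {-1<..<1}" "x1 \<in> {-1<..<1}" "x2 \<in> {-1<..<1}" "x3 \<in> {-1<..<1}" "x4 \<in> {-1<..<1}" "x5 \<in> {-1<..<1}"
  obtains c0 c1 c2 c3 c4 c5 and g :: "real \<Rightarrow> real" where
    "c1 \<ge> 0" "c2 \<ge> 0" "c3 \<ge> 0" "c4 \<ge> 0" "c5 \<ge> 0" "\<And>t. t \<in> {-1<..<1} \<Longrightarrow> g t \<ge> 0"
    "\<And>t. t \<in> {-1<..<1} \<Longrightarrow> h t = c0 + c1 * (t - x0) + c2 * ((t - x0) * (t - x1))
      + c3 * ((t - x0) * (t - x1) * (t - x2)) + c4 * ((t - x0) * (t - x1) * (t - x2) * (t - x3))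
      + c5 * ((t - x0) * (t - x1) * (t - x2) * (t - x3) * (t - x4))
      + g t * ((t - x0) * (t - x1) * (t - x2) * (t - x3) * (t - x4) * (t - x5))"
proof -
  define D where "D j = (deriv ^^ j) h" for j
  have D: "nonneg_derivs 1 D"
    using h unfolding nonneg_derivs_def absolutely_monotone_def D_def
    by (auto intro: field_differentiable_derivI)
  obtain D1 where D1: "nonneg_derivs 0 D1" "\<And>t. t \<in> {-1<..<1} \<Longrightarrow> D 0 t = D 0 (x0) + (t - x0) * D1 0 t"
    using divided_difference[OF D x(1)] by blast
  obtain D2 where D2: "nonneg_derivs 0 D2" "\<And>t. t \<in> {-1<..<1} \<Longrightarrow> D1 0 t = D1 0 (x1) + (t - x1) * D2 0 t"
    using divided_difference[OF nonneg_derivs_mono[OF D1(1)] x(2)] by blast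
  obtain D3 where D3: "nonneg_derivs 0 D3" "\<And>t. t \<in> {-1<..<1} \<Longrightarrow> D2 0 t = D2 0 (x2) + (t - x2) * D3 0 t"
    using divided_difference[OF nonneg_derivs_mono[OF D2(1)] x(3)] by blast
  obtain D4 where D4: "nonneg_derivs 0 D4" "\<And>t. t \<in> {-1<..<1} \<Longrightarrow> D3 0 t = D3 0 (x3) + (t - x3) * D4 0 t"
    using divided_difference[OF nonneg_derivs_mono[OF D3(1)] x(4)] by blast
  obtain D5 where D5: "nonneg_derivs 0 D5" "\<And>t. t \<in> {-1<..<1} \<Longrightarrow> D4 0 t = D4 0 (x4) + (t - x4) * D5 0 t"
    using divided_difference[OF nonneg_derivs_mono[OF D4(1)] x(5)] by blast
  obtain D6 where D6: "nonneg_derivs 0 D6" "\<And>t. t \<in> {-1<..<1} \<Longrightarrow> D5 0 t = D5 0 (x5) + (t - x5) * D6 0 t"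
    using divided_difference[OF nonneg_derivs_mono[OF D5(1)] x(6)] by blast
  show ?thesis
  proof
    show "D1 0 (x1) \<ge> 0" "D2 0 (x2) \<ge> 0" "D3 0 (x3) \<ge> 0" "D4 0 (x4) \<ge> 0" "D5 0 (x5) \<ge> 0"
      "\<And>t. t \<in> {-1<..<1} \<Longrightarrow> D6 0 t \<ge> 0"
      using D1(1) D2(1) D3(1) D4(1) D5(1) D6(1) x by (simp_all add: nonneg_derivs_def)
    fix t :: real assume t: "t \<in> {-1<..<1}"
    have "h t = D 0 t" by (simp add: D_def)
    then show "h t = D 0 (x0) + D1 0 (x1) * (t - x0) + D2 0 (x2) * ((t - x0) * (t - x1))
      + D3 0 (x3) * ((t - x0) * (t - x1) * (t - x2)) + D4 0 (x4) * ((t - x0) * (t - x1) * (t - x2) * (t - x3))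
      + D5 0 (x5) * ((t - x0) * (t - x1) * (t - x2) * (t - x3) * (t - x4))
      + D6 0 t * ((t - x0) * (t - x1) * (t - x2) * (t - x3) * (t - x4) * (t - x5))"
      unfolding D1(2)[OF t] D2(2)[OF t] D3(2)[OF t] D4(2)[OF t] D5(2)[OF t] D6(2)[OF t]
      by (simp only: distrib_left distrib_right mult_ac add_ac)
  qed
qed

text \<open>The excess over the energy that the claimed distance distribution would give. It is
  linear in the potential, which reduces the bound to signs on a few polynomials.\<close>

definition energy_defect :: "(real ^ 23) set \<Rightarrow> (real \<Rightarrow> real) \<Rightarrow> real" where
  "energy_defect C g = energy g C - 11178 * (352 * g (-1/2) + 4125 * g (-1/5) + 5600 * g (1/10) + 1100 * g (2/5))"

lemma energy_defect_linear:
  shows "energy_defect C (\<lambda>t. f t + g t) = energy_defect C f + energy_defect C g"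
    and "energy_defect C (\<lambda>t. c * f t) = c * energy_defect C f"
  unfolding energy_defect_def energy_def
  by (simp_all add: case_prod_unfold sum.distrib sum_distrib_left algebra_simps)

lemma sum_pairs_eq_energy:
  fixes g :: "real \<Rightarrow> real"
  assumes C: "spherical_code C"
  shows "(\<Sum>x\<in>C. \<Sum>y\<in>C. g (x \<bullet> y)) = energy g C + card C * g 1"
proof -
  have fin: "finite C" using C by (simp add: spherical_code_def)
  have n1: "x \<bullet> x = 1" if "x \<in> C" for x using C that by (auto simp: spherical_code_def norm_eq_1)
  have "(\<Sum>x\<in>C. \<Sum>y\<in>C. g (x \<bullet> y)) = (\<Sum>(x, y)\<in>C \<times> C. g (x \<bullet> y))"
    by (simp add: sum.cartesian_product)
  also have "C \<times> C = {(x, y). x \<in> C \<and> y \<in> C \<and> x \<noteq> y} \<union> (\<lambda>x. (x, x)) ` C" by auto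
  also have "(\<Sum>(x, y)\<in>\<dots>. g (x \<bullet> y)) = energy g C + (\<Sum>(x, y)\<in>(\<lambda>x. (x, x)) ` C. g (x \<bullet> y))"
    unfolding energy_def
    by (rule sum.union_disjoint) (auto intro: finite_subset[of _ "C \<times> C"] simp: fin)
  also have "(\<Sum>(x, y)\<in>(\<lambda>x. (x, x)) ` C. g (x \<bullet> y)) = (\<Sum>x\<in>C. g (x \<bullet> x))"
    by (subst sum.reindex) (auto simp: inj_on_def)
  also have "\<dots> = card C * g 1" by (simp add: n1)
  finally show ?thesis .
qed

text \<open>The four weights, together with weight 1 at inner product 1, annihilate the Gegenbauer
  polynomials of degree 1 to 5, so the nonnegative double sums are the defects of these polynomials.
  For constants, 352 + 4125 + 5600 + 1100 + 1 = 11178.\<close>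

lemma energy_defect_powers:
  assumes C: "spherical_code C" "card C = 11178"
  shows "energy_defect C (\<lambda>t. 1) = 0"
    and "energy_defect C (\<lambda>t. t) \<ge> 0"
    and "energy_defect C (\<lambda>t. t ^ 2) \<ge> 0"
    and "energy_defect C (\<lambda>t. t ^ 3) \<ge> 3/25 * energy_defect C (\<lambda>t. t)"
    and "energy_defect C (\<lambda>t. t ^ 4) \<ge> 2/9 * energy_defect C (\<lambda>t. t ^ 2)"
    and "energy_defect C (\<lambda>t. t ^ 5) \<ge> 10/29 * energy_defect C (\<lambda>t. t ^ 3) - 5/261 * energy_defect C (\<lambda>t. t)"
proof -
  have S: "(\<Sum>x\<in>C. \<Sum>y\<in>C. g (x \<bullet> y)) = energy_defect C g
      + 11178 * (352 * g (-1/2) + 4125 * g (-1/5) + 5600 * g (1/10) + 1100 * g (2/5) + g 1)" for g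
    using sum_pairs_eq_energy[OF C(1), of g] C(2) by (simp add: energy_defect_def)
  show "energy_defect C (\<lambda>t. 1) = 0" using S[of "\<lambda>t. 1"] C(2) by simp
  note geg = gegenbauer_sums_nonneg[OF C(1), unfolded S[of "\<lambda>t. t"]
    S[of "\<lambda>t. t ^ 2 - 1/23"] S[of "\<lambda>t. t ^ 3 - 3/25 * t"] S[of "\<lambda>t. t ^ 4 - 2/9 * t ^ 2 + 1/225"]
    S[of "\<lambda>t. t ^ 5 - 10/29 * t ^ 3 + 5/261 * t"]]
  have c: "energy_defect C (\<lambda>t. c) = 0" for c
    using energy_defect_linear(2)[of C c "\<lambda>t. 1"] \<open>energy_defect C (\<lambda>t. 1) = 0\<close> by simp
  have d: "energy_defect C (\<lambda>t. f t - g t) = energy_defect C f - energy_defect C g" for f g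
    unfolding energy_defect_def energy_def by (simp add: case_prod_unfold sum_subtractf algebra_simps)
  show "energy_defect C (\<lambda>t. t) \<ge> 0" using geg(1) by simp
  show "energy_defect C (\<lambda>t. t ^ 2) \<ge> 0" using geg(2) by (simp add: d c power2_eq_square)
  show "energy_defect C (\<lambda>t. t ^ 3) \<ge> 3/25 * energy_defect C (\<lambda>t. t)"
    using geg(3) unfolding d energy_defect_linear(2) by (simp add: power3_eq_cube)
  show "energy_defect C (\<lambda>t. t ^ 4) \<ge> 2/9 * energy_defect C (\<lambda>t. t ^ 2)"
    using geg(4) unfolding d energy_defect_linear c by (simp add: power_divide)
  show "energy_defect C (\<lambda>t. t ^ 5) \<ge> 10/29 * energy_defect C (\<lambda>t. t ^ 3) - 5/261 * energy_defect C (\<lambda>t. t)"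
    using geg(5) unfolding d energy_defect_linear by (simp add: power_divide)
qed

lemma energy_defect_polynomial:
  assumes C: "spherical_code C" "card C = 11178"
  shows "energy_defect C (\<lambda>t. a0 + a1 * t + a2 * t ^ 2 + a3 * t ^ 3 + a4 * t ^ 4 + a5 * t ^ 5) =
     a1 * energy_defect C (\<lambda>t. t) + a2 * energy_defect C (\<lambda>t. t ^ 2) + a3 * energy_defect C (\<lambda>t. t ^ 3)
     + a4 * energy_defect C (\<lambda>t. t ^ 4) + a5 * energy_defect C (\<lambda>t. t ^ 5)"
proof -
  have "energy_defect C (\<lambda>t. a0) = 0"
    using energy_defect_linear(2)[of C a0 "\<lambda>t. 1"] energy_defect_powers(1)[OF C] by simp
  then show ?thesis unfolding energy_defect_linear by simp
qed

text \<open>The interpolation nodes are ordered increasingly; then all partial products have nonnegative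
  Gegenbauer coefficients.\<close>

lemma energy_defect_partial_products:
  fixes C :: "(real ^ 23) set"
  assumes C: "spherical_code C" "card C = 11178"
  shows "energy_defect C (\<lambda>t. (t - (-1/2))) \<ge> 0"
    and "energy_defect C (\<lambda>t. (t - (-1/2)) * (t - (-1/2))) \<ge> 0"
    and "energy_defect C (\<lambda>t. (t - (-1/2)) * (t - (-1/5))) \<ge> 0"
    and "energy_defect C (\<lambda>t. (t - (-1/2)) * (t - (-1/2)) * (t - (-1/5))) \<ge> 0"
    and "energy_defect C (\<lambda>t. (t - (-1/2)) * (t - (-1/5)) * (t - (1/10))) \<ge> 0"
    and "energy_defect C (\<lambda>t. (t - (-1/2)) * (t - (-1/2)) * (t - (-1/5)) * (t - (-1/5))) \<ge> 0"
    and "energy_defect C (\<lambda>t. (t - (-1/2)) * (t - (-1/2)) * (t - (-1/5)) * (t - (1/10))) \<ge> 0"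
    and "energy_defect C (\<lambda>t. (t - (-1/2)) * (t - (-1/5)) * (t - (1/10)) * (t - (1/10))) \<ge> 0"
    and "energy_defect C (\<lambda>t. (t - (-1/2)) * (t - (-1/2)) * (t - (-1/5)) * (t - (-1/5)) * (t - (1/10))) \<ge> 0"
    and "energy_defect C (\<lambda>t. (t - (-1/2)) * (t - (-1/2)) * (t - (-1/5)) * (t - (1/10)) * (t - (2/5))) \<ge> 0"
    and "energy_defect C (\<lambda>t. (t - (-1/2)) * (t - (-1/5)) * (t - (1/10)) * (t - (1/10)) * (t - (2/5))) \<ge> 0"
proof -
  note pw = energy_defect_powers[OF C]
  note pol = energy_defect_polynomial[OF C]
  have eq: "(\<lambda>t::real. (t - (-1/2))) = (\<lambda>t. (1/2) + (1) * t + (0) * t ^ 2 + (0) * t ^ 3 + (0) * t ^ 4 + (0) * t ^ 5)"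
    by (rule ext) (simp add: field_simps eval_nat_numeral)
  show "energy_defect C (\<lambda>t. (t - (-1/2))) \<ge> 0"
    \<comment> \<open>The inequalities \<open>pw\<close> hold the Gegenbauer signs in terms of
      powers; \<open>linarith\<close> eliminates the powers from the highest one down, which amounts
      to computing the Gegenbauer coefficients.\<close>
    using pw arg_cong[OF eq, of "energy_defect C", unfolded pol] by linarith
  have eq: "(\<lambda>t::real. (t - (-1/2)) * (t - (-1/2))) = (\<lambda>t. (1/4) + (1) * t + (1) * t ^ 2 + (0) * t ^ 3 + (0) * t ^ 4 + (0) * t ^ 5)"
    by (rule ext) (simp add: field_simps eval_nat_numeral)
  show "energy_defect C (\<lambda>t. (t - (-1/2)) * (t - (-1/2))) \<ge> 0"
    using pw arg_cong[OF eq, of "energy_defect C", unfolded pol] by linarith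
  have eq: "(\<lambda>t::real. (t - (-1/2)) * (t - (-1/5))) = (\<lambda>t. (1/10) + (7/10) * t + (1) * t ^ 2 + (0) * t ^ 3 + (0) * t ^ 4 + (0) * t ^ 5)"
    by (rule ext) (simp add: field_simps eval_nat_numeral)
  show "energy_defect C (\<lambda>t. (t - (-1/2)) * (t - (-1/5))) \<ge> 0"
    using pw arg_cong[OF eq, of "energy_defect C", unfolded pol] by linarith
  have eq: "(\<lambda>t::real. (t - (-1/2)) * (t - (-1/2)) * (t - (-1/5))) = (\<lambda>t. (1/20) + (9/20) * t + (6/5) * t ^ 2 + (1) * t ^ 3 + (0) * t ^ 4 + (0) * t ^ 5)"
    by (rule ext) (simp add: field_simps eval_nat_numeral)
  show "energy_defect C (\<lambda>t. (t - (-1/2)) * (t - (-1/2)) * (t - (-1/5))) \<ge> 0"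
    using pw arg_cong[OF eq, of "energy_defect C", unfolded pol] by linarith
  have eq: "(\<lambda>t::real. (t - (-1/2)) * (t - (-1/5)) * (t - (1/10))) = (\<lambda>t. (-1/100) + (3/100) * t + (3/5) * t ^ 2 + (1) * t ^ 3 + (0) * t ^ 4 + (0) * t ^ 5)"
    by (rule ext) (simp add: field_simps eval_nat_numeral)
  show "energy_defect C (\<lambda>t. (t - (-1/2)) * (t - (-1/5)) * (t - (1/10))) \<ge> 0"
    using pw arg_cong[OF eq, of "energy_defect C", unfolded pol] by linarith
  have eq: "(\<lambda>t::real. (t - (-1/2)) * (t - (-1/2)) * (t - (-1/5)) * (t - (-1/5))) = (\<lambda>t. (1/100) + (7/50) * t + (69/100) * t ^ 2 + (7/5) * t ^ 3 + (1) * t ^ 4 + (0) * t ^ 5)"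
    by (rule ext) (simp add: field_simps eval_nat_numeral)
  show "energy_defect C (\<lambda>t. (t - (-1/2)) * (t - (-1/2)) * (t - (-1/5)) * (t - (-1/5))) \<ge> 0"
    using pw arg_cong[OF eq, of "energy_defect C", unfolded pol] by linarith
  have eq: "(\<lambda>t::real. (t - (-1/2)) * (t - (-1/2)) * (t - (-1/5)) * (t - (1/10))) = (\<lambda>t. (-1/200) + (1/200) * t + (33/100) * t ^ 2 + (11/10) * t ^ 3 + (1) * t ^ 4 + (0) * t ^ 5)"
    by (rule ext) (simp add: field_simps eval_nat_numeral)
  show "energy_defect C (\<lambda>t. (t - (-1/2)) * (t - (-1/2)) * (t - (-1/5)) * (t - (1/10))) \<ge> 0"
    using pw arg_cong[OF eq, of "energy_defect C", unfolded pol] by linarith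
  have eq: "(\<lambda>t::real. (t - (-1/2)) * (t - (-1/5)) * (t - (1/10)) * (t - (1/10))) = (\<lambda>t. (1/1000) + (-13/1000) * t + (-3/100) * t ^ 2 + (1/2) * t ^ 3 + (1) * t ^ 4 + (0) * t ^ 5)"
    by (rule ext) (simp add: field_simps eval_nat_numeral)
  show "energy_defect C (\<lambda>t. (t - (-1/2)) * (t - (-1/5)) * (t - (1/10)) * (t - (1/10))) \<ge> 0"
    using pw arg_cong[OF eq, of "energy_defect C", unfolded pol] by linarith
  have eq: "(\<lambda>t::real. (t - (-1/2)) * (t - (-1/2)) * (t - (-1/5)) * (t - (-1/5)) * (t - (1/10))) = (\<lambda>t. (-1/1000) + (-1/250) * t + (71/1000) * t ^ 2 + (11/20) * t ^ 3 + (13/10) * t ^ 4 + (1) * t ^ 5)"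
    by (rule ext) (simp add: field_simps eval_nat_numeral)
  show "energy_defect C (\<lambda>t. (t - (-1/2)) * (t - (-1/2)) * (t - (-1/5)) * (t - (-1/5)) * (t - (1/10))) \<ge> 0"
    using pw arg_cong[OF eq, of "energy_defect C", unfolded pol] by linarith
  have eq: "(\<lambda>t::real. (t - (-1/2)) * (t - (-1/2)) * (t - (-1/5)) * (t - (1/10)) * (t - (2/5))) = (\<lambda>t. (1/500) + (-7/1000) * t + (-127/1000) * t ^ 2 + (-11/100) * t ^ 3 + (7/10) * t ^ 4 + (1) * t ^ 5)"
    by (rule ext) (simp add: field_simps eval_nat_numeral)
  show "energy_defect C (\<lambda>t. (t - (-1/2)) * (t - (-1/2)) * (t - (-1/5)) * (t - (1/10)) * (t - (2/5))) \<ge> 0"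
    using pw arg_cong[OF eq, of "energy_defect C", unfolded pol] by linarith
  \<comment> \<open>A narrow case: after the elimination of \<open>t ^ 5\<close> and
    \<open>t ^ 3\<close> the coefficient of \<open>t\<close> is only about 0.0008.\<close>
  have eq: "(\<lambda>t::real. (t - (-1/2)) * (t - (-1/5)) * (t - (1/10)) * (t - (1/10)) * (t - (2/5))) = (\<lambda>t. (-1/2500) + (31/5000) * t + (-1/1000) * t ^ 2 + (-23/100) * t ^ 3 + (1/10) * t ^ 4 + (1) * t ^ 5)"
    by (rule ext) (simp add: field_simps eval_nat_numeral)
  show "energy_defect C (\<lambda>t. (t - (-1/2)) * (t - (-1/5)) * (t - (1/10)) * (t - (1/10)) * (t - (2/5))) \<ge> 0"
    using pw arg_cong[OF eq, of "energy_defect C", unfolded pol] by linarith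
qed

text \<open>The interpolant \<open>f\<close> is below \<open>h\<close> wherever inner products of
  \<open>C\<close> may lie and equals \<open>h\<close> at the four values, so passing from
  \<open>h\<close> to \<open>f\<close> can only lower the defect. The defect of \<open>f\<close> is
  a nonnegative combination of \<open>defects\<close>.\<close>

lemma energy_defect_nonneg_from_nodes:
  assumes h: "absolutely_monotone h" and C: "avoiding_code T C" "card C = 11178"
    and x: "x0 \<in> {-1<..<1}" "x1 \<in> {-1<..<1}" "x2 \<in> {-1<..<1}" "x3 \<in> {-1<..<1}" "x4 \<in> {-1<..<1}" "x5 \<in> {-1<..<1}"
    and sign: "\<And>t. t \<in> {-1<..<1} \<Longrightarrow> t \<notin> T \<Longrightarrow> (t - x0) * (t - x1) * (t - x2) * (t - x3) * (t - x4) * (t - x5) \<ge> 0"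
    and T: "T \<subseteq> {-1/2<..}"
    and nodes: "{x0, x1, x2, x3, x4, x5} = {-1/2, -1/5, 1/10, 2/5}"
    and defects: "energy_defect C (\<lambda>t. t - x0) \<ge> 0" "energy_defect C (\<lambda>t. (t - x0) * (t - x1)) \<ge> 0"
      "energy_defect C (\<lambda>t. (t - x0) * (t - x1) * (t - x2)) \<ge> 0"
      "energy_defect C (\<lambda>t. (t - x0) * (t - x1) * (t - x2) * (t - x3)) \<ge> 0"
      "energy_defect C (\<lambda>t. (t - x0) * (t - x1) * (t - x2) * (t - x3) * (t - x4)) \<ge> 0"
  shows "energy_defect C h \<ge> 0"
proof -
  obtain c1 c2 c3 c4 c5 g c0 where c: "c1 \<ge> 0" "c2 \<ge> 0" "c3 \<ge> 0" "c4 \<ge> 0" "c5 \<ge> 0"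
    and g: "\<And>t. t \<in> {-1<..<1} \<Longrightarrow> g t \<ge> 0"
    and eq: "\<And>t. t \<in> {-1<..<1} \<Longrightarrow> h t = c0 + c1 * (t - x0) + c2 * ((t - x0) * (t - x1))
      + c3 * ((t - x0) * (t - x1) * (t - x2)) + c4 * ((t - x0) * (t - x1) * (t - x2) * (t - x3))
      + c5 * ((t - x0) * (t - x1) * (t - x2) * (t - x3) * (t - x4))
      + g t * ((t - x0) * (t - x1) * (t - x2) * (t - x3) * (t - x4) * (t - x5))"
    by (rule newton_expansion[OF h x]) (rule that, assumption+)
  define f where "f t = c0 + c1 * (t - x0) + c2 * ((t - x0) * (t - x1))
      + c3 * ((t - x0) * (t - x1) * (t - x2)) + c4 * ((t - x0) * (t - x1) * (t - x2) * (t - x3))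
      + c5 * ((t - x0) * (t - x1) * (t - x2) * (t - x3) * (t - x4))" for t
  have sc: "spherical_code C" and inn: "inner_products C \<inter> T = {}" using C(1) by (auto simp: avoiding_code_def)
  have fin: "finite C" using sc by (simp add: spherical_code_def)
  have node_eq: "h t = f t" if "t \<in> {-1/2, -1/5, 1/10, 2/5}" for t
  proof -
    have "t \<in> {x0, x1, x2, x3, x4, x5}" using nodes that by blast
    then have "(t - x0) * (t - x1) * (t - x2) * (t - x3) * (t - x4) * (t - x5) = 0" by auto
    moreover have "t \<in> {-1<..<1}" using that by auto
    ultimately show ?thesis using eq unfolding f_def by simp
  qed
  have ge1: "f t \<le> h t" if "t \<in> {-1<..<1}" "t \<notin> T" for t
    using eq[OF that(1)] mult_nonneg_nonneg[OF g[OF that(1)] sign[OF that]] unfolding f_def by linarith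
  \<comment> \<open>Antipodal pairs give inner product -1, where \<open>h\<close> is only
    continuous: the inequality is the limit from the right, along points left of \<open>-1/2\<close>
    and so outside \<open>T\<close>.\<close>
  have ge2: "f (-1) \<le> h (-1)"
  proof (rule tendsto_le[of "at_right (-1)"])
    have "continuous_on {-1..<1} h" using h by (simp add: absolutely_monotone_def potential_def)
    then have "continuous_on {-1..0} h" by (rule continuous_on_subset) auto
    then have "(h \<longlongrightarrow> h (-1)) (at (-1) within {-1..0})" by (simp add: continuous_on)
    moreover have "at (-1) within {-1..0} = at_right (-1 :: real)" by (rule at_within_Icc_at_right) simp
    ultimately show "(h \<longlongrightarrow> h (-1)) (at_right (-1))" by simp
    show "(f \<longlongrightarrow> f (-1)) (at_right (-1))" unfolding f_def by (intro tendsto_intros)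
    have "eventually (\<lambda>t. t \<in> {-1<..<-1/2}) (at_right (-1 :: real))" by (rule eventually_at_right_real) simp
    then show "eventually (\<lambda>t. f t \<le> h t) (at_right (-1))"
      by eventually_elim (use T in \<open>auto intro!: ge1\<close>)
  qed simp
  have "energy f C \<le> energy h C" unfolding energy_def
  proof (rule sum_mono, clarify)
    fix x y assume xy: "x \<in> C" "y \<in> C" "x \<noteq> y"
    have n: "norm x = 1" "norm y = 1" using sc xy by (auto simp: spherical_code_def)
    have "x \<bullet> y \<in> inner_products C" using xy by (auto simp: inner_products_def)
    then have nT: "x \<bullet> y \<notin> T" using inn by auto
    have "\<bar>x \<bullet> y\<bar> \<le> 1" using Cauchy_Schwarz_ineq2[of x y] n by simp
    moreover have "x \<bullet> y \<noteq> 1"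
    proof
      assume "x \<bullet> y = 1"
      then have "(norm (x - y))\<^sup>2 = 0"
        using n by (simp add: power2_norm_eq_inner inner_diff_left inner_diff_right inner_commute norm_eq_1)
      then show False using xy by simp
    qed
    ultimately have "x \<bullet> y = -1 \<or> x \<bullet> y \<in> {-1<..<1}" by auto
    then show "f (x \<bullet> y) \<le> h (x \<bullet> y)" using ge1[OF _ nT] ge2 by metis
  qed
  then have "energy_defect C f \<le> energy_defect C h"
    unfolding energy_defect_def by (simp add: node_eq)
  moreover have "energy_defect C f = c0 * energy_defect C (\<lambda>t. 1) + c1 * energy_defect C (\<lambda>t. t - x0)
      + c2 * energy_defect C (\<lambda>t. (t - x0) * (t - x1)) + c3 * energy_defect C (\<lambda>t. (t - x0) * (t - x1) * (t - x2))
      + c4 * energy_defect C (\<lambda>t. (t - x0) * (t - x1) * (t - x2) * (t - x3))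
      + c5 * energy_defect C (\<lambda>t. (t - x0) * (t - x1) * (t - x2) * (t - x3) * (t - x4))"
    unfolding f_def[abs_def] energy_defect_linear using energy_defect_linear(2)[of C c0 "\<lambda>t. 1"] by simp
  moreover have "energy_defect C (\<lambda>t. 1) = 0" by (rule energy_defect_powers(1)[OF sc C(2)])
  ultimately have "c1 * energy_defect C (\<lambda>t. t - x0)
      + c2 * energy_defect C (\<lambda>t. (t - x0) * (t - x1)) + c3 * energy_defect C (\<lambda>t. (t - x0) * (t - x1) * (t - x2))
      + c4 * energy_defect C (\<lambda>t. (t - x0) * (t - x1) * (t - x2) * (t - x3))
      + c5 * energy_defect C (\<lambda>t. (t - x0) * (t - x1) * (t - x2) * (t - x3) * (t - x4)) \<le> energy_defect C h"
    by simp
  moreover have "0 \<le> c1 * energy_defect C (\<lambda>t. t - x0)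
      + c2 * energy_defect C (\<lambda>t. (t - x0) * (t - x1)) + c3 * energy_defect C (\<lambda>t. (t - x0) * (t - x1) * (t - x2))
      + c4 * energy_defect C (\<lambda>t. (t - x0) * (t - x1) * (t - x2) * (t - x3))
      + c5 * energy_defect C (\<lambda>t. (t - x0) * (t - x1) * (t - x2) * (t - x3) * (t - x4))"
    by (intro add_nonneg_nonneg mult_nonneg_nonneg c defects)
  ultimately show ?thesis by (rule order_trans[rotated])
qed

theorem energy_lower_bound:
  fixes C :: "(real ^ 23) set"
  assumes T: "T = {-1/2<..<-1/5} \<or> T = {-1/5<..<1/10} \<or> T = {1/10<..<2/5}"
    and h: "absolutely_monotone h" and C: "avoiding_code T C" "card C = 11178"
  shows "energy h C \<ge> 11178 * (352 * h (-1/2) + 4125 * h (-1/5) + 5600 * h (1/10) + 1100 * h (2/5))"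
proof -
  have sc: "spherical_code C" using C(1) by (simp add: avoiding_code_def)
  note pp = energy_defect_partial_products[OF sc C(2)]
  note main = energy_defect_nonneg_from_nodes[OF h C]
  from T consider "T = {-1/2<..<-1/5}" | "T = {-1/5<..<1/10}" | "T = {1/10<..<2/5}" by blast
  then have "energy_defect C h \<ge> 0"
  proof cases
    case 1
    show ?thesis
    proof (rule main[where ?x0.0="(-1/2)" and ?x1.0="(-1/5)" and ?x2.0="(1/10)" and ?x3.0="(1/10)" and ?x4.0="(2/5)" and ?x5.0="(2/5)"])
      fix t :: real assume "t \<notin> T"
      then have "(t - (-1/2)) * (t - (-1/5)) \<ge> 0"
        using 1 by (cases "t \<le> (-1/2)") (auto intro: mult_nonpos_nonpos mult_nonneg_nonneg)
      then have "((t - (-1/2)) * (t - (-1/5))) * (((t - (1/10)) * (t - (1/10))) * ((t - (2/5)) * (t - (2/5)))) \<ge> 0"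
        by (rule mult_nonneg_nonneg[OF _ mult_nonneg_nonneg[OF zero_le_square zero_le_square]])
      then show "(t - (-1/2)) * (t - (-1/5)) * (t - (1/10)) * (t - (1/10)) * (t - (2/5)) * (t - (2/5)) \<ge> 0"
        by (simp only: mult_ac)
    qed (use 1 pp in auto)
  next
    case 2
    show ?thesis
    proof (rule main[where ?x0.0="(-1/2)" and ?x1.0="(-1/2)" and ?x2.0="(-1/5)" and ?x3.0="(1/10)" and ?x4.0="(2/5)" and ?x5.0="(2/5)"])
      fix t :: real assume "t \<notin> T"
      then have "(t - (-1/5)) * (t - (1/10)) \<ge> 0"
        using 2 by (cases "t \<le> (-1/5)") (auto intro: mult_nonpos_nonpos mult_nonneg_nonneg)
      then have "((t - (-1/5)) * (t - (1/10))) * (((t - (-1/2)) * (t - (-1/2))) * ((t - (2/5)) * (t - (2/5)))) \<ge> 0"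
        by (rule mult_nonneg_nonneg[OF _ mult_nonneg_nonneg[OF zero_le_square zero_le_square]])
      then show "(t - (-1/2)) * (t - (-1/2)) * (t - (-1/5)) * (t - (1/10)) * (t - (2/5)) * (t - (2/5)) \<ge> 0"
        by (simp only: mult_ac)
    qed (use 2 pp in auto)
  next
    case 3
    show ?thesis
    proof (rule main[where ?x0.0="(-1/2)" and ?x1.0="(-1/2)" and ?x2.0="(-1/5)" and ?x3.0="(-1/5)" and ?x4.0="(1/10)" and ?x5.0="(2/5)"])
      fix t :: real assume "t \<notin> T"
      then have "(t - (1/10)) * (t - (2/5)) \<ge> 0"
        using 3 by (cases "t \<le> (1/10)") (auto intro: mult_nonpos_nonpos mult_nonneg_nonneg)
      then have "((t - (1/10)) * (t - (2/5))) * (((t - (-1/2)) * (t - (-1/2))) * ((t - (-1/5)) * (t - (-1/5)))) \<ge> 0"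
        by (rule mult_nonneg_nonneg[OF _ mult_nonneg_nonneg[OF zero_le_square zero_le_square]])
      then show "(t - (-1/2)) * (t - (-1/2)) * (t - (-1/5)) * (t - (-1/5)) * (t - (1/10)) * (t - (2/5)) \<ge> 0"
        by (simp only: mult_ac)
    qed (use 3 pp in auto)
  qed
  then show ?thesis by (simp add: energy_defect_def)
qed

section \<open>Theta series and the shells of the Leech lattice\<close>

lemma powser_zero_coeffs:
  fixes a :: "nat \<Rightarrow> real"
  assumes "\<And>x. (\<lambda>n. a n * x ^ n) sums 0"
  shows "a m = 0"
proof (rule ccontr)
  assume nz: "a m \<noteq> 0"
  have "a 0 = 0" using assms[of 0] by simp
  then have "m > 0" using nz by (cases m) auto
  obtain s where "0 < s" "\<And>z::real. z \<in> cball 0 s - {0} \<Longrightarrow> (\<lambda>_. 0 :: real) z \<noteq> 0"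
    by (rule powser_0_nonzero[of 1 0 a "\<lambda>_. 0" m]) (use assms nz \<open>m > 0\<close> in auto)
  from this(2)[of s] this(1) show False by simp
qed

text \<open>Turns an identity between entire functions of \<open>s\<close> into the convolution
  identity of their coefficients.\<close>

lemma powser_product_coeffs:
  fixes e l r :: "nat \<Rightarrow> real"
  assumes e: "\<And>x. (\<lambda>j. e j * x ^ j) sums E x" and l: "\<And>x. (\<lambda>j. l j * x ^ j) sums L x"
    and r: "\<And>x. (\<lambda>j. r j * x ^ j) sums (E x * L x)"
  shows "(\<Sum>i\<le>j. e i * l (j - i)) = r j"
proof -
  have "(\<Sum>i\<le>j. e i * l (j - i)) - r j = 0"
  proof (rule powser_zero_coeffs)
    fix x :: real
    have abs: "summable (\<lambda>j. norm (c j * x ^ j))" if "\<And>x. (\<lambda>j. c j * x ^ j) sums C x" for c C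
      by (rule powser_insidea[of _ "\<bar>x\<bar> + 1"]) (use that in \<open>auto simp: sums_iff\<close>)
    have "(\<lambda>k. \<Sum>i\<le>k. (e i * x ^ i) * (l (k - i) * x ^ (k - i))) sums ((\<Sum>k. e k * x ^ k) * (\<Sum>k. l k * x ^ k))"
      by (rule Cauchy_product_sums) (use abs[OF e] abs[OF l] in auto)
    also have "(\<lambda>k. \<Sum>i\<le>k. (e i * x ^ i) * (l (k - i) * x ^ (k - i))) = (\<lambda>k. (\<Sum>i\<le>k. e i * l (k - i)) * x ^ k)"
      unfolding sum_distrib_right
      by (intro ext sum.cong refl) (metis (no_types, lifting) atMost_iff le_add_diff_inverse mult.assoc mult.left_commute power_add)
    finally have "(\<lambda>k. (\<Sum>i\<le>k. e i * l (k - i)) * x ^ k) sums (E x * L x)"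
      using e[of x] l[of x] by (simp add: sums_iff)
    then have "(\<lambda>k. (\<Sum>i\<le>k. e i * l (k - i)) * x ^ k - r k * x ^ k) sums (E x * L x - E x * L x)"
      by (intro sums_diff r)
    then show "(\<lambda>k. ((\<Sum>i\<le>k. e i * l (k - i)) - r k) * x ^ k) sums 0" by (simp add: left_diff_distrib)
  qed
  then show ?thesis by simp
qed

lemma power_div_fact_sums_exp: "(\<lambda>j. y ^ j / fact j) sums exp (y :: real)"
  using exp_converges[of y] by (simp add: divide_inverse mult.commute)

text \<open>A theta series on the imaginary axis with the weight \<open>(x \<bullet> u) ^ j\<close>.
  The weight is not harmonic, so the transformation law of one moment involves the lower moments of
  the same parity as well.\<close>

definition theta_moment :: "(real ^ 'n) set \<Rightarrow> real ^ 'n \<Rightarrow> nat \<Rightarrow> real \<Rightarrow> real" where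
  "theta_moment \<Lambda> u j t = (\<Sum>\<^sub>\<infinity>x\<in>\<Lambda>. exp (- (pi * t) * (norm x)\<^sup>2) * (x \<bullet> u) ^ j)"

lemma theta_exponential_summable:
  fixes \<Lambda> :: "(real ^ 'n) set"
  assumes L: "unimodular_lattice \<Lambda>" and t: "t > 0"
  shows "(\<lambda>x. exp (- (pi * t) * (norm x)\<^sup>2) * exp (K * norm x)) summable_on \<Lambda>"
proof (rule summable_on_comparison_test)
  have "pi * t / 2 > 0" using t by simp
  from lattice_gaussian_summable[OF L this, of 0]
  show "(\<lambda>x. exp (K\<^sup>2 / (2 * pi * t)) * exp (- (pi * t / 2) * (norm x)\<^sup>2)) summable_on \<Lambda>"
    by (intro summable_on_cmult_right) simp
  show "exp (- (pi * t) * (norm x)\<^sup>2) * exp (K * norm x) \<le> exp (K\<^sup>2 / (2 * pi * t)) * exp (- (pi * t / 2) * (norm x)\<^sup>2)" for x :: "real ^ 'n"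
  proof -
    have "0 \<le> (K - pi * t * norm x)\<^sup>2 / (2 * pi * t)" using t by simp
    also have "\<dots> = K\<^sup>2 / (2 * pi * t) + pi * t / 2 * (norm x)\<^sup>2 - K * norm x"
      using t by (simp add: power2_eq_square field_simps)
    finally show ?thesis by (simp flip: exp_add)
  qed
qed auto

text \<open>The lattice sum and the power series in \<open>s\<close> may be interchanged:
  \<open>K ^ j / fact j\<close> majorizes the coefficients, which leads to the summable bound
  \<open>exp (K * \<bar>s\<bar> * norm x)\<close> against the Gaussian.\<close>

lemma theta_series_expansion:
  fixes \<Lambda> :: "(real ^ 'n) set"
  assumes L: "unimodular_lattice \<Lambda>" and t: "t > 0" and u: "norm u = 1"
    and \<kappa>: "\<And>j. \<bar>\<kappa> j\<bar> \<le> K ^ j / fact j" and K: "K \<ge> 0"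
    and f: "\<And>y. (\<lambda>j. \<kappa> j * y ^ j) sums f y"
  shows "(\<lambda>j. (\<kappa> j * theta_moment \<Lambda> u j t) * s ^ j) sums (\<Sum>\<^sub>\<infinity>x\<in>\<Lambda>. exp (- (pi * t) * (norm x)\<^sup>2) * f (s * (x \<bullet> u)))"
proof -
  define e where "e x = exp (- (pi * t) * (norm x)\<^sup>2)" for x :: "real ^ 'n"
  define G where "G x j = e x * (\<kappa> j * (s * (x \<bullet> u)) ^ j)" for x j
  define H where "H x j = e x * ((K * \<bar>s\<bar> * norm x) ^ j / fact j)" for x j
  have H_sum: "((\<lambda>j. H x j) has_sum e x * exp (K * \<bar>s\<bar> * norm x)) UNIV" for x
    unfolding H_def
    by (rule has_sum_cmult_right, rule norm_summable_imp_has_sum)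
       (use K power_div_fact_sums_exp[of "K * \<bar>s\<bar> * norm x"] in \<open>auto simp: sums_iff abs_mult power_abs\<close>)
  have GH: "norm (G x j) \<le> H x j" for x j
  proof -
    have "\<bar>x \<bullet> u\<bar> \<le> norm x" using Cauchy_Schwarz_ineq2[of x u] u by simp
    then have "\<bar>(s * (x \<bullet> u)) ^ j\<bar> \<le> (\<bar>s\<bar> * norm x) ^ j"
      unfolding power_abs abs_mult by (intro power_mono mult_left_mono) auto
    then have "\<bar>\<kappa> j\<bar> * \<bar>(s * (x \<bullet> u)) ^ j\<bar> \<le> (K ^ j / fact j) * (\<bar>s\<bar> * norm x) ^ j"
      using \<kappa>[of j] by (intro mult_mono) auto
    also have "\<dots> = (K * \<bar>s\<bar> * norm x) ^ j / fact j" by (simp add: power_mult_distrib)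
    finally have "e x * (\<bar>\<kappa> j\<bar> * \<bar>(s * (x \<bullet> u)) ^ j\<bar>) \<le> H x j"
      unfolding H_def by (intro mult_left_mono) (auto simp: e_def)
    then show ?thesis by (simp add: G_def abs_mult e_def)
  qed
  have Hnn: "norm (H x j) = H x j" for x j using K by (simp add: H_def e_def)
  have H_all: "(\<lambda>(x, j). H x j) summable_on (\<Lambda> \<times> UNIV)"
  proof -
    have "(\<lambda>p. norm (case p of (x, j) \<Rightarrow> H x j)) summable_on (\<Lambda> \<times> UNIV)"
      unfolding Infinite_Sum.abs_summable_on_Sigma_iff
    proof (intro conjI ballI)
      show "(\<lambda>y. norm (case (x, y) of (x, j) \<Rightarrow> H x j)) summable_on UNIV" for x
        using H_sum[of x] by (auto simp: Hnn[unfolded real_norm_def] summable_on_def)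
      have "infsum (\<lambda>j. norm (H x j)) UNIV = e x * exp (K * \<bar>s\<bar> * norm x)" for x
        unfolding Hnn by (rule infsumI[OF H_sum])
      then show "(\<lambda>x. norm (\<Sum>\<^sub>\<infinity>y. norm (case (x, y) of (x, j) \<Rightarrow> H x j))) summable_on \<Lambda>"
        using theta_exponential_summable[OF L t, of "K * \<bar>s\<bar>"] by (simp add: e_def abs_mult)
    qed
    then show ?thesis by (simp add: case_prod_unfold Hnn[unfolded real_norm_def])
  qed
  have "(\<lambda>p. norm (case p of (x, j) \<Rightarrow> G x j)) summable_on (\<Lambda> \<times> UNIV)"
    by (rule summable_on_comparison_test[OF H_all]) (use GH in \<open>auto simp: case_prod_unfold\<close>)
  then have G_all: "(\<lambda>(x, j). G x j) summable_on (\<Lambda> \<times> UNIV)" by (rule abs_summable_summable)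
  then have G_all': "(\<lambda>(j, x). G x j) summable_on (UNIV \<times> \<Lambda>)"
    using has_sum_swap[THEN iffD1, of "\<lambda>(x, j). G x j"] by (auto simp: summable_on_def case_prod_unfold)
  have row: "((\<lambda>j. G x j) has_sum e x * f (s * (x \<bullet> u))) UNIV" for x
    unfolding G_def
  proof (rule has_sum_cmult_right, rule norm_summable_imp_has_sum)
    show "summable (\<lambda>j. norm (\<kappa> j * (s * (x \<bullet> u)) ^ j))"
      by (rule powser_insidea[of _ "\<bar>s * (x \<bullet> u)\<bar> + 1"]) (use f in \<open>auto simp: sums_iff\<close>)
  qed (rule f)
  have col: "(\<Sum>\<^sub>\<infinity>x\<in>\<Lambda>. G x j) = \<kappa> j * theta_moment \<Lambda> u j t * s ^ j" for j
  proof -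
    have "(\<Sum>\<^sub>\<infinity>x\<in>\<Lambda>. G x j) = (\<Sum>\<^sub>\<infinity>x\<in>\<Lambda>. (\<kappa> j * s ^ j) * (e x * (x \<bullet> u) ^ j))"
      by (simp add: G_def power_mult_distrib mult_ac)
    also have "\<dots> = (\<kappa> j * s ^ j) * (\<Sum>\<^sub>\<infinity>x\<in>\<Lambda>. e x * (x \<bullet> u) ^ j)" by (rule infsum_cmult_right')
    finally show ?thesis by (simp add: theta_moment_def e_def)
  qed
  have "(\<Sum>\<^sub>\<infinity>x\<in>\<Lambda>. e x * f (s * (x \<bullet> u))) = (\<Sum>\<^sub>\<infinity>x\<in>\<Lambda>. \<Sum>\<^sub>\<infinity>j. G x j)"
    using infsumI[OF row] by simp
  also have "\<dots> = (\<Sum>\<^sub>\<infinity>j. \<Sum>\<^sub>\<infinity>x\<in>\<Lambda>. G x j)" by (rule infsum_swap_banach[OF G_all])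
  finally have eq: "(\<Sum>\<^sub>\<infinity>x\<in>\<Lambda>. e x * f (s * (x \<bullet> u))) = (\<Sum>\<^sub>\<infinity>j. \<kappa> j * theta_moment \<Lambda> u j t * s ^ j)" by (simp add: col)
  have "(\<lambda>j. \<Sum>\<^sub>\<infinity>x\<in>\<Lambda>. G x j) summable_on UNIV"
    using summable_on_Sigma_banach[OF G_all'] by simp
  then have "((\<lambda>j. \<kappa> j * theta_moment \<Lambda> u j t * s ^ j) has_sum (\<Sum>\<^sub>\<infinity>j. \<kappa> j * theta_moment \<Lambda> u j t * s ^ j)) UNIV"
    by (simp add: col)
  then show ?thesis using has_sum_imp_sums eq by (simp add: e_def)
qed

text \<open>Taylor coefficients in \<open>s\<close> of \<open>exp (pi / t * s^2)\<close>, the factor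
  left over when the square in a shifted Gaussian is completed.\<close>

definition gauss_coeff :: "real \<Rightarrow> nat \<Rightarrow> real" where
  "gauss_coeff t j = (if even j then (pi / t) ^ (j div 2) / fact (j div 2) else 0)"

lemma gauss_coeff_sums: "(\<lambda>j. gauss_coeff t j * s ^ j) sums exp (pi / t * s\<^sup>2)"
proof -
  have "(\<lambda>k. (pi / t * s\<^sup>2) ^ k / fact k) sums exp (pi / t * s\<^sup>2)" by (rule power_div_fact_sums_exp)
  then have "(\<lambda>k. gauss_coeff t (2 * k) * s ^ (2 * k)) sums exp (pi / t * s\<^sup>2)"
    unfolding power_mult_distrib power_mult by (simp add: gauss_coeff_def)
  then show ?thesis
    by (subst (asm) sums_mono_reindex[where g="\<lambda>k. 2 * k" and f="\<lambda>j. gauss_coeff t j * s ^ j"])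
       (auto simp: strict_mono_def gauss_coeff_def image_iff elim!: evenE)
qed

text \<open>The Jacobi-type transformation law of the theta series with a linear exponential factor,
  read off coefficientwise.\<close>

lemma theta_moment_transformation:
  fixes \<Lambda> :: "(real ^ 24) set"
  assumes L: "unimodular_lattice \<Lambda>" and t: "t > 0" and u: "norm u = 1"
  shows "(\<Sum>i\<le>j. gauss_coeff t i * (cos_coeff (j - i) * (2 * pi) ^ (j - i) * theta_moment \<Lambda> u (j - i) t))
    = (2 * pi / t) ^ j / fact j * theta_moment \<Lambda> u j (1 / t) / t ^ 12"
proof (rule powser_product_coeffs[where l="\<lambda>i. cos_coeff i * (2 * pi) ^ i * theta_moment \<Lambda> u i t"])
  show "(\<lambda>j. gauss_coeff t j * s ^ j) sums exp (pi / t * s\<^sup>2)" for s by (rule gauss_coeff_sums)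
  define Lf where "Lf s = (\<Sum>\<^sub>\<infinity>x\<in>\<Lambda>. exp (- (pi * t) * (norm x)\<^sup>2) * cos (2 * pi * (s * (x \<bullet> u))))" for s
  show "(\<lambda>j. (cos_coeff j * (2 * pi) ^ j * theta_moment \<Lambda> u j t) * s ^ j) sums Lf s" for s
    unfolding Lf_def
  proof (rule theta_series_expansion[OF L t u, where K="2 * pi"])
    show "\<bar>cos_coeff j * (2 * pi) ^ j\<bar> \<le> (2 * pi) ^ j / fact j" for j
      by (simp add: cos_coeff_def abs_mult power_abs)
    show "(\<lambda>j. cos_coeff j * (2 * pi) ^ j * y ^ j) sums cos (2 * pi * y)" for y
      using cos_converges[of "2 * pi * y"] by (simp add: power_mult_distrib mult.assoc)
  qed simp
  show "(\<lambda>j. ((2 * pi / t) ^ j / fact j * theta_moment \<Lambda> u j (1 / t) / t ^ 12) * s ^ j) sums (exp (pi / t * s\<^sup>2) * Lf s)" for s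
  proof -
    have t': "1 / t > 0" using t by simp
    have "(\<lambda>j. ((2 * pi / t) ^ j / fact j * theta_moment \<Lambda> u j (1 / t)) * s ^ j) sums
        (\<Sum>\<^sub>\<infinity>x\<in>\<Lambda>. exp (- (pi * (1 / t)) * (norm x)\<^sup>2) * exp (2 * pi / t * (s * (x \<bullet> u))))"
    proof (rule theta_series_expansion[OF L t' u, where K="2 * pi / t"])
      show "\<bar>(2 * pi / t) ^ j / fact j\<bar> \<le> (2 * pi / t) ^ j / fact j" for j using t by simp
      show "(\<lambda>j. (2 * pi / t) ^ j / fact j * y ^ j) sums exp (2 * pi / t * y)" for y
        using power_div_fact_sums_exp[of "2 * pi / t * y"] by (simp add: power_mult_distrib power_divide)
    qed (use t in simp)
    then have sums: "(\<lambda>j. ((2 * pi / t) ^ j / fact j * theta_moment \<Lambda> u j (1 / t) / t ^ 12) * s ^ j) sums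
        ((\<Sum>\<^sub>\<infinity>x\<in>\<Lambda>. exp (- (pi / t) * (norm x)\<^sup>2) * exp (2 * pi / t * (s * (x \<bullet> u)))) / t ^ 12)"
      using sums_divide[of "\<lambda>j. ((2 * pi / t) ^ j / fact j * theta_moment \<Lambda> u j (1 / t)) * s ^ j" _ "t ^ 12"] by simp
    \<comment> \<open>Completing the square: the Gaussian shifted by \<open>s *\<^sub>R u\<close> on
      the dual side is the centred one times a linear exponential.\<close>
    have e: "exp (- (pi / t) * (norm x)\<^sup>2) * exp (2 * pi / t * (s * (x \<bullet> u))) =
        exp (pi / t * s\<^sup>2) * exp (- (pi / t) * (norm (x - s *\<^sub>R u))\<^sup>2)" for x
    proof -
      have eq: "(norm (x - s *\<^sub>R u))\<^sup>2 = (norm x)\<^sup>2 - 2 * s * (x \<bullet> u) + s\<^sup>2"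
        using u unfolding power2_norm_eq_inner norm_eq_1
        by (simp add: inner_diff_left inner_diff_right inner_commute power2_eq_square algebra_simps)
      show ?thesis unfolding eq by (simp flip: exp_add add: algebra_simps)
    qed
    have st: "sqrt t ^ CARD(24) = t ^ 12"
    proof -
      have "sqrt t ^ 24 = (sqrt t ^ 2) ^ 12" by (simp flip: power_mult)
      then show ?thesis using t by simp
    qed
    have rsum: "(\<lambda>x. exp (- (pi / t) * (norm (x - s *\<^sub>R u))\<^sup>2)) summable_on \<Lambda>"
      using lattice_gaussian_summable[OF L, of "pi / t" "s *\<^sub>R u"] t by simp
    have lsum: "(\<lambda>x. complex_of_real (exp (- (pi * t) * (norm x)\<^sup>2)) * cis (2 * pi * (x \<bullet> (s *\<^sub>R u)))) summable_on \<Lambda>"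
    proof (rule abs_summable_summable)
      show "(\<lambda>x. norm (complex_of_real (exp (- (pi * t) * (norm x)\<^sup>2)) * cis (2 * pi * (x \<bullet> (s *\<^sub>R u))))) summable_on \<Lambda>"
        using lattice_gaussian_summable[OF L, of "pi * t" 0] t by (simp add: norm_mult)
    qed
    have "complex_of_real (\<Sum>\<^sub>\<infinity>x\<in>\<Lambda>. exp (- (pi / t) * (norm (x - s *\<^sub>R u))\<^sup>2)) = (\<Sum>\<^sub>\<infinity>x\<in>\<Lambda>. complex_of_real (exp (- (pi / t) * (norm (x - s *\<^sub>R u))\<^sup>2)))"
      by (rule infsumI[symmetric]) (simp only: has_sum_of_real_iff has_sum_infsum[OF rsum])
    then have "(\<Sum>\<^sub>\<infinity>x\<in>\<Lambda>. complex_of_real (exp (- (pi * t) * (norm x)\<^sup>2)) * cis (2 * pi * (x \<bullet> (s *\<^sub>R u)))) =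
        of_real ((\<Sum>\<^sub>\<infinity>x\<in>\<Lambda>. exp (- (pi / t) * (norm (x - s *\<^sub>R u))\<^sup>2)) / t ^ 12)"
      using lattice_poisson[OF L t, of "s *\<^sub>R u"] unfolding st by simp
    \<comment> \<open>The dual sum is real, so only the cosine part of the phases counts; this is
      why \<open>cos_coeff\<close> appears in the coefficients.\<close>
    then have "Re (\<Sum>\<^sub>\<infinity>x\<in>\<Lambda>. complex_of_real (exp (- (pi * t) * (norm x)\<^sup>2)) * cis (2 * pi * (x \<bullet> (s *\<^sub>R u)))) =
        (\<Sum>\<^sub>\<infinity>x\<in>\<Lambda>. exp (- (pi / t) * (norm (x - s *\<^sub>R u))\<^sup>2)) / t ^ 12" by (metis Re_complex_of_real)
    moreover have "Re (\<Sum>\<^sub>\<infinity>x\<in>\<Lambda>. complex_of_real (exp (- (pi * t) * (norm x)\<^sup>2)) * cis (2 * pi * (x \<bullet> (s *\<^sub>R u)))) = Lf s"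
      unfolding infsum_Re[OF lsum, symmetric] Lf_def by simp
    ultimately have "Lf s = (\<Sum>\<^sub>\<infinity>x\<in>\<Lambda>. exp (- (pi / t) * (norm (x - s *\<^sub>R u))\<^sup>2)) / t ^ 12" by simp
    then have "exp (pi / t * s\<^sup>2) * Lf s = (\<Sum>\<^sub>\<infinity>x\<in>\<Lambda>. exp (- (pi / t) * (norm x)\<^sup>2) * exp (2 * pi / t * (s * (x \<bullet> u)))) / t ^ 12"
      unfolding e by (simp add: infsum_cmult_right')
    then show ?thesis using sums by simp
  qed
qed

text \<open>The index is half the squared length, the exponent of \<open>exp (- 2 * pi * t)\<close>
  in the theta series. The minimal vectors of a Leech lattice are the shell of index 2.\<close>

definition shell :: "(real ^ 'n) set \<Rightarrow> nat \<Rightarrow> (real ^ 'n) set" where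
  "shell \<Lambda> m = {x \<in> \<Lambda>. x \<bullet> x = 2 * real m}"

lemma norm_shell: "x \<in> shell \<Lambda> m \<Longrightarrow> norm x = sqrt (2 * real m)"
  by (simp add: shell_def norm_eq_sqrt_inner)

text \<open>All vectors of a shell contribute the same positive amount to a convergent Gaussian
  sum.\<close>

lemma finite_shell:
  fixes \<Lambda> :: "(real ^ 'n) set"
  assumes L: "unimodular_lattice \<Lambda>"
  shows "finite (shell \<Lambda> m)"
proof (rule ccontr)
  assume inf: "infinite (shell \<Lambda> m)"
  define f where "f x = exp (- pi * (norm (x - 0))\<^sup>2)" for x :: "real ^ 'n"
  define c where "c = exp (- pi * (2 * real m))"
  have f: "f summable_on \<Lambda>" unfolding f_def by (rule lattice_gaussian_summable[OF L]) simp
  obtain n :: nat where n: "infsum f \<Lambda> / c < real n" using reals_Archimedean2 by blast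
  obtain B where B: "B \<subseteq> shell \<Lambda> m" "finite B" "card B = n" using infinite_arbitrarily_large[OF inf] by blast
  have "sum f B \<le> infsum f \<Lambda>"
    by (rule finite_sum_le_infsum[OF f B(2)]) (use B in \<open>auto simp: shell_def f_def\<close>)
  moreover have "sum f B = (\<Sum>x\<in>B. c)"
    by (rule sum.cong) (use B in \<open>auto simp: shell_def f_def c_def power2_norm_eq_inner subset_iff\<close>)
  ultimately have "real n * c \<le> infsum f \<Lambda>" using B by simp
  moreover have "c > 0" by (simp add: c_def)
  ultimately show False using n by (simp add: field_simps)
qed

lemma even_lattice_sums_by_shells:
  fixes \<Lambda> :: "(real ^ 'n) set" and f :: "real ^ 'n \<Rightarrow> real"
  assumes L: "even_unimodular_lattice \<Lambda>" and f: "f summable_on \<Lambda>"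
  shows "(\<lambda>m. \<Sum>x\<in>shell \<Lambda> m. f x) sums infsum f \<Lambda>"
proof -
  have U: "unimodular_lattice \<Lambda>" using L by (simp add: even_unimodular_lattice_def)
  have bij: "bij_betw snd (Sigma UNIV (shell \<Lambda>)) \<Lambda>"
  proof (rule bij_betwI')
    show "(snd p = snd p') = (p = p')" if "p \<in> Sigma UNIV (shell \<Lambda>)" "p' \<in> Sigma UNIV (shell \<Lambda>)" for p p'
      using that by (auto simp: shell_def)
    show "snd p \<in> \<Lambda>" if "p \<in> Sigma UNIV (shell \<Lambda>)" for p using that by (auto simp: shell_def)
    show "\<exists>p\<in>Sigma UNIV (shell \<Lambda>). x = snd p" if x: "x \<in> \<Lambda>" for x
    proof -
      obtain k :: int where k: "x \<bullet> x = 2 * of_int k" using L x by (auto simp: even_unimodular_lattice_def)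
      then have "k \<ge> 0" using inner_ge_zero[of x] by simp
      then have "x \<bullet> x = 2 * real (nat k)" using k by simp
      then show ?thesis using x by (intro bexI[of _ "(nat k, x)"]) (auto simp: shell_def)
    qed
  qed
  have "(f has_sum infsum f \<Lambda>) \<Lambda>" using f by (rule has_sum_infsum)
  then have "((\<lambda>p. f (snd p)) has_sum infsum f \<Lambda>) (Sigma UNIV (shell \<Lambda>))"
    by (subst has_sum_reindex_bij_betw[OF bij])
  then have "((\<lambda>m. \<Sum>x\<in>shell \<Lambda> m. f x) has_sum infsum f \<Lambda>) UNIV"
    by (rule has_sum_SigmaD) (use finite_shell[OF U] in \<open>auto intro!: has_sum_finite\<close>)
  then show ?thesis by (rule has_sum_imp_sums)
qed

lemma exp_norm_shell:
  assumes "x \<in> shell \<Lambda> m"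
  shows "exp (- (pi * t) * (norm x)\<^sup>2) = exp (- 2 * pi * t) ^ m"
  using assms by (simp add: shell_def power2_norm_eq_inner flip: exp_of_nat_mult)

lemma theta_power_summable:
  fixes \<Lambda> :: "(real ^ 'n) set"
  assumes L: "unimodular_lattice \<Lambda>" and t: "t > 0"
  shows "(\<lambda>x. exp (- (pi * t) * (norm x)\<^sup>2) * norm x ^ j) summable_on \<Lambda>"
proof (rule summable_on_comparison_test)
  show "(\<lambda>x. fact j * (exp (- (pi * t) * (norm x)\<^sup>2) * exp (1 * norm x))) summable_on \<Lambda>"
    by (intro summable_on_cmult_right theta_exponential_summable L t)
  show "exp (- (pi * t) * (norm x)\<^sup>2) * norm x ^ j \<le> fact j * (exp (- (pi * t) * (norm x)\<^sup>2) * exp (1 * norm x))" for x :: "real ^ 'n"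
  proof -
    have "(\<Sum>i\<in>{j}. norm x ^ i / fact i) \<le> exp (norm x)"
      using power_div_fact_sums_exp[of "norm x"]
      by (subst sums_unique[OF power_div_fact_sums_exp]) (rule sum_le_suminf, auto simp: sums_iff)
    then have "norm x ^ j \<le> fact j * exp (norm x)" by (simp add: field_simps)
    then show ?thesis by simp
  qed
qed auto

text \<open>With \<open>r = exp (- 2 * pi * t)\<close> this is a theta series weighted by a power of
  the length. It majorizes the moments in all unit directions at once; at \<open>r = 0\<close> there
  is no such \<open>t\<close>.\<close>

lemma shell_card_summable:
  fixes \<Lambda> :: "(real ^ 'n) set"
  assumes L: "even_unimodular_lattice \<Lambda>" and r: "0 \<le> r" "r < 1"
  shows "summable (\<lambda>m. real (card (shell \<Lambda> m)) * sqrt (2 * real m) ^ j * r ^ m)"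
proof (cases "r = 0")
  case True
  then have "(\<lambda>m. real (card (shell \<Lambda> m)) * sqrt (2 * real m) ^ j * r ^ m) sums (real (card (shell \<Lambda> 0)) * sqrt (2 * real 0) ^ j)"
    using powser_sums_zero[of "\<lambda>m. real (card (shell \<Lambda> m)) * sqrt (2 * real m) ^ j"] by simp
  then show ?thesis by (simp add: sums_iff)
next
  case False
  have U: "unimodular_lattice \<Lambda>" using L by (simp add: even_unimodular_lattice_def)
  define t where "t = - ln r / (2 * pi)"
  have t: "t > 0" using r False by (simp add: t_def ln_less_zero field_simps)
  have q: "exp (- 2 * pi * t) = r" using r False by (simp add: t_def)
  have "summable (\<lambda>m. \<Sum>x\<in>shell \<Lambda> m. exp (- (pi * t) * (norm x)\<^sup>2) * norm x ^ j)"
    using even_lattice_sums_by_shells[OF L theta_power_summable[OF U t]] by (simp add: sums_iff)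
  moreover have "(\<Sum>x\<in>shell \<Lambda> m. exp (- (pi * t) * (norm x)\<^sup>2) * norm x ^ j) = real (card (shell \<Lambda> m)) * sqrt (2 * real m) ^ j * r ^ m" for m
  proof -
    have "(\<Sum>x\<in>shell \<Lambda> m. exp (- (pi * t) * (norm x)\<^sup>2) * norm x ^ j) = (\<Sum>x\<in>shell \<Lambda> m. r ^ m * sqrt (2 * real m) ^ j)"
      by (intro sum.cong refl, subst exp_norm_shell) (simp_all only: q norm_shell)
    then show ?thesis by simp
  qed
  ultimately show ?thesis by simp
qed

lemma theta_moment_by_shells:
  fixes \<Lambda> :: "(real ^ 'n) set"
  assumes L: "even_unimodular_lattice \<Lambda>" and t: "t > 0"
  shows "(\<lambda>m. (\<Sum>x\<in>shell \<Lambda> m. (x \<bullet> u) ^ j) * exp (- 2 * pi * t) ^ m) sums theta_moment \<Lambda> u j t"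
proof -
  have U: "unimodular_lattice \<Lambda>" using L by (simp add: even_unimodular_lattice_def)
  have s: "(\<lambda>x. exp (- (pi * t) * (norm x)\<^sup>2) * (x \<bullet> u) ^ j) summable_on \<Lambda>"
  proof (rule abs_summable_summable, rule summable_on_comparison_test)
    show "(\<lambda>x. norm u ^ j * (exp (- (pi * t) * (norm x)\<^sup>2) * norm x ^ j)) summable_on \<Lambda>"
      by (intro summable_on_cmult_right theta_power_summable U t)
    show "norm (exp (- (pi * t) * (norm x)\<^sup>2) * (x \<bullet> u) ^ j) \<le> norm u ^ j * (exp (- (pi * t) * (norm x)\<^sup>2) * norm x ^ j)" for x
    proof -
      have "\<bar>x \<bullet> u\<bar> ^ j \<le> (norm x * norm u) ^ j" by (intro power_mono Cauchy_Schwarz_ineq2) auto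
      then show ?thesis by (simp add: abs_mult power_abs power_mult_distrib mult_ac)
    qed
  qed auto
  have "(\<Sum>x\<in>shell \<Lambda> m. exp (- (pi * t) * (norm x)\<^sup>2) * (x \<bullet> u) ^ j) = (\<Sum>x\<in>shell \<Lambda> m. (x \<bullet> u) ^ j) * exp (- 2 * pi * t) ^ m" for m
    unfolding sum_distrib_right by (intro sum.cong refl) (simp only: exp_norm_shell mult.commute)
  then show ?thesis
    using even_lattice_sums_by_shells[OF L s] by (simp add: theta_moment_def)
qed

definition mean_theta_moment :: "(real ^ 'n) set \<Rightarrow> nat \<Rightarrow> real \<Rightarrow> real" where
  "mean_theta_moment \<Lambda> j t = (LINT u|surface_measure. theta_moment \<Lambda> u j t)"

text \<open>On the unit sphere the terms have a bound independent of \<open>u\<close>, summable by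
  \<open>shell_card_summable\<close>, so the sum over shells may be integrated term by term.\<close>

lemma mean_theta_moment_by_shells:
  fixes \<Lambda> :: "(real ^ 'n::{finite,wellorder}) set"
  assumes L: "even_unimodular_lattice \<Lambda>" and t: "t > 0"
  shows "integrable surface_measure (\<lambda>u. theta_moment \<Lambda> u j t)"
    and "(\<lambda>m. (LINT u|surface_measure. (\<Sum>x\<in>shell \<Lambda> m. (x \<bullet> u) ^ j)) * exp (- 2 * pi * t) ^ m) sums mean_theta_moment \<Lambda> j t"
proof -
  interpret prob_space "surface_measure :: (real ^ 'n::_) measure" by (rule prob_space_surface_measure)
  define q where "q = exp (- 2 * pi * t)"
  have q: "0 \<le> q" "q < 1" using t by (simp_all add: q_def)
  define F where "F m u = (\<Sum>x\<in>shell \<Lambda> m. (x \<bullet> u) ^ j) * q ^ m" for m u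
  define B where "B m = real (card (shell \<Lambda> m)) * sqrt (2 * real m) ^ j * q ^ m" for m
  have B: "summable B" unfolding B_def by (rule shell_card_summable[OF L q])
  have int: "integrable surface_measure (F m)" for m
    unfolding F_def by (intro integrable_surface_measure continuous_intros)
  have le: "norm (F m u) \<le> B m" if u: "norm u = 1" for m u
  proof -
    have "\<bar>x \<bullet> u\<bar> ^ j \<le> sqrt (2 * real m) ^ j" if "x \<in> shell \<Lambda> m" for x
      using Cauchy_Schwarz_ineq2[of x u] u norm_shell[OF that] by (intro power_mono) auto
    then have "\<bar>\<Sum>x\<in>shell \<Lambda> m. (x \<bullet> u) ^ j\<bar> \<le> real (card (shell \<Lambda> m)) * sqrt (2 * real m) ^ j"
      using sum_norm_bound[of "shell \<Lambda> m" "\<lambda>x. (x \<bullet> u) ^ j"] by (simp add: power_abs)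
    then show ?thesis using q unfolding F_def B_def by (simp add: abs_mult mult_right_mono)
  qed
  have AEle: "AE u in surface_measure. \<forall>m. norm (F m u) \<le> B m"
    using AE_surface_measure_norm by eventually_elim (use le in auto)
  have AEs: "AE u in surface_measure. summable (\<lambda>m. norm (F m u))"
    using AEle by eventually_elim (rule summable_comparison_test'[OF B], auto)
  have Is: "summable (\<lambda>m. LINT u|surface_measure. norm (F m u))"
  proof (rule summable_comparison_test'[OF B])
    show "norm (LINT u|surface_measure. norm (F m u)) \<le> B m" for m
    proof -
      have "(LINT u|surface_measure. norm (F m u)) \<le> (LINT u|(surface_measure :: (real ^ 'n::_) measure). B m)"
        by (rule integral_mono_AE) (use int AEle in \<open>auto elim!: eventually_mono\<close>)
      then show ?thesis using prob_space by simp
    qed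
  qed
  have eq: "theta_moment \<Lambda> u j t = (\<Sum>m. F m u)" for u
    using theta_moment_by_shells[OF L t, of u j] by (simp add: sums_iff F_def q_def)
  show "integrable surface_measure (\<lambda>u. theta_moment \<Lambda> u j t)"
    unfolding eq by (rule integrable_suminf[OF int AEs Is])
  have "(\<lambda>m. LINT u|surface_measure. F m u) sums (LINT u|surface_measure. (\<Sum>m. F m u))"
    by (rule sums_integral[OF int AEs Is])
  then show "(\<lambda>m. (LINT u|surface_measure. (\<Sum>x\<in>shell \<Lambda> m. (x \<bullet> u) ^ j)) * exp (- 2 * pi * t) ^ m) sums mean_theta_moment \<Lambda> j t"
    unfolding mean_theta_moment_def eq by (simp add: F_def q_def)
qed

text \<open>The law for a single direction is linear in the moments with coefficients independent of
  \<open>u\<close>, so it survives averaging. The difference from the mean obeys it too, which takes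
  the place of a decomposition into harmonic polynomials.\<close>

lemma mean_theta_moment_transformation:
  fixes \<Lambda> :: "(real ^ 24) set"
  assumes L: "even_unimodular_lattice \<Lambda>" and t: "t > 0"
  shows "(\<Sum>i\<le>j. gauss_coeff t i * (cos_coeff (j - i) * (2 * pi) ^ (j - i) * mean_theta_moment \<Lambda> (j - i) t))
    = (2 * pi / t) ^ j / fact j * mean_theta_moment \<Lambda> j (1 / t) / t ^ 12"
proof -
  have U: "unimodular_lattice \<Lambda>" using L by (simp add: even_unimodular_lattice_def)
  have t': "1 / t > 0" using t by simp
  have "(LINT u|surface_measure. (\<Sum>i\<le>j. gauss_coeff t i * (cos_coeff (j - i) * (2 * pi) ^ (j - i) * theta_moment \<Lambda> u (j - i) t)))
    = (LINT u|surface_measure. (2 * pi / t) ^ j / fact j * theta_moment \<Lambda> u j (1 / t) / t ^ 12)"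
  proof (rule integral_cong_AE)
    show "AE u in surface_measure. (\<Sum>i\<le>j. gauss_coeff t i * (cos_coeff (j - i) * (2 * pi) ^ (j - i) * theta_moment \<Lambda> u (j - i) t))
      = (2 * pi / t) ^ j / fact j * theta_moment \<Lambda> u j (1 / t) / t ^ 12"
      using AE_surface_measure_norm by eventually_elim (rule theta_moment_transformation[OF U t])
    have m: "(\<lambda>u. theta_moment \<Lambda> u i s) \<in> borel_measurable surface_measure" if "s > 0" for i s
      using mean_theta_moment_by_shells(1)[OF L that] by (rule borel_measurable_integrable)
    show "(\<lambda>u. \<Sum>i\<le>j. gauss_coeff t i * (cos_coeff (j - i) * (2 * pi) ^ (j - i) * theta_moment \<Lambda> u (j - i) t)) \<in> borel_measurable surface_measure"
      by (intro borel_measurable_sum borel_measurable_times borel_measurable_const m t)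
    show "(\<lambda>u. (2 * pi / t) ^ j / fact j * theta_moment \<Lambda> u j (1 / t) / t ^ 12) \<in> borel_measurable surface_measure"
      by (intro borel_measurable_divide borel_measurable_times borel_measurable_const m t')
  qed
  then show ?thesis
    by (simp add: mean_theta_moment_def mean_theta_moment_by_shells(1)[OF L t] mean_theta_moment_by_shells(1)[OF L t'] Bochner_Integration.integral_sum)
qed

text \<open>The difference between the moments in direction \<open>u\<close> and their spherical mean is a cusp form
  of weight \<open>12 + 2 k\<close> vanishing to order 2, as soon as the lower differences vanish; so it is 0.\<close>

theorem leech_shell_design:
  fixes \<Lambda> :: "(real ^ 24) set"
  assumes leech: "leech_lattice \<Lambda>" and u: "norm u = 1" and k: "k \<le> 4"
  shows "(\<Sum>x\<in>shell \<Lambda> m. (x \<bullet> u) ^ (2 * k)) = sphere_moment 24 k * (2 * real m) ^ k * real (card (shell \<Lambda> m))"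
  using k
proof (induction k arbitrary: m rule: less_induct)
  case (less k)
  have L: "even_unimodular_lattice \<Lambda>" using leech by (simp add: leech_lattice_def)
  have U: "unimodular_lattice \<Lambda>" using L by (simp add: even_unimodular_lattice_def)
  \<comment> \<open>Averaging over the direction \<open>u\<close> instead of over the shell: the
    result depends only on the length of \<open>x\<close>, and it is the value a spherical design
    must have.\<close>
  have mean_shell: "(LINT u|surface_measure. (\<Sum>x\<in>shell \<Lambda> m. (x \<bullet> u) ^ (2 * i))) = sphere_moment 24 i * (2 * real m) ^ i * real (card (shell \<Lambda> m))" for m i
  proof -
    have "(LINT u|surface_measure. (\<Sum>x\<in>shell \<Lambda> m. (x \<bullet> u) ^ (2 * i))) = (\<Sum>x\<in>shell \<Lambda> m. LINT u|surface_measure. (u \<bullet> x) ^ (2 * i))"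
      by (subst Bochner_Integration.integral_sum) (auto intro!: integrable_surface_measure continuous_intros simp: inner_commute)
    also have "\<dots> = (\<Sum>x\<in>shell \<Lambda> m. sphere_moment 24 i * (2 * real m) ^ i)"
    proof (rule sum.cong)
      fix x assume x: "x \<in> shell \<Lambda> m"
      have "norm x ^ (2 * i) = (2 * real m) ^ i" using norm_shell[OF x] by (simp add: power_mult)
      then show "(LINT u|surface_measure. (u \<bullet> x) ^ (2 * i)) = sphere_moment 24 i * (2 * real m) ^ i"
        using surface_integral_even[of x i] by simp
    qed simp
    finally show ?thesis by simp
  qed
  define \<delta> where "\<delta> j t = theta_moment \<Lambda> u j t - mean_theta_moment \<Lambda> j t" for j t
  define a where "a i m = (\<Sum>x\<in>shell \<Lambda> m. (x \<bullet> u) ^ (2 * i)) - sphere_moment 24 i * (2 * real m) ^ i * real (card (shell \<Lambda> m))" for i m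
  have \<delta>_sums: "(\<lambda>m. a i m * exp (- 2 * pi * t) ^ m) sums \<delta> (2 * i) t" if "t > 0" for i t
    using sums_diff[OF theta_moment_by_shells[OF L that, of u "2 * i"] mean_theta_moment_by_shells(2)[OF L that, of "2 * i"]]
    by (simp add: mean_shell a_def \<delta>_def left_diff_distrib)
  have \<delta>_low: "\<delta> (2 * i) t = 0" if "i < k" "t > 0" for i t
  proof -
    have "a i m = 0" for m using less.IH[OF that(1), of m] less.prems that by (simp add: a_def)
    then have "(\<lambda>m. 0) sums \<delta> (2 * i) t" using \<delta>_sums[OF that(2), of i] by simp
    then show ?thesis using sums_unique2 sums_zero by blast
  qed
  have fe: "\<delta> (2 * k) (1 / t) = (- 1) ^ k * t ^ (12 + 2 * k) * \<delta> (2 * k) t" if t: "t > 0" for t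
  proof -
    define j where "j = 2 * k"
    have "(\<Sum>i\<le>j. gauss_coeff t i * (cos_coeff (j - i) * (2 * pi) ^ (j - i) * \<delta> (j - i) t)) = (2 * pi / t) ^ j / fact j * \<delta> j (1 / t) / t ^ 12"
      using arg_cong2[OF theta_moment_transformation[OF U t u, of j] mean_theta_moment_transformation[OF L t, of j], of "(-)"]
      unfolding \<delta>_def by (simp add: right_diff_distrib sum_subtractf diff_divide_distrib)
    \<comment> \<open>Only \<open>i = 0\<close> survives: \<open>gauss_coeff\<close> is zero at odd
      indices, and even \<open>i > 0\<close> leads to a lower moment, whose difference is zero by
      induction.\<close>
    also have "(\<Sum>i\<le>j. gauss_coeff t i * (cos_coeff (j - i) * (2 * pi) ^ (j - i) * \<delta> (j - i) t)) =
        (\<Sum>i\<in>{0}. gauss_coeff t i * (cos_coeff (j - i) * (2 * pi) ^ (j - i) * \<delta> (j - i) t))"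
    proof (rule sum.mono_neutral_right)
      show "\<forall>i\<in>{..j} - {0}. gauss_coeff t i * (cos_coeff (j - i) * (2 * pi) ^ (j - i) * \<delta> (j - i) t) = 0"
      proof
        fix i assume i: "i \<in> {..j} - {0}"
        show "gauss_coeff t i * (cos_coeff (j - i) * (2 * pi) ^ (j - i) * \<delta> (j - i) t) = 0"
        proof (cases "even i")
          case True
          then obtain i' where i': "i = 2 * i'" by (auto elim: evenE)
          then have "j - i = 2 * (k - i')" "k - i' < k" using i by (auto simp: j_def)
          then show ?thesis using \<delta>_low[OF _ t, of "k - i'"] by simp
        qed (simp add: gauss_coeff_def)
      qed
    qed auto
    also have "\<dots> = (- 1) ^ k / fact j * (2 * pi) ^ j * \<delta> j t"
      by (simp add: gauss_coeff_def cos_coeff_def j_def)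
    finally have "(- 1) ^ k * \<delta> j t * ((2 * pi) ^ j / fact j) = \<delta> j (1 / t) / (t ^ j * t ^ 12) * ((2 * pi) ^ j / fact j)"
      by (simp add: power_divide mult_ac)
    then have "(- 1) ^ k * \<delta> j t = \<delta> j (1 / t) / (t ^ j * t ^ 12)"
      by (subst (asm) mult_right_cancel) auto
    then show ?thesis using t by (simp add: j_def power_add field_simps)
  qed
  have shell0: "shell \<Lambda> 0 = {0}" using lattice_zero[OF U] by (auto simp: shell_def)
  have shell1: "shell \<Lambda> 1 = {}"
  proof -
    have False if x: "x \<in> shell \<Lambda> 1" for x
    proof -
      have "x \<in> \<Lambda> - {0}" "x \<bullet> x = 2" using x by (auto simp: shell_def)
      then have "4 \<le> x \<bullet> x" using leech unfolding leech_lattice_def by blast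
      then show False using \<open>x \<bullet> x = 2\<close> by simp
    qed
    then show ?thesis by blast
  qed
  have "complex_of_real (a k m) = 0"
  proof (rule modular_form_vanishes[where k="12 + 2 * k"])
    show "12 + 2 * k \<le> 20" using less.prems by simp
    \<comment> \<open>Order 2 at infinity: there are no vectors of squared length 2, and the zero
      vector contributes 1 to both terms if \<open>k = 0\<close> and 0 otherwise.\<close>
    show "complex_of_real (a k 1) = 0" by (simp only: a_def shell1) simp
    show "complex_of_real (a k 0) = 0" by (cases k) (simp_all add: a_def shell0 sphere_moment_def)
    show "summable (\<lambda>m. norm (complex_of_real (a k m)) * r ^ m)" if r: "0 \<le> r" "r < 1" for r
    proof (rule summable_comparison_test')
      show "summable (\<lambda>m. (1 + \<bar>sphere_moment 24 k\<bar>) * (real (card (shell \<Lambda> m)) * sqrt (2 * real m) ^ (2 * k) * r ^ m))"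
        by (intro summable_mult shell_card_summable L r)
      fix m
      have "\<bar>x \<bullet> u\<bar> ^ (2 * k) \<le> sqrt (2 * real m) ^ (2 * k)" if "x \<in> shell \<Lambda> m" for x
        using Cauchy_Schwarz_ineq2[of x u] u norm_shell[OF that] by (intro power_mono) auto
      then have "\<bar>\<Sum>x\<in>shell \<Lambda> m. (x \<bullet> u) ^ (2 * k)\<bar> \<le> real (card (shell \<Lambda> m)) * (2 * real m) ^ k"
        using sum_norm_bound[of "shell \<Lambda> m" "\<lambda>x. (x \<bullet> u) ^ (2 * k)"] by (simp add: power_mult power_even_abs)
      moreover have "\<bar>sphere_moment 24 k * (2 * real m) ^ k * real (card (shell \<Lambda> m))\<bar> = \<bar>sphere_moment 24 k\<bar> * (real (card (shell \<Lambda> m)) * (2 * real m) ^ k)"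
        by (simp add: abs_mult mult_ac)
      ultimately have "\<bar>a k m\<bar> \<le> (1 + \<bar>sphere_moment 24 k\<bar>) * (real (card (shell \<Lambda> m)) * (2 * real m) ^ k)"
        unfolding a_def distrib_right by linarith
      then have "\<bar>a k m\<bar> * r ^ m \<le> (1 + \<bar>sphere_moment 24 k\<bar>) * (real (card (shell \<Lambda> m)) * (2 * real m) ^ k) * r ^ m"
        using r by (intro mult_right_mono) auto
      then show "norm (norm (complex_of_real (a k m)) * r ^ m) \<le> (1 + \<bar>sphere_moment 24 k\<bar>) * (real (card (shell \<Lambda> m)) * sqrt (2 * real m) ^ (2 * k) * r ^ m)"
        using r unfolding power_mult[of "sqrt (2 * real m)"] by (simp add: abs_mult mult_ac)
    qed
    show "(\<Sum>m. complex_of_real (a k m) * of_real (exp (- 2 * pi / t)) ^ m) =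
       (\<i> * of_real t) ^ (12 + 2 * k) * (\<Sum>m. complex_of_real (a k m) * of_real (exp (- 2 * pi * t)) ^ m)" if t: "t > 0" for t
    proof -
      have s: "(\<Sum>m. complex_of_real (a k m) * of_real (exp (- 2 * pi * s)) ^ m) = of_real (\<delta> (2 * k) s)" if "s > 0" for s
        using sums_of_real[OF \<delta>_sums[OF that, of k], where 'a=complex] by (simp add: sums_iff)
      \<comment> \<open>The factor \<open>\<i> ^ 12\<close> is 1, so the sign
        \<open>(- 1) ^ k\<close> produced by \<open>cos_coeff\<close> is exactly the one required in
        weight \<open>12 + 2 * k\<close>.\<close>
      have "(\<i> * complex_of_real t) ^ (12 + 2 * k) = ((\<i> * complex_of_real t)\<^sup>2) ^ (6 + k)"
        by (simp flip: power_mult)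
      also have "(\<i> * complex_of_real t)\<^sup>2 = of_real ((- 1) * t\<^sup>2)" by (simp add: power_mult_distrib)
      also have "\<dots> ^ (6 + k) = of_real (((- 1) * t\<^sup>2) ^ (6 + k))" by (rule of_real_power[symmetric])
      also have "((- 1) * t\<^sup>2) ^ (6 + k) = (- 1) ^ k * t ^ (12 + 2 * k)"
        unfolding power_mult_distrib power_mult[symmetric] by (simp add: power_add)
      finally have "(\<i> * complex_of_real t) ^ (12 + 2 * k) = of_real ((- 1) ^ k * t ^ (12 + 2 * k))" .
      then show ?thesis using s[of "1 / t"] s[of t] t fe[OF t] by simp
    qed
  qed
  then have "a k m = 0" by (simp only: of_real_eq_0_iff)
  then show ?case by (simp add: a_def)
qed

section \<open>Counting minimal vectors and the slice\<close>

lemma sum_by_values: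
  fixes f :: "'b \<Rightarrow> real"
  assumes "finite A" "finite V" "g ` A \<subseteq> V"
  shows "(\<Sum>a\<in>A. f (g a)) = (\<Sum>v\<in>V. real (card {a \<in> A. g a = v}) * f v)"
proof -
  have "(\<Sum>a\<in>A. f (g a)) = (\<Sum>v\<in>V. \<Sum>a\<in>{a \<in> A. g a = v}. f (g a))"
    by (rule sum.group[OF assms, symmetric])
  also have "\<dots> = (\<Sum>v\<in>V. real (card {a \<in> A. g a = v}) * f v)"
    by (intro sum.cong refl) simp
  finally show ?thesis .
qed

lemma sphere_moment_24_values:
  shows "sphere_moment 24 0 = 1" and "sphere_moment 24 1 = 1/24" and "sphere_moment 24 2 = 1/208"
    and "sphere_moment 24 3 = 5/5824" and "sphere_moment 24 4 = 1/4992"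
  by (simp_all add: sphere_moment_def prod_lessThan_values)

definition leech_slice :: "(real ^ 24) set \<Rightarrow> real ^ 24 \<Rightarrow> (real ^ 24) set" where
  "leech_slice \<Lambda> W = {x \<in> shell \<Lambda> 2. x \<bullet> W = 2}"

context
  fixes \<Lambda> :: "(real ^ 24) set"
  assumes leech: "leech_lattice \<Lambda>"
begin

lemma leech_unimodular: "unimodular_lattice \<Lambda>"
  using leech by (simp add: leech_lattice_def even_unimodular_lattice_def)

lemma leech_min_norm: "x \<in> \<Lambda> \<Longrightarrow> x \<noteq> 0 \<Longrightarrow> x \<bullet> x \<ge> 4"
  using leech by (auto simp: leech_lattice_def)

lemma leech_shell_moments:
  assumes k: "k \<le> 4"
  shows "(\<Sum>x\<in>shell \<Lambda> 2. (x \<bullet> u) ^ (2 * k)) = (sphere_moment 24 k * 4 ^ k * real (card (shell \<Lambda> 2))) * (u \<bullet> u) ^ k"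
proof (cases "u = 0")
  case True
  then show ?thesis by (cases k) (auto simp: sphere_moment_def)
next
  case False
  define v where "v = u /\<^sub>R norm u"
  have v: "norm v = 1" using False by (simp add: v_def)
  have uv: "u = norm u *\<^sub>R v" using False by (simp add: v_def)
  have "(\<Sum>x\<in>shell \<Lambda> 2. (x \<bullet> u) ^ (2 * k)) = (\<Sum>x\<in>shell \<Lambda> 2. norm u ^ (2 * k) * (x \<bullet> v) ^ (2 * k))"
    by (subst uv) (simp add: power_mult_distrib)
  also have "\<dots> = norm u ^ (2 * k) * (sphere_moment 24 k * 4 ^ k * real (card (shell \<Lambda> 2)))"
    unfolding sum_distrib_left[symmetric] leech_shell_design[OF leech v k] by simp
  also have "norm u ^ (2 * k) = (u \<bullet> u) ^ k" by (simp add: power_mult power2_norm_eq_inner)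
  finally show ?thesis by simp
qed

text \<open>The even moments hold for every vector, in particular for
  \<open>p + s *\<^sub>R q\<close> with varying \<open>s\<close>, so \<open>polarization\<close>
  applies.\<close>

lemma leech_mixed_moments:
  assumes m: "m \<le> 4" and j: "j \<le> 2 * m"
  shows "real (2 * m choose j) * (\<Sum>x\<in>shell \<Lambda> 2. (x \<bullet> p) ^ (2 * m - j) * (x \<bullet> q) ^ j)
     = (sphere_moment 24 m * 4 ^ m * real (card (shell \<Lambda> 2))) * coeff ([:p \<bullet> p, 2 * (p \<bullet> q), q \<bullet> q:] ^ m) j"
proof (rule polarization[OF _ j])
  fix s :: real
  have "(\<Sum>j\<le>2*m. real (2*m choose j) * (\<Sum>x\<in>shell \<Lambda> 2. (x \<bullet> p) ^ (2*m - j) * (x \<bullet> q) ^ j) * s ^ j)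
      = (\<Sum>x\<in>shell \<Lambda> 2. \<Sum>j\<le>2*m. real (2*m choose j) * s ^ j * ((x \<bullet> p) ^ (2*m - j) * (x \<bullet> q) ^ j))"
    unfolding sum_distrib_left sum_distrib_right by (subst sum.swap) (simp add: mult_ac)
  also have "\<dots> = (\<Sum>x\<in>shell \<Lambda> 2. (s * (x \<bullet> q) + x \<bullet> p) ^ (2*m))"
    by (subst binomial_ring) (simp add: power_mult_distrib mult_ac)
  also have "\<dots> = (\<Sum>x\<in>shell \<Lambda> 2. (x \<bullet> (p + s *\<^sub>R q)) ^ (2*m))" by (simp add: inner_add_right add.commute)
  also have "\<dots> = (sphere_moment 24 m * 4 ^ m * real (card (shell \<Lambda> 2))) * ((p + s *\<^sub>R q) \<bullet> (p + s *\<^sub>R q)) ^ m"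
    by (rule leech_shell_moments[OF m])
  also have "(p + s *\<^sub>R q) \<bullet> (p + s *\<^sub>R q) = p \<bullet> p + 2 * (p \<bullet> q) * s + (q \<bullet> q) * s\<^sup>2"
    by (simp add: inner_add_left inner_add_right inner_commute power2_eq_square algebra_simps)
  finally show "(\<Sum>j\<le>2*m. real (2*m choose j) * (\<Sum>x\<in>shell \<Lambda> 2. (x \<bullet> p) ^ (2*m - j) * (x \<bullet> q) ^ j) * s ^ j)
      = (sphere_moment 24 m * 4 ^ m * real (card (shell \<Lambda> 2))) * (p \<bullet> p + 2 * (p \<bullet> q) * s + (q \<bullet> q) * s\<^sup>2) ^ m" .
qed

lemma leech_shell_odd:
  assumes "odd (i + j)"
  shows "(\<Sum>x\<in>shell \<Lambda> 2. (x \<bullet> p) ^ i * (x \<bullet> q) ^ j) = 0"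
proof -
  have bij: "bij_betw uminus (shell \<Lambda> 2) (shell \<Lambda> 2)"
    by (rule bij_betwI[where g=uminus]) (auto simp: shell_def intro: lattice_uminus[OF leech_unimodular])
  have "(\<Sum>x\<in>shell \<Lambda> 2. (x \<bullet> p) ^ i * (x \<bullet> q) ^ j) = (\<Sum>x\<in>shell \<Lambda> 2. ((- x) \<bullet> p) ^ i * ((- x) \<bullet> q) ^ j)"
    by (rule sum.reindex_bij_betw[OF bij, symmetric])
  also have "\<dots> = (\<Sum>x\<in>shell \<Lambda> 2. - ((x \<bullet> p) ^ i * (x \<bullet> q) ^ j))"
    using assms by (intro sum.cong refl) (cases "even i", auto)
  finally show ?thesis by (simp add: sum_negf)
qed

text \<open>\<open>P t\<close> is \<open>t^2 (t^2 - 1) (t^2 - 4)\<close> and vanishes at the inner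
  products -2 to 2 of a minimal vector \<open>v\<close> with the others. Only \<open>v\<close> and
  \<open>- v\<close> contribute, with \<open>P 4 = 2880\<close> each, while the design moments give
  8/273 times the cardinality.\<close>

lemma card_leech_shell: "card (shell \<Lambda> 2) = 196560"
proof -
  obtain v where v: "v \<in> \<Lambda>" "v \<bullet> v = 4" using leech by (auto simp: leech_lattice_def)
  define S where "S = shell \<Lambda> 2"
  have fin: "finite S" unfolding S_def by (rule finite_shell[OF leech_unimodular])
  define P where "P t = t ^ 6 - 5 * t ^ 4 + 4 * t ^ 2" for t :: real
  have vS: "v \<in> S" "- v \<in> S" using v lattice_uminus[OF leech_unimodular] by (auto simp: S_def shell_def)
  have nz: "v \<noteq> - v" using v by (metis inner_minus_right inner_zero_left minus_equation_iff neg_equal_zero zero_neq_numeral real_vector.scale_minus_right)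
  have P0: "P (x \<bullet> v) = 0" if x: "x \<in> S" "x \<noteq> v" "x \<noteq> - v" for x
  proof -
    have xL: "x \<in> \<Lambda>" "x \<bullet> x = 4" using x by (auto simp: S_def shell_def)
    have "(x - v) \<bullet> (x - v) \<ge> 4" "(x + v) \<bullet> (x + v) \<ge> 4"
      using x xL v by (auto intro!: leech_min_norm lattice_diff lattice_add leech_unimodular simp: add_eq_0_iff2)
    then have le: "x \<bullet> v \<le> 2" "x \<bullet> v \<ge> -2"
      using xL v by (simp_all add: inner_diff_left inner_diff_right inner_add_left inner_add_right inner_commute)
    obtain k :: int where k: "x \<bullet> v = of_int k" using lattice_inner_Ints[OF leech_unimodular xL(1) v(1)] by (auto elim: Ints_cases)
    then have "k \<le> 2" "k \<ge> -2" using le by linarith+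
    then have "k = -2 \<or> k = -1 \<or> k = 0 \<or> k = 1 \<or> k = 2" by arith
    then show ?thesis unfolding k P_def by auto
  qed
  have "(\<Sum>x\<in>S. P (x \<bullet> v)) = (\<Sum>x\<in>{v, - v}. P (x \<bullet> v))"
    by (rule sum.mono_neutral_right[OF fin]) (use vS P0 in auto)
  also have "\<dots> = 5760" using nz v by (simp add: P_def)
  finally have s1: "(\<Sum>x\<in>S. P (x \<bullet> v)) = 5760" .
  have "(\<Sum>x\<in>S. P (x \<bullet> v)) = (\<Sum>x\<in>S. (x \<bullet> v) ^ (2 * 3)) - 5 * (\<Sum>x\<in>S. (x \<bullet> v) ^ (2 * 2)) + 4 * (\<Sum>x\<in>S. (x \<bullet> v) ^ (2 * 1))"
    by (simp add: P_def sum.distrib sum_subtractf sum_distrib_left)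
  also have "\<dots> = (8 / 273) * real (card S)"
    unfolding S_def by (subst (1 2 3) leech_shell_moments) (simp_all add: sphere_moment_24_values[unfolded One_nat_def] v field_simps)
  finally have "real (card S) = 196560" using s1 by simp
  then show ?thesis by (simp add: S_def)
qed

text \<open>The polynomial is \<open>t (t + 2) (t^2 - 1) (t^2 - 9)\<close>. Minimality of
  \<open>x - W\<close> and \<open>x + W\<close> confines \<open>x \<bullet> W\<close> to the
  integers from -3 to 3, and there it vanishes except at 2, where it is -120: divided by -120 it is
  the indicator of the slice.\<close>

lemma leech_slice_sum:
  assumes W: "W \<in> \<Lambda>" "W \<bullet> W = 6"
  shows "(\<Sum>x\<in>leech_slice \<Lambda> W. f x) =
    (\<Sum>x\<in>shell \<Lambda> 2. ((x \<bullet> W) ^ 6 + 2 * (x \<bullet> W) ^ 5 - 10 * (x \<bullet> W) ^ 4 - 20 * (x \<bullet> W) ^ 3 + 9 * (x \<bullet> W) ^ 2 + 18 * (x \<bullet> W)) * f x) / (-120)"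
proof -
  define Q where "Q t = t ^ 6 + 2 * t ^ 5 - 10 * t ^ 4 - 20 * t ^ 3 + 9 * t ^ 2 + 18 * t" for t :: real
  have Q: "Q (x \<bullet> W) = (if x \<bullet> W = 2 then -120 else 0)" if x: "x \<in> shell \<Lambda> 2" for x
  proof -
    have xL: "x \<in> \<Lambda>" "x \<bullet> x = 4" using x by (auto simp: shell_def)
    have "x \<noteq> W" "x \<noteq> - W" using xL W by auto
    then have "(x - W) \<bullet> (x - W) \<ge> 4" "(x + W) \<bullet> (x + W) \<ge> 4"
      using xL W by (auto intro!: leech_min_norm lattice_diff lattice_add leech_unimodular simp: add_eq_0_iff2)
    then have le: "x \<bullet> W \<le> 3" "x \<bullet> W \<ge> -3"
      using xL W by (simp_all add: inner_diff_left inner_diff_right inner_add_left inner_add_right inner_commute)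
    obtain k :: int where k: "x \<bullet> W = of_int k" using lattice_inner_Ints[OF leech_unimodular xL(1) W(1)] by (auto elim: Ints_cases)
    then have "k \<le> 3" "k \<ge> -3" using le by linarith+
    then have "k = -3 \<or> k = -2 \<or> k = -1 \<or> k = 0 \<or> k = 1 \<or> k = 2 \<or> k = 3" by arith
    then show ?thesis unfolding k Q_def by auto
  qed
  have "(\<Sum>x\<in>shell \<Lambda> 2. Q (x \<bullet> W) * f x) = (\<Sum>x\<in>leech_slice \<Lambda> W. -120 * f x)"
    by (rule sum.mono_neutral_cong_right[OF finite_shell[OF leech_unimodular]]) (auto simp: leech_slice_def Q Q_def[of 2])
  also have "\<dots> = -120 * (\<Sum>x\<in>leech_slice \<Lambda> W. f x)" by (simp add: sum_distrib_left)
  finally show ?thesis by (simp add: Q_def)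
qed

lemma card_leech_slice:
  assumes W: "W \<in> \<Lambda>" "W \<bullet> W = 6"
  shows "card (leech_slice \<Lambda> W) = 11178"
proof -
  have m: "(\<Sum>x\<in>shell \<Lambda> 2. (x \<bullet> W) ^ 6) = 2332800" "(\<Sum>x\<in>shell \<Lambda> 2. (x \<bullet> W) ^ 4) = 544320"
    "(\<Sum>x\<in>shell \<Lambda> 2. (x \<bullet> W) ^ 2) = 196560"
    using leech_shell_moments[of 3 W] leech_shell_moments[of 2 W] leech_shell_moments[of 1 W]
    by (simp_all add: sphere_moment_24_values[unfolded One_nat_def] card_leech_shell W)
  have o: "(\<Sum>x\<in>shell \<Lambda> 2. (x \<bullet> W) ^ 5) = 0" "(\<Sum>x\<in>shell \<Lambda> 2. (x \<bullet> W) ^ 3) = 0" "(\<Sum>x\<in>shell \<Lambda> 2. (x \<bullet> W)) = 0"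
    using leech_shell_odd[of 5 0 W] leech_shell_odd[of 3 0 W] leech_shell_odd[of 1 0 W] by simp_all
  have "real (card (leech_slice \<Lambda> W)) = (\<Sum>x\<in>leech_slice \<Lambda> W. 1)" by simp
  also have "\<dots> = 11178"
    unfolding leech_slice_sum[OF W] by (simp add: sum.distrib sum_subtractf m o flip: sum_distrib_left)
  finally show ?thesis by simp
qed

text \<open>The indicator polynomial of degree 6 times a power up to 3 has degree at most 9. Odd
  total degrees vanish, and the even ones, at most 8, are within reach of the design
  property.\<close>

lemma leech_slice_moments:
  assumes W: "W \<in> \<Lambda>" "W \<bullet> W = 6" and y: "y \<in> leech_slice \<Lambda> W"
  shows "(\<Sum>x\<in>leech_slice \<Lambda> W. x \<bullet> y) = 7452" and "(\<Sum>x\<in>leech_slice \<Lambda> W. (x \<bullet> y) ^ 2) = 10368"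
    and "(\<Sum>x\<in>leech_slice \<Lambda> W. (x \<bullet> y) ^ 3) = 14112"
proof -
  have y: "W \<bullet> y = 2" "y \<bullet> y = 4" using y by (auto simp: leech_slice_def shell_def inner_commute)
  define M where "M i j = (\<Sum>x\<in>shell \<Lambda> 2. (x \<bullet> W) ^ i * (x \<bullet> y) ^ j)" for i j
  \<comment> \<open>The entries are \<open>W \<bullet> W\<close>, \<open>2 * (W \<bullet> y)\<close>
    and \<open>y \<bullet> y\<close>.\<close>
  have p2: "[:6, 4, 4:] ^ 2 = [:36, 48, 64, 32, 16::real:]" by (simp add: power2_eq_square)
  have p3: "[:6, 4, 4:] ^ 3 = [:216, 432, 720, 640, 480, 192, 64::real:]"
    using power_Suc[of "[:6, 4, 4::real:]" 2] p2 by (simp add: eval_nat_numeral)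
  have p4: "[:6, 4, 4:] ^ 4 = [:1296, 3456, 6912, 8448, 8320, 5632, 3072, 1024, 256::real:]"
    using power_Suc[of "[:6, 4, 4::real:]" 3] p3 by (simp add: eval_nat_numeral)
  note ev = W y M_def card_leech_shell sphere_moment_24_values[unfolded One_nat_def] p2 p3 p4 coeff_pCons_numeral choose_values
  have M1: "M 5 1 = 777600" "M 3 1 = 181440" "M 1 1 = 65520"
    using leech_mixed_moments[of 3 1 W y] leech_mixed_moments[of 2 1 W y] leech_mixed_moments[of 1 1 W y]
    by (simp_all add: ev)
  have M2: "M 6 2 = 2488320" "M 4 2 = 518400" "M 2 2 = 161280"
    using leech_mixed_moments[of 4 2 W y] leech_mixed_moments[of 3 2 W y] leech_mixed_moments[of 2 2 W y]
    by (simp_all add: ev)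
  have M3: "M 5 3 = 1520640" "M 3 3 = 345600" "M 1 3 = 120960"
    using leech_mixed_moments[of 4 3 W y] leech_mixed_moments[of 3 3 W y] leech_mixed_moments[of 2 3 W y]
    by (simp_all add: ev)
  have M0: "M i j = 0" if "odd (i + j)" for i j unfolding M_def by (rule leech_shell_odd[OF that])
  have gen: "(\<Sum>x\<in>leech_slice \<Lambda> W. (x \<bullet> y) ^ j) = (M 6 j + 2 * M 5 j - 10 * M 4 j - 20 * M 3 j + 9 * M 2 j + 18 * M 1 j) / (-120)" for j
    unfolding leech_slice_sum[OF W] M_def
    by (simp add: sum.distrib sum_subtractf sum_distrib_left algebra_simps)
  show "(\<Sum>x\<in>leech_slice \<Lambda> W. x \<bullet> y) = 7452" using gen[of 1] M1 M0[of 6 1] M0[of 4 1] M0[of 2 1] by simp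
  show "(\<Sum>x\<in>leech_slice \<Lambda> W. (x \<bullet> y) ^ 2) = 10368" using gen[of 2] M2 M0[of 5 2] M0[of 3 2] M0[of 1 2] by simp
  show "(\<Sum>x\<in>leech_slice \<Lambda> W. (x \<bullet> y) ^ 3) = 14112" using gen[of 3] M3 M0[of 6 3] M0[of 4 3] M0[of 2 3] by simp
qed

text \<open>Minimality of \<open>x - y\<close> bounds the inner product above. Below, the lattice
  vector \<open>x + y - W\<close> has squared length \<open>6 + 2 * (x \<bullet> y)\<close>, to be
  at least 4; it cannot be zero, since that would demand both \<open>x \<bullet> y = -3\<close> and,
  by pairing with \<open>x\<close>, \<open>x \<bullet> y = -2\<close>.\<close>

lemma leech_slice_inner:
  assumes W: "W \<in> \<Lambda>" "W \<bullet> W = 6" and xy: "x \<in> leech_slice \<Lambda> W" "y \<in> leech_slice \<Lambda> W" "x \<noteq> y"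
  shows "x \<bullet> y \<in> {-1, 0, 1, 2}"
proof -
  have x: "x \<in> \<Lambda>" "x \<bullet> x = 4" "x \<bullet> W = 2" and y: "y \<in> \<Lambda>" "y \<bullet> y = 4" "y \<bullet> W = 2"
    using xy by (auto simp: leech_slice_def shell_def)
  have "(x - y) \<bullet> (x - y) \<ge> 4"
    using xy(3) x y by (auto intro!: leech_min_norm lattice_diff leech_unimodular)
  then have le: "x \<bullet> y \<le> 2" using x y by (simp add: inner_diff_left inner_diff_right inner_commute)
  have ne: "x + y - W \<noteq> 0 \<or> x \<bullet> y = -2"
  proof (rule disjCI)
    assume "x \<bullet> y \<noteq> - 2"
    show "x + y - W \<noteq> 0"
    proof
      assume "x + y - W = 0"
      then have "x \<bullet> (x + y) = x \<bullet> W" by simp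
      then show False using x \<open>x \<bullet> y \<noteq> - 2\<close> by (simp add: inner_add_right)
    qed
  qed
  have n: "(x + y - W) \<bullet> (x + y - W) = 6 + 2 * (x \<bullet> y)"
    using x y W by (simp add: inner_diff_left inner_diff_right inner_add_left inner_add_right inner_commute)
  have "x \<bullet> y \<ge> -1"
  proof (cases "x + y - W = 0")
    case True
    then show ?thesis using ne n by simp
  next
    case False
    then have "(x + y - W) \<bullet> (x + y - W) \<ge> 4"
      using x y W by (intro leech_min_norm lattice_diff lattice_add leech_unimodular)
    then show ?thesis using n by simp
  qed
  moreover obtain k :: int where k: "x \<bullet> y = of_int k" using lattice_inner_Ints[OF leech_unimodular x(1) y(1)] by (auto elim: Ints_cases)
  ultimately have "k \<ge> -1" "k \<le> 2" using le by linarith+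
  then have "k = -1 \<or> k = 0 \<or> k = 1 \<or> k = 2" by arith
  then show ?thesis unfolding k by auto
qed

text \<open>Four unknown counts and the moments of order 0 to 3: a Vandermonde system at -1, 0, 1,
  2, once the term of \<open>y\<close> itself, \<open>4 ^ j\<close>, has been split off.\<close>

lemma leech_slice_distribution:
  assumes W: "W \<in> \<Lambda>" "W \<bullet> W = 6" and y: "y \<in> leech_slice \<Lambda> W"
  shows "card {x \<in> leech_slice \<Lambda> W - {y}. x \<bullet> y = -1} = 352"
    and "card {x \<in> leech_slice \<Lambda> W - {y}. x \<bullet> y = 0} = 4125"
    and "card {x \<in> leech_slice \<Lambda> W - {y}. x \<bullet> y = 1} = 5600"
    and "card {x \<in> leech_slice \<Lambda> W - {y}. x \<bullet> y = 2} = 1100"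
proof -
  define D where "D = leech_slice \<Lambda> W - {y}"
  define n where "n v = real (card {x \<in> D. x \<bullet> y = v})" for v
  have fin: "finite (leech_slice \<Lambda> W)" unfolding leech_slice_def using finite_shell[OF leech_unimodular] by simp
  have yy: "y \<bullet> y = 4" using y by (simp add: leech_slice_def shell_def)
  have s: "(\<Sum>x\<in>leech_slice \<Lambda> W. (x \<bullet> y) ^ j) = 4 ^ j + (n (-1) * (-1) ^ j + n 0 * 0 ^ j + n 1 * 1 ^ j + n 2 * 2 ^ j)" for j
  proof -
    have "(\<Sum>x\<in>leech_slice \<Lambda> W. (x \<bullet> y) ^ j) = (y \<bullet> y) ^ j + (\<Sum>x\<in>D. (x \<bullet> y) ^ j)"
      unfolding D_def by (rule sum.remove[OF fin y])
    also have "(\<Sum>x\<in>D. (x \<bullet> y) ^ j) = (\<Sum>v\<in>{-1, 0, 1, 2}. n v * v ^ j)"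
      unfolding n_def using leech_slice_inner[OF W _ y] fin
      by (intro sum_by_values[where g="\<lambda>x. x \<bullet> y" and f="\<lambda>v. v ^ j"]) (auto simp: D_def)
    finally show ?thesis using yy by simp
  qed
  have e: "11178 = 1 + (n (-1) + n 0 + n 1 + n 2)" "7452 = 4 + (- n (-1) + n 1 + n 2 * 2)"
    "10368 = 16 + (n (-1) + n 1 + n 2 * 4)" "14112 = 64 + (- n (-1) + n 1 + n 2 * 8)"
    using s[of 0] s[of 1] s[of 2] s[of 3] card_leech_slice[OF W] leech_slice_moments[OF W y] by simp_all
  have "n (-1) = 352" "n 0 = 4125" "n 1 = 5600" "n 2 = 1100" using e by linarith+
  then show "card {x \<in> leech_slice \<Lambda> W - {y}. x \<bullet> y = -1} = 352"
    "card {x \<in> leech_slice \<Lambda> W - {y}. x \<bullet> y = 0} = 4125"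
    "card {x \<in> leech_slice \<Lambda> W - {y}. x \<bullet> y = 1} = 5600"
    "card {x \<in> leech_slice \<Lambda> W - {y}. x \<bullet> y = 2} = 1100"
    by (simp_all add: n_def D_def)
qed

end

section \<open>A Leech lattice\<close>

text \<open>Connects the abstract index type with positions in lists. It preserves the order, so a
  triangular list of rows gives a triangular matrix.\<close>

definition rank_index :: "'n::{finite,linorder} \<Rightarrow> nat" where
  "rank_index i = card {j. j < i}"

lemma rank_index_less: "i < j \<Longrightarrow> rank_index i < rank_index (j :: 'n::{finite,linorder})"
  unfolding rank_index_def by (rule psubset_card_mono) auto

lemma bij_rank_index: "bij_betw rank_index (UNIV :: 'n::{finite,linorder} set) {..<CARD('n)}"
proof -
  have inj: "inj (rank_index :: 'n \<Rightarrow> nat)"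
    by (rule injI) (metis rank_index_less less_irrefl not_less_iff_gr_or_eq)
  have "rank_index i < CARD('n)" for i :: 'n
    unfolding rank_index_def by (rule psubset_card_mono) auto
  then have "range (rank_index :: 'n \<Rightarrow> nat) \<subseteq> {..<CARD('n)}" by auto
  moreover have "card (range (rank_index :: 'n \<Rightarrow> nat)) = CARD('n)" using card_image[OF inj] by simp
  ultimately have "range (rank_index :: 'n \<Rightarrow> nat) = {..<CARD('n)}" by (intro card_subset_eq) auto
  then show ?thesis using inj by (simp add: bij_betw_def)
qed

text \<open>Rows: a lower triangular basis of the lattice in Conway's coordinates, scaled by \<open>\<surd>8\<close>.
  It is built from the extended Golay code with generator matrix \<open>[I | A]\<close>, \<open>A\<close> the bordered
  circulant of the quadratic residues modulo 11.\<close>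

definition leech_rows :: "int list list" where
  "leech_rows =
    [[8, 0, 0, 0, 0, 0, 0, 0, 0, 0, 0, 0, 0, 0, 0, 0, 0, 0, 0, 0, 0, 0, 0, 0],
     [4, 4, 0, 0, 0, 0, 0, 0, 0, 0, 0, 0, 0, 0, 0, 0, 0, 0, 0, 0, 0, 0, 0, 0],
     [4, 0, 4, 0, 0, 0, 0, 0, 0, 0, 0, 0, 0, 0, 0, 0, 0, 0, 0, 0, 0, 0, 0, 0],
     [4, 0, 0, 4, 0, 0, 0, 0, 0, 0, 0, 0, 0, 0, 0, 0, 0, 0, 0, 0, 0, 0, 0, 0],
     [4, 0, 0, 0, 4, 0, 0, 0, 0, 0, 0, 0, 0, 0, 0, 0, 0, 0, 0, 0, 0, 0, 0, 0],
     [4, 0, 0, 0, 0, 4, 0, 0, 0, 0, 0, 0, 0, 0, 0, 0, 0, 0, 0, 0, 0, 0, 0, 0],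
     [4, 0, 0, 0, 0, 0, 4, 0, 0, 0, 0, 0, 0, 0, 0, 0, 0, 0, 0, 0, 0, 0, 0, 0],
     [4, 0, 0, 0, 0, 0, 0, 4, 0, 0, 0, 0, 0, 0, 0, 0, 0, 0, 0, 0, 0, 0, 0, 0],
     [4, 0, 0, 0, 0, 0, 0, 0, 4, 0, 0, 0, 0, 0, 0, 0, 0, 0, 0, 0, 0, 0, 0, 0],
     [4, 0, 0, 0, 0, 0, 0, 0, 0, 4, 0, 0, 0, 0, 0, 0, 0, 0, 0, 0, 0, 0, 0, 0],
     [4, 0, 0, 0, 0, 0, 0, 0, 0, 0, 4, 0, 0, 0, 0, 0, 0, 0, 0, 0, 0, 0, 0, 0],
     [4, 0, 0, 0, 0, 0, 0, 0, 0, 0, 0, 4, 0, 0, 0, 0, 0, 0, 0, 0, 0, 0, 0, 0],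
     [0, 2, 2, 2, 2, 2, 2, 2, 2, 2, 2, 2, 2, 0, 0, 0, 0, 0, 0, 0, 0, 0, 0, 0],
     [2, 2, 0, 2, 0, 0, 0, 2, 2, 2, 0, 2, 0, 2, 0, 0, 0, 0, 0, 0, 0, 0, 0, 0],
     [2, 0, 2, 0, 0, 0, 2, 2, 2, 0, 2, 2, 0, 0, 2, 0, 0, 0, 0, 0, 0, 0, 0, 0],
     [2, 2, 0, 0, 0, 2, 2, 2, 0, 2, 2, 0, 0, 0, 0, 2, 0, 0, 0, 0, 0, 0, 0, 0],
     [2, 0, 0, 0, 2, 2, 2, 0, 2, 2, 0, 2, 0, 0, 0, 0, 2, 0, 0, 0, 0, 0, 0, 0],
     [2, 0, 0, 2, 2, 2, 0, 2, 2, 0, 2, 0, 0, 0, 0, 0, 0, 2, 0, 0, 0, 0, 0, 0],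
     [2, 0, 2, 2, 2, 0, 2, 2, 0, 2, 0, 0, 0, 0, 0, 0, 0, 0, 2, 0, 0, 0, 0, 0],
     [2, 2, 2, 2, 0, 2, 2, 0, 2, 0, 0, 0, 0, 0, 0, 0, 0, 0, 0, 2, 0, 0, 0, 0],
     [2, 2, 2, 0, 2, 2, 0, 2, 0, 0, 0, 2, 0, 0, 0, 0, 0, 0, 0, 0, 2, 0, 0, 0],
     [2, 2, 0, 2, 2, 0, 2, 0, 0, 0, 2, 2, 0, 0, 0, 0, 0, 0, 0, 0, 0, 2, 0, 0],
     [2, 0, 2, 2, 0, 2, 0, 0, 0, 2, 2, 2, 0, 0, 0, 0, 0, 0, 0, 0, 0, 0, 2, 0],
     [5, 1, 1, 1, 1, 1, 1, 1, 1, 1, 1, 1, 1, 1, 1, 1, 1, 1, 1, 1, 1, 1, 1, 1]]"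

text \<open>Column \<open>n\<close> of the generator matrix, which is also a parity check matrix of the self-dual code.\<close>

definition golay_columns :: "bool list list" where
  "golay_columns =
    [[True, False, False, False, False, False, False, False, False, False, False, False],
     [False, True, False, False, False, False, False, False, False, False, False, False],
     [False, False, True, False, False, False, False, False, False, False, False, False],
     [False, False, False, True, False, False, False, False, False, False, False, False],
     [False, False, False, False, True, False, False, False, False, False, False, False],
     [False, False, False, False, False, True, False, False, False, False, False, False],
     [False, False, False, False, False, False, True, False, False, False, False, False],
     [False, False, False, False, False, False, False, True, False, False, False, False],
     [False, False, False, False, False, False, False, False, True, False, False, False],
     [False, False, False, False, False, False, False, False, False, True, False, False],
     [False, False, False, False, False, False, False, False, False, False, True, False],
     [False, False, False, False, False, False, False, False, False, False, False, True],
     [False, True, True, True, True, True, True, True, True, True, True, True],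
     [True, True, False, True, False, False, False, True, True, True, False, True],
     [True, False, True, False, False, False, True, True, True, False, True, True],
     [True, True, False, False, False, True, True, True, False, True, True, False],
     [True, False, False, False, True, True, True, False, True, True, False, True],
     [True, False, False, True, True, True, False, True, True, False, True, False],
     [True, False, True, True, True, False, True, True, False, True, False, False],
     [True, True, True, True, False, True, True, False, True, False, False, False],
     [True, True, True, False, True, True, False, True, False, False, False, True],
     [True, True, False, True, True, False, True, False, False, False, True, True],
     [True, False, True, True, False, True, False, False, False, True, True, True],
     [True, True, True, False, True, False, False, False, True, True, True, False]]"

definition list_inner :: "int list \<Rightarrow> int list \<Rightarrow> int" where
  "list_inner r s = sum_list (map2 times r s)"

text \<open>Conway's congruences for the scaled coordinates. They are linear in the row and so pass
  from the basis to all integer combinations, where \<open>standard_leech_no_roots\<close> uses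
  them. For even coordinates the last one makes the parity pattern of the halves satisfy the parity
  checks of the Golay code.\<close>

definition row_congruences :: "int list \<Rightarrow> bool" where
  "row_congruences r \<longleftrightarrow> (sum_list r - 4 * r ! 0) mod 8 = 0 \<and> list_all (\<lambda>a. (a - r ! 0) mod 2 = 0) r \<and>
     list_all (\<lambda>k. sum_list (map2 (\<lambda>b a. if b ! k then a else 0) golay_columns r) mod 4 = 0) [0..<12]"

lemma leech_rows_congruences: "list_all row_congruences leech_rows"
  by code_simp

text \<open>Since the rows are scaled by sqrt 8, divisibility by 8 and 16 means integral inner
  products and even squared lengths.\<close>

lemma leech_rows_inner:
  "list_all (\<lambda>r. list_inner r r mod 16 = 0 \<and> list_all (\<lambda>s. list_inner r s mod 8 = 0) leech_rows) leech_rows"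
  by code_simp

lemma leech_rows_triangular:
  "list_all (\<lambda>j. list_all (\<lambda>n. leech_rows ! j ! n = 0) [Suc j..<24]) [0..<24]"
  by code_simp

text \<open>\<open>2 ^ 36 = sqrt 8 ^ 24\<close>, so after rescaling the basis has determinant
  1.\<close>

lemma leech_rows_diagonal: "prod_list (map (\<lambda>j. leech_rows ! j ! j) [0..<24]) = 2 ^ 36"
  by code_simp

lemma leech_rows_length: "length leech_rows = 24 \<and> list_all (\<lambda>r. length r = 24) leech_rows"
  by code_simp

lemma golay_columns_length: "length golay_columns = 24 \<and> list_all (\<lambda>r. length r = 12) golay_columns"
  by code_simp

section \<open>Minimum distance of the Golay code\<close>

definition xor_list :: "bool list \<Rightarrow> bool list \<Rightarrow> bool list" where
  "xor_list = map2 (\<noteq>)"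

text \<open>Branches on whether the next column is taken; true iff no choice of between 1 and
  \<open>k\<close> columns adds up with \<open>acc\<close> to the zero word. For the zero word and
  \<open>k = 4\<close> it says that every nonzero codeword has weight above 4.\<close>

fun no_short_relation :: "nat \<Rightarrow> bool list list \<Rightarrow> bool list \<Rightarrow> bool" where
  "no_short_relation 0 S acc = True"
| "no_short_relation (Suc k) [] acc = True"
| "no_short_relation (Suc k) (s # S) acc \<longleftrightarrow> no_short_relation (Suc k) S acc \<and>
     (let a = xor_list acc s in list_ex (\<lambda>b. b) a \<and> no_short_relation k S a)"

lemma golay_no_short_relation: "no_short_relation 4 golay_columns (replicate 12 False)"
  by code_simp

lemma nth_leech_rows: "j < 24 \<Longrightarrow> leech_rows ! j \<in> set leech_rows" "j < 24 \<Longrightarrow> length (leech_rows ! j) = 24"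
  using leech_rows_length by (auto simp: list_all_iff)

lemma leech_row_congruences:
  assumes j: "j < 24"
  shows "8 dvd (\<Sum>n<24. leech_rows ! j ! n) - 4 * leech_rows ! j ! 0"
    and "n < 24 \<Longrightarrow> 2 dvd leech_rows ! j ! n - leech_rows ! j ! 0"
    and "k < 12 \<Longrightarrow> 4 dvd (\<Sum>n<24. if golay_columns ! n ! k then leech_rows ! j ! n else 0)"
proof -
  define r where "r = leech_rows ! j"
  have r: "row_congruences r" "length r = 24"
    using leech_rows_congruences nth_leech_rows[OF j] by (auto simp: list_all_iff r_def)
  have s: "sum_list r = (\<Sum>n<24. r ! n)" using r(2) by (simp add: sum_list_sum_nth atLeast0LessThan)
  show "8 dvd (\<Sum>n<24. leech_rows ! j ! n) - 4 * leech_rows ! j ! 0"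
    using r(1) unfolding row_congruences_def s unfolding r_def by (simp add: dvd_eq_mod_eq_0)
  show "2 dvd leech_rows ! j ! n - leech_rows ! j ! 0" if "n < 24"
    using r that unfolding row_congruences_def r_def[symmetric] list_all_length by (simp add: dvd_eq_mod_eq_0)
  show "4 dvd (\<Sum>n<24. if golay_columns ! n ! k then leech_rows ! j ! n else 0)" if k: "k < 12"
  proof -
    have "sum_list (map2 (\<lambda>b a. if b ! k then a else 0) golay_columns r) mod 4 = 0"
      using r(1) k unfolding row_congruences_def by (simp add: list_all_iff)
    moreover have "sum_list (map2 (\<lambda>b a. if b ! k then a else 0) golay_columns r) = (\<Sum>n<24. if golay_columns ! n ! k then r ! n else 0)"
      using r(2) golay_columns_length by (simp add: sum_list_sum_nth atLeast0LessThan)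
    ultimately have "4 dvd (\<Sum>n<24. if golay_columns ! n ! k then r ! n else 0)" by (simp only: dvd_eq_mod_eq_0)
    then show ?thesis by (simp only: r_def)
  qed
qed

lemma leech_row_products:
  assumes "j < 24" "k < 24"
  shows "8 dvd (\<Sum>n<24. leech_rows ! j ! n * leech_rows ! k ! n)"
    and "16 dvd (\<Sum>n<24. leech_rows ! j ! n * leech_rows ! j ! n)"
proof -
  have s: "list_inner (leech_rows ! a) (leech_rows ! b) = (\<Sum>n<24. leech_rows ! a ! n * leech_rows ! b ! n)" if "a < 24" "b < 24" for a b
    using nth_leech_rows(2)[OF that(1)] nth_leech_rows(2)[OF that(2)]
    by (simp add: list_inner_def sum_list_sum_nth atLeast0LessThan)
  have "list_inner (leech_rows ! j) (leech_rows ! k) mod 8 = 0" "list_inner (leech_rows ! j) (leech_rows ! j) mod 16 = 0"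
    using leech_rows_inner nth_leech_rows(1)[OF assms(1)] nth_leech_rows(1)[OF assms(2)] by (auto simp: list_all_iff)
  then show "8 dvd (\<Sum>n<24. leech_rows ! j ! n * leech_rows ! k ! n)" "16 dvd (\<Sum>n<24. leech_rows ! j ! n * leech_rows ! j ! n)"
    using s assms by (simp_all add: dvd_eq_mod_eq_0)
qed

lemma xor_list_simps:
  assumes "length a = length b"
  shows "length (xor_list a b) = length a" and "k < length a \<Longrightarrow> xor_list a b ! k = (a ! k \<noteq> b ! k)"
  using assms by (simp_all add: xor_list_def)

text \<open>Soundness of the search: the filtered list is one of the branches it has
  explored.\<close>

lemma no_short_relation_foldl:
  assumes "no_short_relation k (map c xs) acc" "filter P xs \<noteq> []" "length (filter P xs) \<le> k"
  shows "list_ex (\<lambda>b. b) (foldl xor_list acc (map c (filter P xs)))"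
  using assms
proof (induction xs arbitrary: k acc)
  case (Cons x xs)
  then obtain k' where k: "k = Suc k'" by (cases k) auto
  show ?case
  proof (cases "P x")
    case True
    show ?thesis
    proof (cases "filter P xs = []")
      case True
      then show ?thesis using Cons.prems \<open>P x\<close> by (simp add: k Let_def)
    next
      case False
      then show ?thesis using Cons.prems Cons.IH[of k' "xor_list acc (c x)"] \<open>P x\<close> by (simp add: k Let_def)
    qed
  next
    case False
    then show ?thesis using Cons.prems Cons.IH[of k acc] by (simp add: k)
  qed
qed simp

lemma nth_foldl_xor_list:
  assumes "\<And>y. y \<in> set ys \<Longrightarrow> length y = length acc" and k: "k < length acc"
  shows "length (foldl xor_list acc ys) = length acc \<and> foldl xor_list acc ys ! k = (acc ! k \<noteq> odd (length (filter (\<lambda>y. y ! k) ys)))"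
  using assms
proof (induction ys arbitrary: acc)
  case (Cons y ys)
  have "length (xor_list acc y) = length acc" using Cons.prems by (simp add: xor_list_simps)
  then show ?case using Cons.prems Cons.IH[of "xor_list acc y"] by (auto simp: xor_list_simps)
qed simp

text \<open>The parity conditions say that the columns at the odd positions of \<open>y\<close> add
  up to zero modulo 2; a nonempty choice of at most 4 columns never does.\<close>

lemma golay_parity_imp_even:
  fixes y :: "nat \<Rightarrow> int"
  assumes par: "\<And>k. k < 12 \<Longrightarrow> even (\<Sum>n<24. if golay_columns ! n ! k then y n else 0)"
    and small: "card {n. n < 24 \<and> odd (y n)} \<le> 4" and n: "n < 24"
  shows "even (y n)"
proof (rule ccontr)
  assume "odd (y n)"
  define xs where "xs = filter (\<lambda>n. odd (y n)) [0..<24]"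
  have len: "length xs \<le> 4"
  proof -
    have "length xs = card {n. n < 24 \<and> odd (y n)}"
      unfolding xs_def by (simp add: length_filter_conv_card) (rule arg_cong[where f=card], auto)
    then show ?thesis using small by simp
  qed
  have "n \<in> set xs" using n \<open>odd (y n)\<close> by (simp add: xs_def)
  then have ne: "xs \<noteq> []" by auto
  have cols: "map ((!) golay_columns) [0..<24] = golay_columns"
    using golay_columns_length by (metis map_nth)
  have l12: "length (golay_columns ! i) = 12" if "i < 24" for i
    using golay_columns_length that by (simp add: list_all_length)
  have "list_ex (\<lambda>b. b) (foldl xor_list (replicate 12 False) (map ((!) golay_columns) xs))"
    unfolding xs_def
    by (rule no_short_relation_foldl[where k=4]) (use golay_no_short_relation cols ne len in \<open>simp_all add: xs_def\<close>)
  then obtain b where "b \<in> set (foldl xor_list (replicate 12 False) (map ((!) golay_columns) xs))" "b"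
    by (auto simp: list_ex_iff)
  moreover have *: "length (foldl xor_list (replicate 12 False) (map ((!) golay_columns) xs)) = 12 \<and>
     (foldl xor_list (replicate 12 False) (map ((!) golay_columns) xs) ! k = odd (length (filter (\<lambda>i. golay_columns ! i ! k) xs)))"
    if "k < 12" for k
    using nth_foldl_xor_list[of "map ((!) golay_columns) xs" "replicate 12 False" k] that l12
    by (auto simp: xs_def filter_map o_def)
  ultimately obtain k where k: "k < 12" "odd (length (filter (\<lambda>i. golay_columns ! i ! k) xs))"
    using *[of 0] unfolding in_set_conv_nth by auto
  have "even (card {i \<in> {..<24}. odd (if golay_columns ! i ! k then y i else 0)})"
    using par[OF k(1)] by (subst (asm) even_sum_iff) auto
  moreover have "length (filter (\<lambda>i. golay_columns ! i ! k) xs) = card {i \<in> {..<24}. odd (if golay_columns ! i ! k then y i else 0)}"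
    unfolding xs_def filter_filter by (simp add: length_filter_conv_card) (rule arg_cong[where f=card], auto split: if_splits)
  ultimately show False using k(2) by simp
qed

section \<open>The lattice generated by the rows\<close>

definition leech_basis :: "nat \<Rightarrow> real ^ 24" where
  "leech_basis j = (\<chi> i. real_of_int (leech_rows ! j ! rank_index i) / sqrt 8)"

lemma sum_rank_index: "(\<Sum>i\<in>(UNIV :: 24 set). f (rank_index i)) = (\<Sum>n<24. f n)"
  using sum.reindex_bij_betw[OF bij_rank_index[where 'n=24], of f] by simp

lemma leech_basis_inner:
  "leech_basis j \<bullet> leech_basis k = real_of_int (\<Sum>n<24. leech_rows ! j ! n * leech_rows ! k ! n) / 8"
proof -
  have "leech_basis j \<bullet> leech_basis k = (\<Sum>i\<in>(UNIV :: 24 set). real_of_int (leech_rows ! j ! rank_index i * leech_rows ! k ! rank_index i) / 8)"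
    by (simp add: leech_basis_def inner_vec_def)
  also have "\<dots> = (\<Sum>n<24. real_of_int (leech_rows ! j ! n * leech_rows ! k ! n) / 8)"
    by (rule sum_rank_index)
  finally show ?thesis by (simp add: sum_divide_distrib)
qed

definition standard_leech :: "(real ^ 24) set" where
  "standard_leech = {\<Sum>j<24. real_of_int (c j) *\<^sub>R leech_basis j | c. True}"

lemma leech_basis_Ints: "j < 24 \<Longrightarrow> k < 24 \<Longrightarrow> leech_basis j \<bullet> leech_basis k \<in> \<int>"
proof -
  assume "j < 24" "k < 24"
  then obtain m where "(\<Sum>n<24. leech_rows ! j ! n * leech_rows ! k ! n) = 8 * m"
    using leech_row_products(1)[of j k] by (auto elim!: dvdE)
  then show ?thesis by (simp add: leech_basis_inner)
qed

lemma leech_basis_even: "j < 24 \<Longrightarrow> \<exists>k::int. leech_basis j \<bullet> leech_basis j = 2 * of_int k"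
proof -
  assume "j < 24"
  then obtain k where "(\<Sum>n<24. leech_rows ! j ! n * leech_rows ! j ! n) = 16 * k"
    using leech_row_products(2)[of j j] by (auto elim!: dvdE)
  then show ?thesis by (intro exI[of _ k]) (simp add: leech_basis_inner)
qed

lemma standard_leech_inner_Ints:
  assumes "x \<in> standard_leech" "y \<in> standard_leech"
  shows "x \<bullet> y \<in> \<int>"
proof -
  obtain c d where "x = (\<Sum>j<24. real_of_int (c j) *\<^sub>R leech_basis j)" "y = (\<Sum>j<24. real_of_int (d j) *\<^sub>R leech_basis j)"
    using assms by (auto simp: standard_leech_def)
  then have "x \<bullet> y = (\<Sum>j<24. \<Sum>k<24. real_of_int (d j) * (real_of_int (c k) * (leech_basis k \<bullet> leech_basis j)))"
    by (simp add: inner_sum_left inner_sum_right sum_distrib_left)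
  then show ?thesis by (auto intro!: Ints_sum Ints_mult leech_basis_Ints)
qed

text \<open>Adding one basis vector at a time changes the squared length by an even square term and
  by twice an integer cross term.\<close>

lemma standard_leech_even:
  assumes "x \<in> standard_leech"
  shows "\<exists>k::int. x \<bullet> x = 2 * of_int k"
proof -
  obtain c where x: "x = (\<Sum>j<24. real_of_int (c j) *\<^sub>R leech_basis j)"
    using assms by (auto simp: standard_leech_def)
  define S where "S m = (\<Sum>j<m. real_of_int (c j) *\<^sub>R leech_basis j)" for m
  have "\<exists>k::int. S m \<bullet> S m = 2 * of_int k" if "m \<le> 24" for m
    using that
  proof (induction m)
    case 0
    then show ?case by (auto simp: S_def intro!: exI[of _ 0])
  next
    case (Suc m)
    obtain k :: int where k: "S m \<bullet> S m = 2 * of_int k" using Suc by auto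
    obtain k' :: int where k': "leech_basis m \<bullet> leech_basis m = 2 * of_int k'" using leech_basis_even[of m] Suc.prems by auto
    have "S m \<bullet> leech_basis m \<in> \<int>"
      using Suc.prems by (auto simp: S_def inner_sum_left intro!: Ints_sum Ints_mult leech_basis_Ints)
    then obtain l :: int where l: "S m \<bullet> leech_basis m = of_int l" by (auto elim: Ints_cases)
    have "S (Suc m) = S m + real_of_int (c m) *\<^sub>R leech_basis m" by (simp add: S_def)
    then have "S (Suc m) \<bullet> S (Suc m) = 2 * of_int (k + c m * l + c m * c m * k')"
      using k k' l by (simp add: inner_add_left inner_add_right inner_commute algebra_simps)
    then show ?case by blast
  qed
  then show ?thesis unfolding x S_def[symmetric] by simp
qed

text \<open>With the rows of the list as columns the basis matrix is upper triangular, so its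
  determinant is the product of the diagonal.\<close>

lemma standard_leech_unimodular: "unimodular_lattice standard_leech"
  unfolding unimodular_lattice_def
proof (intro conjI ballI)
  define B :: "real ^ 24 ^ 24" where "B = (\<chi> i j. real_of_int (leech_rows ! rank_index j ! rank_index i) / sqrt 8)"
  have rl: "rank_index (i :: 24) < 24" for i using bij_rank_index[where 'n=24] by (auto simp: bij_betw_def)
  have "det B = (\<Prod>i\<in>UNIV. B $ i $ i)"
  proof (rule det_upperdiagonal)
    fix i j :: 24 assume "j < i"
    then have "rank_index j < rank_index i" by (rule rank_index_less)
    then have "leech_rows ! rank_index j ! rank_index i = 0"
      using leech_rows_triangular rl[of i] rl[of j] by (auto simp: list_all_iff)
    then show "B $ i $ j = 0" by (simp add: B_def)
  qed
  also have "\<dots> = (\<Prod>n<24. real_of_int (leech_rows ! n ! n) / sqrt 8)"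
    using prod.reindex_bij_betw[OF bij_rank_index[where 'n=24], of "\<lambda>n. real_of_int (leech_rows ! n ! n) / sqrt 8"]
    by (simp add: B_def)
  also have "\<dots> = real_of_int (\<Prod>n<24. leech_rows ! n ! n) / sqrt 8 ^ 24" by (simp add: prod_dividef)
  also have "(\<Prod>n<24. leech_rows ! n ! n) = 2 ^ 36"
    using leech_rows_diagonal prod.distinct_set_conv_list[of "[0..<24]" "\<lambda>n. leech_rows ! n ! n"]
    by (simp add: atLeast0LessThan del: upt_rec_numeral)
  also have "sqrt 8 ^ 24 = (8 :: real) ^ 12"
    using power_mult[of "sqrt 8" 2 12] by simp
  finally have "\<bar>det B\<bar> = 1" by simp
  moreover have "standard_leech = {B *v z | z. \<forall>i. z $ i \<in> \<int>}"
  proof -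
    have Bz: "B *v z = (\<Sum>j\<in>UNIV. (z $ j) *\<^sub>R leech_basis (rank_index j))" for z
      by (simp add: vec_eq_iff matrix_vector_mult_def B_def leech_basis_def mult.commute)
    have conv: "(\<Sum>j\<in>(UNIV :: 24 set). real_of_int (c (rank_index j)) *\<^sub>R leech_basis (rank_index j)) = (\<Sum>j<24. real_of_int (c j) *\<^sub>R leech_basis j)" for c
      using sum.reindex_bij_betw[OF bij_rank_index[where 'n=24], of "\<lambda>j. real_of_int (c j) *\<^sub>R leech_basis j"] by simp
    show ?thesis
    proof (intro set_eqI iffI)
      fix x assume "x \<in> standard_leech"
      then obtain c where c: "x = (\<Sum>j<24. real_of_int (c j) *\<^sub>R leech_basis j)" by (auto simp: standard_leech_def)
      define z :: "real ^ 24" where "z = (\<chi> j. real_of_int (c (rank_index j)))"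
      have "x = B *v z" unfolding Bz c conv[symmetric] by (simp add: z_def)
      then show "x \<in> {B *v z | z. \<forall>i. z $ i \<in> \<int>}" by (auto simp: z_def)
    next
      fix x assume "x \<in> {B *v z | z. \<forall>i. z $ i \<in> \<int>}"
      then obtain z where z: "x = B *v z" "\<And>i. z $ i \<in> \<int>" by auto
      define c where "c n = \<lfloor>z $ (inv_into UNIV rank_index n)\<rfloor>" for n
      have "real_of_int (c (rank_index j)) = z $ j" for j
        using z(2)[of j] bij_rank_index[where 'n=24] by (auto simp: c_def bij_betw_def inv_into_f_f elim!: Ints_cases)
      then have "x = (\<Sum>j<24. real_of_int (c j) *\<^sub>R leech_basis j)" unfolding z(1) Bz conv[symmetric] by simp
      then show "x \<in> standard_leech" by (auto simp: standard_leech_def)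
    qed
  qed
  ultimately show "\<exists>B :: real ^ 24 ^ 24. \<bar>det B\<bar> = 1 \<and> standard_leech = {B *v z | z. \<forall>i. z $ i \<in> \<int>}" by blast
qed (rule standard_leech_inner_Ints)

text \<open>The scaled coordinates \<open>X\<close> would have squares summing to 16. If they are
  odd, 24 odd squares already exceed this. If they are even, the squares of the halves
  \<open>y\<close> sum to 4, so at most 4 of the \<open>y\<close> are odd, and the Golay parity
  checks leave none. A further halving gives squares summing to 1, while the congruence modulo 8
  makes the sum of the \<open>z\<close>, hence also of their squares, even.\<close>

lemma standard_leech_no_roots:
  assumes "x \<in> standard_leech"
  shows "x \<bullet> x \<noteq> 2"
proof
  assume norm2: "x \<bullet> x = 2"
  obtain c where x: "x = (\<Sum>j<24. real_of_int (c j) *\<^sub>R leech_basis j)"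
    using assms by (auto simp: standard_leech_def)
  define X where "X n = (\<Sum>j<24. c j * leech_rows ! j ! n)" for n
  have "x $ i = real_of_int (X (rank_index i)) / sqrt 8" for i
    by (simp add: x leech_basis_def X_def sum_divide_distrib)
  then have "x \<bullet> x = (\<Sum>i\<in>(UNIV :: 24 set). real_of_int ((X (rank_index i))\<^sup>2) / 8)"
    by (simp add: inner_vec_def power2_eq_square)
  also have "\<dots> = (\<Sum>n<24. real_of_int ((X n)\<^sup>2) / 8)" by (rule sum_rank_index)
  also have "\<dots> = real_of_int (\<Sum>n<24. (X n)\<^sup>2) / 8" by (simp add: sum_divide_distrib)
  finally have "real_of_int (\<Sum>n<24. (X n)\<^sup>2) = real_of_int 16" using norm2 by simp
  then have norm16: "(\<Sum>n<24. (X n)\<^sup>2) = 16" by (simp only: of_int_eq_iff)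
  have lin: "(\<Sum>n<24. if P n then X n else 0) = (\<Sum>j<24. c j * (\<Sum>n<24. if P n then leech_rows ! j ! n else 0))" for P
  proof -
    have "(\<Sum>n<24. if P n then X n else 0) = (\<Sum>n<24. \<Sum>j<24. c j * (if P n then leech_rows ! j ! n else 0))"
      by (intro sum.cong refl) (simp add: X_def)
    also have "\<dots> = (\<Sum>j<24. c j * (\<Sum>n<24. if P n then leech_rows ! j ! n else 0))"
      unfolding sum_distrib_left by (rule sum.swap)
    finally show ?thesis .
  qed
  have c1: "8 dvd (\<Sum>n<24. X n) - 4 * X 0"
  proof -
    have "(\<Sum>n<24. X n) - 4 * X 0 = (\<Sum>j<24. c j * ((\<Sum>n<24. leech_rows ! j ! n) - 4 * leech_rows ! j ! 0))"
      using lin[of "\<lambda>_. True"] by (simp add: X_def right_diff_distrib sum_subtractf sum_distrib_left mult.left_commute)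
    also have "8 dvd \<dots>" by (intro dvd_sum dvd_mult leech_row_congruences(1)) auto
    finally show ?thesis .
  qed
  have c2: "2 dvd X n - X 0" if "n < 24" for n
  proof -
    have "X n - X 0 = (\<Sum>j<24. c j * (leech_rows ! j ! n - leech_rows ! j ! 0))"
      by (simp add: X_def right_diff_distrib sum_subtractf)
    also have "2 dvd \<dots>" by (intro dvd_sum dvd_mult leech_row_congruences(2)) (use that in auto)
    finally show ?thesis .
  qed
  have c3: "4 dvd (\<Sum>n<24. if golay_columns ! n ! k then X n else 0)" if "k < 12" for k
    unfolding lin by (intro dvd_sum dvd_mult leech_row_congruences(3)) (use that in auto)
  show False
  proof (cases "odd (X 0)")
    case True
    then have "odd (X n)" if "n < 24" for n using c2[OF that] by (auto simp: dvd_diff_commute elim!: dvdE)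
    then have "(X n)\<^sup>2 \<ge> 1" if "n < 24" for n
      using that by (metis even_zero int_one_le_iff_zero_less zero_less_power2)
    then have "(\<Sum>n<(24::nat). (1::int)) \<le> (\<Sum>n<24. (X n)\<^sup>2)" by (intro sum_mono) auto
    then show False using norm16 by simp
  next
    case False
    have ev: "even (X n)" if "n < 24" for n using c2[OF that] False by (simp add: even_diff_iff)
    define y where "y n = X n div 2" for n
    have Xy: "X n = 2 * y n" if "n < 24" for n using ev[OF that] by (simp add: y_def)
    have "(\<Sum>n<24. (X n)\<^sup>2) = 4 * (\<Sum>n<24. (y n)\<^sup>2)"
      unfolding sum_distrib_left by (intro sum.cong refl) (simp add: Xy)
    then have norm4: "(\<Sum>n<24. (y n)\<^sup>2) = 4" using norm16 by simp
    have "(\<Sum>n<24. X n) = 2 * (\<Sum>n<24. y n)"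
      unfolding sum_distrib_left by (intro sum.cong refl) (simp add: Xy)
    moreover have "X 0 = 2 * y 0" by (rule Xy) simp
    \<comment> \<open>With \<open>X 0 = 2 * y 0\<close> the correction term \<open>4 * X 0\<close>
      is itself a multiple of 8 and drops out.\<close>
    ultimately have "8 dvd 2 * (\<Sum>n<24. y n) - 8 * y 0" using c1 by simp
    then have sy: "4 dvd (\<Sum>n<24. y n)" by presburger
    have py: "even (\<Sum>n<24. if golay_columns ! n ! k then y n else 0)" if "k < 12" for k
    proof -
      have "(\<Sum>n<24. if golay_columns ! n ! k then X n else 0) = 2 * (\<Sum>n<24. if golay_columns ! n ! k then y n else 0)"
        unfolding sum_distrib_left by (intro sum.cong refl) (simp add: Xy)
      then show ?thesis using c3[OF that] by presburger
    qed
    have "card {n. n < 24 \<and> odd (y n)} \<le> 4"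
    proof -
      have "int (card {n. n < 24 \<and> odd (y n)}) = (\<Sum>n\<in>{n. n < 24 \<and> odd (y n)}. 1)" by simp
      also have "\<dots> \<le> (\<Sum>n\<in>{n. n < 24 \<and> odd (y n)}. (y n)\<^sup>2)"
        by (intro sum_mono) (metis even_zero int_one_le_iff_zero_less mem_Collect_eq zero_less_power2)
      also have "\<dots> \<le> (\<Sum>n<24. (y n)\<^sup>2)" by (intro sum_mono2) auto
      finally show ?thesis using norm4 by simp
    qed
    then have evy: "even (y n)" if "n < 24" for n using golay_parity_imp_even[OF py _ that] by blast
    define z where "z n = y n div 2" for n
    have yz: "y n = 2 * z n" if "n < 24" for n using evy[OF that] by (simp add: z_def)
    have "(\<Sum>n<24. (y n)\<^sup>2) = 4 * (\<Sum>n<24. (z n)\<^sup>2)"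
      unfolding sum_distrib_left by (intro sum.cong refl) (simp add: yz)
    then have norm1: "(\<Sum>n<24. (z n)\<^sup>2) = 1" using norm4 by simp
    have "(\<Sum>n<24. y n) = 2 * (\<Sum>n<24. z n)"
      unfolding sum_distrib_left by (intro sum.cong refl) (simp add: yz)
    then have "even (\<Sum>n<24. z n)" using sy by presburger
    moreover have "even (\<Sum>n<24. (z n)\<^sup>2 - z n)" by (intro dvd_sum) simp
    ultimately have "even (\<Sum>n<24. (z n)\<^sup>2)" by (simp add: sum_subtractf)
    then show False using norm1 by simp
  qed
qed

lemma leech_basis_in: "j < 24 \<Longrightarrow> leech_basis j \<in> standard_leech"
proof -
  assume j: "j < 24"
  have "(\<Sum>i<24. real_of_int (if i = j then 1 else 0) *\<^sub>R leech_basis i) = (\<Sum>i<24. if i = j then leech_basis i else 0)"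
    by (intro sum.cong) auto
  also have "\<dots> = leech_basis j" using j by simp
  finally show ?thesis unfolding standard_leech_def by (auto intro!: exI[of _ "\<lambda>i. if i = j then 1 else 0"])
qed

lemma leech_rows_norms:
  "list_inner (leech_rows ! 1) (leech_rows ! 1) = 32 \<and> list_inner (leech_rows ! 23) (leech_rows ! 23) = 48"
  by code_simp

lemma leech_basis_norms:
  shows "leech_basis 1 \<bullet> leech_basis 1 = 4" and "leech_basis 23 \<bullet> leech_basis 23 = 6"
proof -
  have "list_inner (leech_rows ! a) (leech_rows ! a) = (\<Sum>n<24. leech_rows ! a ! n * leech_rows ! a ! n)" if "a < 24" for a
    using nth_leech_rows(2)[OF that] by (simp add: list_inner_def sum_list_sum_nth atLeast0LessThan)
  from this[of 1] this[of 23] leech_rows_norms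
  show "leech_basis 1 \<bullet> leech_basis 1 = 4" "leech_basis 23 \<bullet> leech_basis 23 = 6" by (simp_all add: leech_basis_inner)
qed

theorem leech_lattice_standard: "leech_lattice standard_leech"
  unfolding leech_lattice_def even_unimodular_lattice_def
proof (intro conjI ballI standard_leech_unimodular standard_leech_even)
  show "\<exists>x\<in>standard_leech. x \<bullet> x = 4"
    using leech_basis_in[of 1] leech_basis_norms(1) by auto
  fix x assume x: "x \<in> standard_leech - {0}"
  obtain k :: int where k: "x \<bullet> x = 2 * of_int k" using standard_leech_even x by blast
  have "x \<bullet> x > 0" using x by simp
  then have "k > 0" using k by simp
  moreover have "k \<noteq> 1" using standard_leech_no_roots[of x] x k by auto
  ultimately have "k \<ge> 2" by simp
  then show "x \<bullet> x \<ge> 4" using k by simp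
qed

section \<open>The code and its optimality\<close>

lemma energy_of_distribution:
  fixes C :: "(real ^ 'n) set"
  assumes C: "spherical_code C" and ip: "inner_products C \<subseteq> {-1/2, -1/5, 1/10, 2/5}"
    and dist: "\<And>x. x \<in> C \<Longrightarrow> card {y \<in> C - {x}. x \<bullet> y = -1/2} = 352"
      "\<And>x. x \<in> C \<Longrightarrow> card {y \<in> C - {x}. x \<bullet> y = -1/5} = 4125"
      "\<And>x. x \<in> C \<Longrightarrow> card {y \<in> C - {x}. x \<bullet> y = 1/10} = 5600"
      "\<And>x. x \<in> C \<Longrightarrow> card {y \<in> C - {x}. x \<bullet> y = 2/5} = 1100"
  shows "energy h C = real (card C) * (352 * h (-1/2) + 4125 * h (-1/5) + 5600 * h (1/10) + 1100 * h (2/5))"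
proof -
  have fin: "finite C" using C by (simp add: spherical_code_def)
  have "{(x, y). x \<in> C \<and> y \<in> C \<and> x \<noteq> y} = Sigma C (\<lambda>x. C - {x})" by auto
  then have "energy h C = (\<Sum>x\<in>C. \<Sum>y\<in>C - {x}. h (x \<bullet> y))"
    unfolding energy_def using fin by (simp add: sum.Sigma)
  also have "\<dots> = (\<Sum>x\<in>C. 352 * h (-1/2) + 4125 * h (-1/5) + 5600 * h (1/10) + 1100 * h (2/5))"
  proof (rule sum.cong)
    fix x assume x: "x \<in> C"
    have "(\<Sum>y\<in>C - {x}. h (x \<bullet> y)) = (\<Sum>v\<in>{-1/2, -1/5, 1/10, 2/5}. real (card {y \<in> C - {x}. x \<bullet> y = v}) * h v)"
    proof (rule sum_by_values)
      show "(\<bullet>) x ` (C - {x}) \<subseteq> {-1/2, -1/5, 1/10, 2/5}"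
        using ip x by (auto simp: inner_products_def)
    qed (use fin in auto)
    then show "(\<Sum>y\<in>C - {x}. h (x \<bullet> y)) = 352 * h (-1/2) + 4125 * h (-1/5) + 5600 * h (1/10) + 1100 * h (2/5)"
      using dist[OF x] by simp
  qed simp
  finally show ?thesis by simp
qed

section \<open>Powers of linear forms as test functions for designs\<close>

lemma finite_exponents: "finite {m :: 'n::finite \<Rightarrow> nat. (\<Sum>i\<in>UNIV. m i) \<le> d}"
proof (rule finite_subset)
  show "{m :: 'n \<Rightarrow> nat. (\<Sum>i\<in>UNIV. m i) \<le> d} \<subseteq> PiE UNIV (\<lambda>_. {..d})"
  proof
    fix m :: "'n \<Rightarrow> nat" assume "m \<in> {m. (\<Sum>i\<in>UNIV. m i) \<le> d}"
    then have s: "(\<Sum>i\<in>UNIV. m i) \<le> d" by simp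
    have "m i \<le> d" for i using member_le_sum[of i UNIV m] s by simp
    then show "m \<in> PiE UNIV (\<lambda>_. {..d})" by auto
  qed
qed (intro finite_PiE, auto)

lemma polynomials_upto_monomial:
  fixes m :: "'n::finite \<Rightarrow> nat"
  assumes "(\<Sum>i\<in>UNIV. m i) \<le> d"
  shows "(\<lambda>x :: real ^ 'n. \<Prod>i\<in>UNIV. (x $ i) ^ m i) \<in> polynomials_upto d"
proof -
  have "(\<Sum>m'\<in>{m :: 'n \<Rightarrow> nat. (\<Sum>i\<in>UNIV. m i) \<le> d}. (if m' = m then 1 else 0) * (\<Prod>i\<in>UNIV. (x $ i) ^ m' i)) = (\<Prod>i\<in>UNIV. (x $ i) ^ m i)" for x :: "real ^ 'n"
  proof -
    have "(\<Sum>m'\<in>{m :: 'n \<Rightarrow> nat. (\<Sum>i\<in>UNIV. m i) \<le> d}. (if m' = m then 1 else 0) * (\<Prod>i\<in>UNIV. (x $ i) ^ m' i)) =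
        (\<Sum>m'\<in>{m :: 'n \<Rightarrow> nat. (\<Sum>i\<in>UNIV. m i) \<le> d}. if m' = m then (\<Prod>i\<in>UNIV. (x $ i) ^ m' i) else 0)"
      by (intro sum.cong) auto
    then show ?thesis using assms by (simp add: sum.delta[OF finite_exponents])
  qed
  then show ?thesis unfolding polynomials_upto_def by (auto intro!: exI[of _ "\<lambda>m'. if m' = m then 1 else 0"])
qed

lemma polynomials_upto_sum:
  fixes f :: "'a \<Rightarrow> real ^ 'n \<Rightarrow> real"
  assumes "\<And>a. a \<in> A \<Longrightarrow> f a \<in> polynomials_upto d"
  shows "(\<lambda>x. \<Sum>a\<in>A. k a * f a x) \<in> polynomials_upto d"
proof -
  have "\<forall>a\<in>A. \<exists>c. f a = (\<lambda>x. \<Sum>m\<in>{m :: 'n \<Rightarrow> nat. (\<Sum>i\<in>UNIV. m i) \<le> d}. c m * (\<Prod>i\<in>UNIV. (x $ i) ^ m i))"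
    using assms unfolding polynomials_upto_def by blast
  then obtain c where c: "\<And>a. a \<in> A \<Longrightarrow> f a = (\<lambda>x. \<Sum>m\<in>{m :: 'n \<Rightarrow> nat. (\<Sum>i\<in>UNIV. m i) \<le> d}. c a m * (\<Prod>i\<in>UNIV. (x $ i) ^ m i))"
    by (auto simp: bchoice_iff)
  have "(\<lambda>x. \<Sum>a\<in>A. k a * f a x) = (\<lambda>x. \<Sum>m\<in>{m :: 'n \<Rightarrow> nat. (\<Sum>i\<in>UNIV. m i) \<le> d}. (\<Sum>a\<in>A. k a * c a m) * (\<Prod>i\<in>UNIV. (x $ i) ^ m i))"
  proof
    fix x
    have "(\<Sum>a\<in>A. k a * f a x) = (\<Sum>a\<in>A. \<Sum>m\<in>{m :: 'n \<Rightarrow> nat. (\<Sum>i\<in>UNIV. m i) \<le> d}. k a * c a m * (\<Prod>i\<in>UNIV. (x $ i) ^ m i))"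
      by (intro sum.cong refl) (simp add: c sum_distrib_left mult.assoc)
    also have "\<dots> = (\<Sum>m\<in>{m :: 'n \<Rightarrow> nat. (\<Sum>i\<in>UNIV. m i) \<le> d}. (\<Sum>a\<in>A. k a * c a m) * (\<Prod>i\<in>UNIV. (x $ i) ^ m i))"
      by (subst sum.swap) (simp add: sum_distrib_right)
    finally show "(\<Sum>a\<in>A. k a * f a x) = (\<Sum>m\<in>{m :: 'n \<Rightarrow> nat. (\<Sum>i\<in>UNIV. m i) \<le> d}. (\<Sum>a\<in>A. k a * c a m) * (\<Prod>i\<in>UNIV. (x $ i) ^ m i))" .
  qed
  then show ?thesis unfolding polynomials_upto_def
    by (intro CollectI exI[of _ "\<lambda>m. \<Sum>a\<in>A. k a * c a m"] conjI TrueI)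
qed

lemma polynomials_upto_mult_coordinate:
  fixes p :: "real ^ 'n \<Rightarrow> real"
  assumes "p \<in> polynomials_upto d"
  shows "(\<lambda>x. x $ j * p x) \<in> polynomials_upto (Suc d)"
proof -
  obtain c where c: "p = (\<lambda>x. \<Sum>m\<in>{m :: 'n \<Rightarrow> nat. (\<Sum>i\<in>UNIV. m i) \<le> d}. c m * (\<Prod>i\<in>UNIV. (x $ i) ^ m i))"
    using assms unfolding polynomials_upto_def by blast
  have shift: "x $ j * (\<Prod>i\<in>UNIV. (x $ i) ^ m i) = (\<Prod>i\<in>UNIV. (x $ i) ^ (m(j := Suc (m j))) i)" for x and m :: "'n \<Rightarrow> nat"
    by (simp add: prod.remove[of UNIV j] mult.assoc)
  have "(\<lambda>x. \<Sum>m\<in>{m :: 'n \<Rightarrow> nat. (\<Sum>i\<in>UNIV. m i) \<le> d}. c m * (\<Prod>i\<in>UNIV. (x $ i) ^ (m(j := Suc (m j))) i)) \<in> polynomials_upto (Suc d)"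
  proof (intro polynomials_upto_sum polynomials_upto_monomial)
    fix m :: "'n \<Rightarrow> nat" assume m: "m \<in> {m. (\<Sum>i\<in>UNIV. m i) \<le> d}"
    have "(\<Sum>i\<in>UNIV. (m(j := Suc (m j))) i) = Suc (\<Sum>i\<in>UNIV. m i)"
      by (simp add: sum.remove[of UNIV j])
    then show "(\<Sum>i\<in>UNIV. (m(j := Suc (m j))) i) \<le> Suc d" using m by simp
  qed
  moreover have "(\<lambda>x. x $ j * p x) = (\<lambda>x. \<Sum>m\<in>{m :: 'n \<Rightarrow> nat. (\<Sum>i\<in>UNIV. m i) \<le> d}. c m * (\<Prod>i\<in>UNIV. (x $ i) ^ (m(j := Suc (m j))) i))"
    unfolding c shift[symmetric] by (simp add: sum_distrib_left mult.left_commute)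
  ultimately show ?thesis by simp
qed

lemma polynomials_upto_mono:
  fixes p :: "real ^ 'n \<Rightarrow> real"
  assumes "p \<in> polynomials_upto d" "d \<le> d'"
  shows "p \<in> polynomials_upto d'"
proof -
  obtain c where c: "p = (\<lambda>x. \<Sum>m\<in>{m :: 'n \<Rightarrow> nat. (\<Sum>i\<in>UNIV. m i) \<le> d}. c m * (\<Prod>i\<in>UNIV. (x $ i) ^ m i))"
    using assms(1) unfolding polynomials_upto_def by blast
  show ?thesis unfolding c
    by (intro polynomials_upto_sum polynomials_upto_monomial) (use assms(2) in auto)
qed

lemma inner_power_in_polynomials_upto:
  fixes u :: "real ^ 'n"
  assumes "k \<le> d"
  shows "(\<lambda>x. (x \<bullet> u) ^ k) \<in> polynomials_upto d"
proof -
  have "(\<lambda>x. (x \<bullet> u) ^ k) \<in> polynomials_upto k"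
  proof (induction k)
    case 0
    then show ?case using polynomials_upto_monomial[of "\<lambda>_. 0" 0] by simp
  next
    case (Suc k)
    have "(\<lambda>x. \<Sum>i\<in>UNIV. u $ i * (x $ i * (x \<bullet> u) ^ k)) \<in> polynomials_upto (Suc k)"
      by (intro polynomials_upto_sum polynomials_upto_mult_coordinate Suc)
    moreover have "(\<Sum>i\<in>UNIV. u $ i * (x $ i * (x \<bullet> u) ^ k)) = (x \<bullet> u) ^ Suc k" for x
      by (simp add: inner_vec_def[of x u] sum_distrib_right mult_ac)
    ultimately show ?case by simp
  qed
  then show ?thesis using assms polynomials_upto_mono by blast
qed

text \<open>The distribution is forced: the moments of order 0 to 3 around a point of a 5-design
  equal those of the sphere, and four inner products leave four unknowns in an invertible
  Vandermonde system.\<close>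

lemma design_distribution:
  fixes C :: "(real ^ 23) set"
  assumes des: "spherical_design 5 C" and card: "card C = 11178"
    and ip: "inner_products C \<subseteq> {-1/2, -1/5, 1/10, 2/5}" and x: "x \<in> C"
  shows "card {y \<in> C - {x}. x \<bullet> y = -1/2} = 352" "card {y \<in> C - {x}. x \<bullet> y = -1/5} = 4125"
    "card {y \<in> C - {x}. x \<bullet> y = 1/10} = 5600" "card {y \<in> C - {x}. x \<bullet> y = 2/5} = 1100"
proof -
  have C: "spherical_code C" using des by (simp add: spherical_design_def)
  have fin: "finite C" using C by (simp add: spherical_code_def)
  have n1: "norm x = 1" using C x by (auto simp: spherical_code_def)
  have mom: "(\<Sum>y\<in>C. (y \<bullet> x) ^ j) = 11178 * (LINT z|surface_measure. (z \<bullet> x) ^ j)" if "j \<le> 5" for j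
  proof -
    have "(\<Sum>y\<in>C. (y \<bullet> x) ^ j) / real (card C) = (LINT z|surface_measure. (z \<bullet> x) ^ j)"
      using des inner_power_in_polynomials_upto[OF that, of x] unfolding spherical_design_def by blast
    then show ?thesis using card by (simp add: field_simps)
  qed
  define n where "n v = real (card {y \<in> C - {x}. x \<bullet> y = v})" for v
  have s: "(\<Sum>y\<in>C. (y \<bullet> x) ^ j) = 1 + (n (-1/2) * (-1/2) ^ j + n (-1/5) * (-1/5) ^ j + n (1/10) * (1/10) ^ j + n (2/5) * (2/5) ^ j)" for j
  proof -
    have "(\<Sum>y\<in>C. (y \<bullet> x) ^ j) = (x \<bullet> x) ^ j + (\<Sum>y\<in>C - {x}. (x \<bullet> y) ^ j)"
      by (subst sum.remove[OF fin x]) (simp add: inner_commute)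
    also have "(\<Sum>y\<in>C - {x}. (x \<bullet> y) ^ j) = (\<Sum>v\<in>{-1/2, -1/5, 1/10, 2/5}. n v * v ^ j)"
      unfolding n_def
    proof (rule sum_by_values[where f="\<lambda>v. v ^ j"])
      show "(\<bullet>) x ` (C - {x}) \<subseteq> {-1/2, -1/5, 1/10, 2/5}"
        using ip x by (auto simp: inner_products_def)
    qed (use fin in auto)
    finally show ?thesis using n1 by (simp add: norm_eq_1)
  qed
  have e0: "1 + (n (-1/2) + n (-1/5) + n (1/10) + n (2/5)) = 11178" using s[of 0] card by simp
  have e1: "1 + (n (-1/2) * (-1/2) + n (-1/5) * (-1/5) + n (1/10) * (1/10) + n (2/5) * (2/5)) = 0"
    using s[of 1] mom[of 1] surface_integral_odd[of 1 x] by simp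
  \<comment> \<open>The value 486 is 11178 / 23, the second moment of a coordinate times the number
    of points.\<close>
  have e2: "1 + (n (-1/2) * (1/4) + n (-1/5) * (1/25) + n (1/10) * (1/100) + n (2/5) * (4/25)) = 486"
    using s[of 2] mom[of 2] surface_integral_even[of x 1] n1 sphere_moment_values(1) by (simp add: power2_eq_square)
  have e3: "1 + (n (-1/2) * (-1/8) + n (-1/5) * (-1/125) + n (1/10) * (1/1000) + n (2/5) * (8/125)) = 0"
    using s[of 3] mom[of 3] surface_integral_odd[of 3 x] by (simp add: power3_eq_cube)
  have "n (-1/2) = 352" "n (-1/5) = 4125" "n (1/10) = 5600" "n (2/5) = 1100"
    using e0 e1 e2 e3 by linarith+
  then show "card {y \<in> C - {x}. x \<bullet> y = -1/2} = 352" "card {y \<in> C - {x}. x \<bullet> y = -1/5} = 4125"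
    "card {y \<in> C - {x}. x \<bullet> y = 1/10} = 5600" "card {y \<in> C - {x}. x \<bullet> y = 2/5} = 1100"
    by (simp_all add: n_def)
qed

lemma design_distance_invariant:
  fixes C :: "(real ^ 23) set"
  assumes des: "spherical_design 5 C" and card: "card C = 11178"
    and ip: "inner_products C = {-1/2, -1/5, 1/10, 2/5}"
  shows "distance_invariant C" and "distance_distribution C = [352, 4125, 5600, 1100]"
proof -
  have C: "spherical_code C" using des by (simp add: spherical_design_def)
  have ne: "C \<noteq> {}" using card by auto
  \<comment> \<open>A point has inner product 1 with itself, so counting over \<open>C\<close> or
    over \<open>C - {x}\<close> agrees at any other value.\<close>
  have no_self: "{y \<in> C. x \<bullet> y = v} = {y \<in> C - {x}. x \<bullet> y = v}" if "x \<in> C" "v \<noteq> 1" for x v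
    using C that by (auto simp: spherical_code_def norm_eq_1)
  note d = design_distribution[OF des card equalityD1[OF ip]]
  have v: "(-1/2 :: real) \<noteq> 1" "(-1/5 :: real) \<noteq> 1" "(1/10 :: real) \<noteq> 1" "(2/5 :: real) \<noteq> 1" by simp_all
  have c: "card {y \<in> C. x \<bullet> y = -1/2} = 352" "card {y \<in> C. x \<bullet> y = -1/5} = 4125"
    "card {y \<in> C. x \<bullet> y = 1/10} = 5600" "card {y \<in> C. x \<bullet> y = 2/5} = 1100" if "x \<in> C" for x
    using d[OF that] by (simp_all only: no_self[OF that v(1)] no_self[OF that v(2)] no_self[OF that v(3)] no_self[OF that v(4)])
  show "distance_invariant C"
    unfolding distance_invariant_def ip using c by auto
  have the: "(THE a. \<forall>x\<in>C. card {y \<in> C. x \<bullet> y = t} = a) = k" if "\<And>x. x \<in> C \<Longrightarrow> card {y \<in> C. x \<bullet> y = t} = k" for t k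
    by (rule the_equality) (use that ne in auto)
  have "sorted_list_of_set (set [-1/2, -1/5, 1/10, 2/5]) = [-1/2, -1/5, 1/10, 2/5 :: real]"
    by (rule sorted_list_of_set.idem_if_sorted_distinct) auto
  then have sorted: "sorted_list_of_set {-1/2, -1/5, 1/10, 2/5} = [-1/2, -1/5, 1/10, 2/5 :: real]" by simp
  have "distance_distribution C = map (\<lambda>t. THE a. \<forall>x\<in>C. card {y \<in> C. x \<bullet> y = t} = a) [-1/2, -1/5, 1/10, 2/5]"
    unfolding distance_distribution_def ip sorted ..
  then show "distance_distribution C = [352, 4125, 5600, 1100]"
    by (simp only: list.map the[OF c(1)] the[OF c(2)] the[OF c(3)] the[OF c(4)])
qed

lemma isometry_inner:
  assumes "linear \<phi>" and "\<And>x. norm (\<phi> x) = norm x"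
  shows "\<phi> x \<bullet> \<phi> y = x \<bullet> y"
  unfolding dot_norm linear_add[OF assms(1), symmetric] assms(2) ..

text \<open>In the scale of the lattice the condition \<open>y \<bullet> w = sqrt 6 / 6\<close>
  reads \<open>x \<bullet> W = 2\<close>, so the code is a similar copy of
  \<open>leech_slice\<close>. Inner products change by the affine map from \<open>v\<close> to
  \<open>(v / 4 - 1/6) * (6/5)\<close>, which sends -1, 0, 1, 2 to -1/2, -1/5, 1/10, 2/5.\<close>

lemma C_sqrt6_6_code:
  assumes leech: "leech_lattice \<Lambda>" and W: "W \<in> \<Lambda>" "norm W = sqrt 6"
    and \<phi>: "coordinates_on_complement (W /\<^sub>R sqrt 6) \<phi>"
  shows "spherical_code (C_sqrt6_6 \<Lambda> W \<phi>)" and "card (C_sqrt6_6 \<Lambda> W \<phi>) = 11178"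
    and "inner_products (C_sqrt6_6 \<Lambda> W \<phi>) \<subseteq> {-1/2, -1/5, 1/10, 2/5}"
    and "energy h (C_sqrt6_6 \<Lambda> W \<phi>) = 11178 * (352 * h (-1/2) + 4125 * h (-1/5) + 5600 * h (1/10) + 1100 * h (2/5))"
proof -
  define S where "S = leech_slice \<Lambda> W"
  define C where "C = C_sqrt6_6 \<Lambda> W \<phi>"
  \<comment> \<open>Projection of \<open>x / 2\<close> along \<open>W\<close>, rescaled to unit
    length: \<open>1/6\<close> is \<open>\<alpha> / sqrt 6\<close> and \<open>5/6\<close> is
    \<open>1 - \<alpha>^2\<close> for \<open>\<alpha> = sqrt 6 / 6\<close>.\<close>
  define e where "e x = (x /\<^sub>R 2 - (1/6) *\<^sub>R W) /\<^sub>R sqrt (5/6)" for x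
  have e_alt: "e x = ((1/2) *\<^sub>R x - (1/6) *\<^sub>R W) /\<^sub>R sqrt (5/6)" for x
    unfolding e_def by (simp only: inverse_eq_divide)
  have WW: "W \<bullet> W = 6" using W(2) by (simp add: norm_eq_sqrt_inner)
  have lin: "linear \<phi>" and iso: "\<And>x. norm (\<phi> x) = norm x" and ran: "range \<phi> = {v. v \<bullet> (W /\<^sub>R sqrt 6) = 0}"
    using \<phi> by (auto simp: coordinates_on_complement_def)
  have inj: "inj \<phi>"
  proof (rule injI)
    fix x y assume "\<phi> x = \<phi> y"
    then have "\<phi> (x - y) = 0" by (simp add: linear_diff[OF lin])
    then have "norm (x - y) = 0" using iso[of "x - y"] by simp
    then show "x = y" by simp
  qed
  have S: "x \<in> S \<longleftrightarrow> x \<in> \<Lambda> \<and> x \<bullet> x = 4 \<and> x \<bullet> W = 2" for x by (simp add: S_def leech_slice_def shell_def)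
  have s6: "sqrt 6 * sqrt 6 = (6 :: real)" by simp
  have derived: "derived_code (sqrt 6 / 6) (W /\<^sub>R sqrt 6) (kissing_code \<Lambda>) = e ` S"
  proof -
    have a: "1 - (sqrt 6 / 6)\<^sup>2 = (5/6 :: real)" by (simp add: power_divide)
    have b: "(sqrt 6 / 6) *\<^sub>R (W /\<^sub>R sqrt 6) = (1/6) *\<^sub>R W" by simp
    have cond: "(x /\<^sub>R 2) \<bullet> (W /\<^sub>R sqrt 6) = sqrt 6 / 6 \<longleftrightarrow> x \<bullet> W = 2" for x
    proof -
      have "(x /\<^sub>R 2) \<bullet> (W /\<^sub>R sqrt 6) = (x \<bullet> W) / (2 * sqrt 6)" by (simp add: field_simps)
      moreover have "(x \<bullet> W) / (2 * sqrt 6) = sqrt 6 / 6 \<longleftrightarrow> (x \<bullet> W) * 6 = sqrt 6 * (2 * sqrt 6)"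
        by (rule frac_eq_eq) auto
      moreover have "sqrt 6 * (2 * sqrt 6) = (12 :: real)" using s6 by linarith
      ultimately show ?thesis by linarith
    qed
    have n: "norm x = 2 \<longleftrightarrow> x \<bullet> x = 4" for x :: "real ^ 24"
      by (metis norm_eq_sqrt_inner real_sqrt_four real_sqrt_eq_iff)
    have "derived_code (sqrt 6 / 6) (W /\<^sub>R sqrt 6) (kissing_code \<Lambda>) = {e x | x. x \<in> \<Lambda> \<and> norm x = 2 \<and> (x /\<^sub>R 2) \<bullet> (W /\<^sub>R sqrt 6) = sqrt 6 / 6}"
      unfolding derived_code_def kissing_code_def a b e_def by blast
    then show ?thesis unfolding cond n using S by auto
  qed
  have ee: "e x \<bullet> e y = (x \<bullet> y / 4 - 1/6) * (6/5)" if "x \<in> S" "y \<in> S" for x y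
  proof -
    have "e x \<bullet> e y = (((1/2) *\<^sub>R x - (1/6) *\<^sub>R W) \<bullet> ((1/2) *\<^sub>R y - (1/6) *\<^sub>R W)) * (inverse (sqrt (5/6)) * inverse (sqrt (5/6)))"
      unfolding e_alt by (simp only: inner_scaleR_left inner_scaleR_right mult_ac)
    also have "inverse (sqrt (5/6)) * inverse (sqrt (5/6)) = (6/5 :: real)"
      by (simp flip: inverse_mult_distrib)
    also have "((1/2) *\<^sub>R x - (1/6) *\<^sub>R W) \<bullet> ((1/2) *\<^sub>R y - (1/6) *\<^sub>R W) = x \<bullet> y / 4 - 1/6"
      using that WW by (simp add: S inner_diff_left inner_diff_right inner_commute)
    finally show ?thesis .
  qed
  have "e x \<in> range \<phi>" if "x \<in> S" for x
    unfolding ran e_alt using that WW by (simp add: S inner_diff_left)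
  then have "\<forall>x\<in>S. \<exists>c. \<phi> c = e x" by (metis imageE)
  \<comment> \<open>\<open>f\<close> pulls the projected slice back to 23-space; it is injective on
    \<open>S\<close>, and inner products are unchanged by the isometry.\<close>
  then obtain f where f: "\<And>x. x \<in> S \<Longrightarrow> \<phi> (f x) = e x" by metis
  have ff: "f x \<bullet> f y = (x \<bullet> y / 4 - 1/6) * (6/5)" if "x \<in> S" "y \<in> S" for x y
    using isometry_inner[OF lin iso, of "f x" "f y"] f that ee by simp
  have CS: "C = f ` S"
  proof
    show "C \<subseteq> f ` S"
    proof
      fix c assume "c \<in> C"
      then obtain x where x: "x \<in> S" "\<phi> c = e x" by (auto simp: C_def C_sqrt6_6_def derived)
      then have "c = f x" using inj f by (metis injD)
      then show "c \<in> f ` S" using x by simp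
    qed
    show "f ` S \<subseteq> C" using f by (auto simp: C_def C_sqrt6_6_def derived)
  qed
  have inj_f: "inj_on f S"
  proof (rule inj_onI)
    fix x y assume xy: "x \<in> S" "y \<in> S" "f x = f y"
    then have "e x = e y" using f by metis
    then show "x = y" by (simp add: e_def)
  qed
  have cardS: "card S = 11178" unfolding S_def by (rule card_leech_slice[OF leech W(1) WW])
  then have finS: "finite S" by (metis card.infinite zero_neq_numeral)
  have card: "card C = 11178" using card_image[OF inj_f] cardS CS by simp
  have code: "spherical_code C"
  proof -
    have "f x \<bullet> f x = 1" if "x \<in> S" for x using ff[OF that that] that by (simp add: S)
    then show ?thesis unfolding spherical_code_def CS using finS by (auto simp: norm_eq_1)
  qed
  have ip: "inner_products C \<subseteq> {-1/2, -1/5, 1/10, 2/5}"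
  proof
    fix t assume "t \<in> inner_products C"
    then obtain x y where xy: "x \<in> S" "y \<in> S" "f x \<noteq> f y" "t = f x \<bullet> f y" by (auto simp: inner_products_def CS)
    have "x \<bullet> y \<in> {-1, 0, 1, 2}" using leech_slice_inner[OF leech W(1) WW, of x y] xy by (auto simp: S_def)
    then show "t \<in> {-1/2, -1/5, 1/10, 2/5}" using ff[OF xy(1,2)] xy(4) by auto
  qed
  have dist: "card {c' \<in> C - {f y}. f y \<bullet> c' = (v / 4 - 1/6) * (6/5)} = card {x \<in> S - {y}. x \<bullet> y = v}" if y: "y \<in> S" for y v
  proof -
    have "{c' \<in> C - {f y}. f y \<bullet> c' = (v / 4 - 1/6) * (6/5)} = f ` {x \<in> S - {y}. x \<bullet> y = v}"
      unfolding CS using ff y inj_f by (auto simp: inner_commute inj_on_eq_iff)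
    moreover have "inj_on f {x \<in> S - {y}. x \<bullet> y = v}" by (rule inj_on_subset[OF inj_f]) auto
    ultimately show ?thesis by (simp add: card_image)
  qed
  have d: "card {y \<in> C - {x}. x \<bullet> y = -1/2} = 352" "card {y \<in> C - {x}. x \<bullet> y = -1/5} = 4125"
    "card {y \<in> C - {x}. x \<bullet> y = 1/10} = 5600" "card {y \<in> C - {x}. x \<bullet> y = 2/5} = 1100" if "x \<in> C" for x
  proof -
    have "x \<in> f ` S" using that CS by simp
    then obtain y where y: "y \<in> S" "x = f y" by (rule imageE)
    note D = leech_slice_distribution[OF leech W(1) WW y(1)[unfolded S_def], folded S_def]
    show "card {y \<in> C - {x}. x \<bullet> y = -1/2} = 352" "card {y \<in> C - {x}. x \<bullet> y = -1/5} = 4125"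
      "card {y \<in> C - {x}. x \<bullet> y = 1/10} = 5600" "card {y \<in> C - {x}. x \<bullet> y = 2/5} = 1100"
      using dist[OF y(1), of "-1"] dist[OF y(1), of 0] dist[OF y(1), of 1] dist[OF y(1), of 2] D y(2) by simp_all
  qed
  show "spherical_code (C_sqrt6_6 \<Lambda> W \<phi>)" "card (C_sqrt6_6 \<Lambda> W \<phi>) = 11178"
    "inner_products (C_sqrt6_6 \<Lambda> W \<phi>) \<subseteq> {-1/2, -1/5, 1/10, 2/5}"
    using code card ip by (simp_all add: C_def)
  show "energy h (C_sqrt6_6 \<Lambda> W \<phi>) = 11178 * (352 * h (-1/2) + 4125 * h (-1/5) + 5600 * h (1/10) + 1100 * h (2/5))"
    using energy_of_distribution[OF code ip d, of h] card by (simp add: C_def)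
qed

text \<open>The hyperplane orthogonal to \<open>w\<close> has dimension 23, so an isometry exists;
  the witness for the minimum needs one.\<close>

lemma coordinates_on_complement_exist:
  assumes "w \<noteq> 0"
  shows "\<exists>\<phi>. coordinates_on_complement w \<phi>"
proof -
  have "dim {v. v \<bullet> w = 0} = 23" using dim_hyperplane[OF assms] by (simp add: inner_commute)
  then have "dim (UNIV :: (real ^ 23) set) = dim {v. v \<bullet> w = 0}" by simp
  then obtain f where f: "linear f" "f ` (UNIV :: (real ^ 23) set) = {v. v \<bullet> w = 0}" "\<And>x. norm (f x) = norm x"
    by (rule isometry_subspaces[OF subspace_UNIV subspace_hyperplane2]) (rule that, auto)
  have "coordinates_on_complement w f" unfolding coordinates_on_complement_def using f by simp
  then show ?thesis by blast
qed

theorem theorem7p4: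
  fixes T :: "real set"
  assumes "T = {-1/2<..<-1/5} \<or> T = {-1/5<..<1/10} \<or> T = {1/10<..<2/5}"
  shows
    "(\<forall>h. absolutely_monotone h \<and> (\<forall>t\<in>{-1<..<1}. (deriv ^^ 6) h t > 0) \<longrightarrow>
        min_energy TYPE(23) h 11178 T =
          11178 * (352 * h (-1/2) + 4125 * h (-1/5) + 5600 * h (1/10) + 1100 * h (2/5)) \<and>
        (\<exists>C :: (real ^ 23) set. avoiding_code T C \<and> card C = 11178 \<and>
           energy h C = min_energy TYPE(23) h 11178 T) \<and>
        (\<forall>C :: (real ^ 23) set. avoiding_code T C \<and> card C = 11178 \<longrightarrow>
           energy h C \<ge> min_energy TYPE(23) h 11178 T \<and>
           (spherical_design 5 C \<and> inner_products C = {-1/2, -1/5, 1/10, 2/5} \<longrightarrow>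
              distance_invariant C \<and> distance_distribution C = [352, 4125, 5600, 1100] \<and>
              energy h C = min_energy TYPE(23) h 11178 T)))
     \<and> (\<forall>\<Lambda> W \<phi>. leech_lattice \<Lambda> \<and> W \<in> \<Lambda> \<and> norm W = sqrt 6 \<and>
          coordinates_on_complement (W /\<^sub>R sqrt 6) \<phi> \<longrightarrow>
          avoiding_universally_optimal T (C_sqrt6_6 \<Lambda> W \<phi>))"
proof -
  have T: "{-1/2, -1/5, 1/10, 2/5} \<inter> T = {}" using assms by auto
  define E where "E h = 11178 * (352 * h (-1/2) + 4125 * h (-1/5) + 5600 * h (1/10) + 1100 * h (2/5))" for h :: "real \<Rightarrow> real"
  have lower: "E h \<le> energy h C" if "absolutely_monotone h" "avoiding_code T C" "card C = 11178" for h and C :: "(real ^ 23) set"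
    unfolding E_def by (rule energy_lower_bound[OF assms that])
  have code: "avoiding_code T (C_sqrt6_6 \<Lambda> W \<phi>)" "card (C_sqrt6_6 \<Lambda> W \<phi>) = 11178" "energy h (C_sqrt6_6 \<Lambda> W \<phi>) = E h"
    if "leech_lattice \<Lambda>" "W \<in> \<Lambda>" "norm W = sqrt 6" "coordinates_on_complement (W /\<^sub>R sqrt 6) \<phi>" for \<Lambda> W \<phi> h
    using C_sqrt6_6_code[OF that] T by (auto simp: avoiding_code_def E_def)
  \<comment> \<open>Row 23 has the scaled squared length 48, hence squared length 6, as required of
    \<open>W\<close>.\<close>
  define W0 where "W0 = leech_basis 23"
  have W0: "W0 \<in> standard_leech" "norm W0 = sqrt 6"
    using leech_basis_in[of 23] leech_basis_norms(2) by (simp_all add: W0_def norm_eq_sqrt_inner)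
  then have "W0 /\<^sub>R sqrt 6 \<noteq> 0" by auto
  then obtain \<phi>0 where \<phi>0: "coordinates_on_complement (W0 /\<^sub>R sqrt 6) \<phi>0"
    using coordinates_on_complement_exist by blast
  define C0 where "C0 = C_sqrt6_6 standard_leech W0 \<phi>0"
  have C0: "avoiding_code T C0" "card C0 = 11178" "energy h C0 = E h" for h
    unfolding C0_def by (rule code[OF leech_lattice_standard W0 \<phi>0])+
  \<comment> \<open>\<open>C0\<close> attains the value and \<open>lower\<close> bounds every
    competitor, which identifies the \<open>Least\<close>.\<close>
  have min: "min_energy TYPE(23) h 11178 T = E h" if "absolutely_monotone h" for h
    unfolding min_energy_def
  proof (rule Least_equality)
    show "\<exists>C :: (real ^ 23) set. avoiding_code T C \<and> card C = 11178 \<and> E h = energy h C"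
      using C0 by (intro exI[of _ C0]) simp
    show "E h \<le> y" if "\<exists>C :: (real ^ 23) set. avoiding_code T C \<and> card C = 11178 \<and> y = energy h C" for y
      using that lower[OF \<open>absolutely_monotone h\<close>] by blast
  qed
  have design: "energy h C = E h" if des: "spherical_design 5 C" "inner_products C = {-1/2, -1/5, 1/10, 2/5}" "card C = 11178" for h and C :: "(real ^ 23) set"
  proof -
    have "spherical_code C" using des(1) by (simp add: spherical_design_def)
    then have "energy h C = real (card C) * (352 * h (-1/2) + 4125 * h (-1/5) + 5600 * h (1/10) + 1100 * h (2/5))"
      by (rule energy_of_distribution[OF _ equalityD1[OF des(2)] design_distribution[OF des(1,3) equalityD1[OF des(2)]]])
    then show ?thesis using des(3) by (simp add: E_def)
  qed
  show ?thesis
  proof (intro conjI allI impI)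
    fix h assume "absolutely_monotone h \<and> (\<forall>t\<in>{-1<..<1}. (deriv ^^ 6) h t > 0)"
    then have h: "absolutely_monotone h" by blast
    show "min_energy TYPE(23) h 11178 T = 11178 * (352 * h (-1/2) + 4125 * h (-1/5) + 5600 * h (1/10) + 1100 * h (2/5))"
      using min[OF h] by (simp add: E_def)
    show "\<exists>C :: (real ^ 23) set. avoiding_code T C \<and> card C = 11178 \<and> energy h C = min_energy TYPE(23) h 11178 T"
      using C0 min[OF h] by (intro exI[of _ C0]) simp
    fix C :: "(real ^ 23) set" assume C: "avoiding_code T C \<and> card C = 11178"
    show "energy h C \<ge> min_energy TYPE(23) h 11178 T" using lower[OF h, of C] C min[OF h] by simp
    assume des: "spherical_design 5 C \<and> inner_products C = {-1/2, -1/5, 1/10, 2/5}"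
    show "distance_invariant C" "distance_distribution C = [352, 4125, 5600, 1100]"
      using design_distance_invariant[of C] des C by blast+
    show "energy h C = min_energy TYPE(23) h 11178 T" using design[of C h] des C min[OF h] by simp
  next
    fix \<Lambda> W \<phi>
    assume "leech_lattice \<Lambda> \<and> W \<in> \<Lambda> \<and> norm W = sqrt 6 \<and> coordinates_on_complement (W /\<^sub>R sqrt 6) \<phi>"
    then have L: "leech_lattice \<Lambda>" "W \<in> \<Lambda>" "norm W = sqrt 6" "coordinates_on_complement (W /\<^sub>R sqrt 6) \<phi>" by blast+
    show "avoiding_universally_optimal T (C_sqrt6_6 \<Lambda> W \<phi>)"
      unfolding avoiding_universally_optimal_def using code[OF L] lower by metis
  qed
qed

end
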